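(* Let $R$ be a commutative local ring with principal maximal ideal $\mathfrak{m}=(p)\neq0$ such that $\mathfrak{m}^2=0$, and let $\mathscr{C}$ be the category of finitely generated free $R$-modules. Suppose moreover that $2p=0$. Let $n\geq3$ be an integer, let $\Sigma\colon\mathscr{C}\to\mathscr{C}$ be the identity functor, and let $\mathscr{N}$ be the $n$-angulation of $(\mathscr{C},\Sigma)$ consisting of all $n$-$\Sigma$-sequences isomorphic to a direct sum $C_\bullet\oplus F(p)_\bullet$, where $C_\bullet$ is a contractible candidate $n$-angle in $\mathscr{C}$, $F$ is a free module in $\mathscr{C}$ and $F(p)_\bullet$ is the $n$-$\Sigma$-sequence $F\xrightarrow{p}F\xrightarrow{p}\cdots\xrightarrow{p}F\xrightarrow{p}\Sigma F$. If $n$ is odd and there exists $d\in\mathbb{Z}$ such that $d\cdot1_R\in\mathfrak{m}\setminus\{0\}$, then the $n$-angulated category $(\mathscr{C},\Sigma,\mathscr{N})$ is not algebraic.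
   Context: **$n$-angulated categories.** Let $\mathscr{C}$ be an additive category with an automorphism $\Sigma\colon\mathscr{C}\to\mathscr{C}$, and let $n\geq 3$ be an integer. An $n$-$\Sigma$-sequence is a sequence $A_\bullet\colon A_1\xrightarrow{\alpha_1}A_2\xrightarrow{\alpha_2}\cdots\xrightarrow{\alpha_{n-1}}A_n\xrightarrow{\alpha_n}\Sigma A_1$. Its left rotation is $A_2\xrightarrow{\alpha_2}A_3\to\cdots\xrightarrow{\alpha_n}\Sigma A_1\xrightarrow{(-1)^n\Sigma\alpha_1}\Sigma A_2$. A morphism $A_\bullet\to B_\bullet$ is a sequence $(\varphi_1,\dots,\varphi_n)$, $\varphi_i\colon A_i\to B_i$, with $\varphi_{i+1}\alpha_i=\beta_i\varphi_i$ for $1\le i\le n$, where $\varphi_{n+1}:=\Sigma\varphi_1$; it is an isomorphism if all $\varphi_i$ are. A candidate $n$-angle is an $n$-$\Sigma$-sequence with $\alpha_{i+1}\alpha_i=0$ for $1\le i\le n-1$ and $(\Sigma\alpha_1)\alpha_n=0$. It is contractible if there are $\Theta_i\colon A_{i+1}\to A_i$ ($1\le i\le n$, $A_{n+1}:=\Sigma A_1$) with $1_{A_i}=\Theta_i\alpha_i+\alpha_{i-1}\Theta_{i-1}$ for $2\le i\le n$ and $1_{\Sigma A_1}=(\Sigma\Theta_1)(\Sigma\alpha_1)+\alpha_n\Theta_n$. A collection $\mathscr{N}$ of $n$-$\Sigma$-sequences (called $n$-angles) is an $n$-angulation, and $(\mathscr{C},\Sigma,\mathscr{N})$ is $n$-angulated,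 if: (N1) $\mathscr{N}$ is closed under direct sums, direct summands and isomorphisms; it contains $A\xrightarrow{1}A\to0\to\cdots\to0\to\Sigma A$ for all $A$; every morphism is the first morphism of a member of $\mathscr{N}$. (N2) A sequence is in $\mathscr{N}$ iff its left rotation is. (N3) Given $A_\bullet,B_\bullet\in\mathscr{N}$ and $\varphi_1,\varphi_2$ with $\varphi_2\alpha_1=\beta_1\varphi_1$, there are $\varphi_3,\dots,\varphi_n$ such that $(\varphi_1,\dots,\varphi_n)$ is a morphism $A_\bullet\to B_\bullet$. (N4) In (N3) these can be chosen so that the mapping cone $A_2\oplus B_1\to A_3\oplus B_2\to\cdots\to\Sigma A_1\oplus B_n\to\Sigma A_2\oplus\Sigma B_1$, with maps $\left[\begin{smallmatrix}-\alpha_{i+1}&0\\ \varphi_{i+1}&\beta_i\end{smallmatrix}\right]$ for $1\le i\le n-1$ and last map $\left[\begin{smallmatrix}-\Sigma\alpha_1&0\\ \Sigma\varphi_1&\beta_n\end{smallmatrix}\right]$, belongs to $\mathscr{N}$. **$(n-2)$-exact categories.** Let $\mathscr{E}$ be an additive category. A complex $A_1\to\cdots\to A_n\to0$ in $\mathscr{E}$ is right $(n-2)$-exact if for every $A\in\mathscr{E}$ the sequence $0\to\mathrm{Hom}(A_n,A)\to\cdots\to\mathrm{Hom}(A_1,A)$ is exact; left $(n-2)$-exact sequences are defined dually. A complex $0\to A_1\to\cdots\to A_n\to0$ is an $(n-2)$-exact sequence if it is both right and left $(n-2)$-exact. A morphism of complexes $(\varphi_1,\dots,\varphi_{n-1})$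 from $A_1\xrightarrow{\alpha_1}\cdots\xrightarrow{\alpha_{n-2}}A_{n-1}$ to $B_1\xrightarrow{\beta_1}\cdots\xrightarrow{\beta_{n-2}}B_{n-1}$ is an $(n-2)$-pushout diagram (of the top row along $\varphi_1$) if its mapping cone $$A_1\xrightarrow{\left[\begin{smallmatrix}-\alpha_1\\ \varphi_1\end{smallmatrix}\right]}A_2\oplus B_1\xrightarrow{\left[\begin{smallmatrix}-\alpha_2&0\\ \varphi_2&\beta_1\end{smallmatrix}\right]}\cdots\to A_{n-1}\oplus B_{n-2}\xrightarrow{\left[\begin{smallmatrix}\varphi_{n-1}&\beta_{n-2}\end{smallmatrix}\right]}B_{n-1}\to0$$ is right $(n-2)$-exact; $(n-2)$-pullback diagrams are defined dually. A morphism of $(n-2)$-exact sequences $(f_1,\dots,f_n)$ is a weak isomorphism if $f_k$ and $f_{k+1}$ are isomorphisms for some $k\in\{1,\dots,n\}$, where $f_{n+1}:=f_1$. An $(n-2)$-exact structure on $\mathscr{E}$ is a class $\mathcal{X}$ of $(n-2)$-exact sequences (called admissible; the first map $A_1\to A_2$ of an admissible sequence is an admissible monomorphism and the last map $A_{n-1}\to A_n$ an admissible epimorphism), closed under weak isomorphisms, such that: (E0) the zero sequence is admissible; (E1) admissible monomorphisms are closed under composition; (E1$^{op}$) admissible epimorphisms are closed under composition; (E2) for each admissible sequence $A_1\to\cdots\to A_n$ and each morphism $f\colon A_1\to B_1$ there is an $(n-2)$-pushout diagram of $A_1\to\cdots\to A_{n-1}$ along $f$ whose bottom row begins with an admissible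 monomorphism $B_1\to B_2$; (E2$^{op}$) the dual of (E2). Then $(\mathscr{E},\mathcal{X})$ is an $(n-2)$-exact category. An object $I$ is $\mathcal{X}$-injective if $\mathrm{Hom}(B,I)\to\mathrm{Hom}(A,I)$ is surjective for every admissible monomorphism $A\to B$; $\mathcal{X}$-projectives are defined dually. $(\mathscr{E},\mathcal{X})$ is Frobenius if for each $A\in\mathscr{E}$ there are admissible sequences $0\to A\to I_1\to\cdots\to I_{n-2}\to B\to0$ with all $I_j$ $\mathcal{X}$-injective and $0\to C\to P_1\to\cdots\to P_{n-2}\to A\to0$ with all $P_j$ $\mathcal{X}$-projective, and the classes of $\mathcal{X}$-projectives and $\mathcal{X}$-injectives coincide. **Natural $n$-angulation.** For a Frobenius $(n-2)$-exact category, the stable category $\underline{\mathscr{E}}$ has the same objects as $\mathscr{E}$ and morphisms taken modulo those factoring through $\mathcal{X}$-injectives. Choosing for each $A$ an admissible sequence $0\to A\to I_1\to\cdots\to I_{n-2}\to\Sigma A\to0$ with all $I_j$ $\mathcal{X}$-injective defines an autoequivalence $\Sigma$ of $\underline{\mathscr{E}}$ (treated as an automorphism, as is usual for stable categories). For each $f\colon A\to B$ in $\mathscr{E}$ there is a commutative diagram with admissible rows from $0\to A\to I_1\to\cdots\to I_{n-2}\to\Sigma A\to0$ to $0\to B\to C_1\to\cdots\to C_{n-2}\to\Sigma A\to0$ that is $f$ on the first terms, the identity on $\Sigma A$, and whose restriction to the first $n-1$ columns is an $(n-2)$-pushout diagram. The $n$-angles of $\underline{\mathscr{E}}$ are the sequences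 isomorphic in $\underline{\mathscr{E}}$ to some $A\xrightarrow{f}B\to C_1\to\cdots\to C_{n-2}\to\Sigma A$ so obtained; this is known to be an $n$-angulation of $\underline{\mathscr{E}}$. An $n$-angulated category is algebraic if it is equivalent, as an $n$-angulated category (i.e. via an additive equivalence $G$ with a natural isomorphism $G\Sigma\cong\Sigma G$ carrying $n$-angles to $n$-angles), to the stable category of a Frobenius $(n-2)$-exact category with its natural $n$-angulation. *)

theory Defs
  imports "HOL-Algebra.Module" "HOL-Algebra.Ideal_Product"
begin

section \<open>Additive categories\<close>

text \<open>Only the values on \<open>Obj\<close> and \<open>Arr\<close> matter; outside them the operations are arbitrary.\<close>

record ('o, 'm) cat =
  Obj :: "'o set"
  Arr :: "'m set"
  Dom :: "'m \<Rightarrow> 'o"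
  Cod :: "'m \<Rightarrow> 'o"
  Ident :: "'o \<Rightarrow> 'm"
  Comp :: "'m \<Rightarrow> 'm \<Rightarrow> 'm"  (infixr \<open>\<bullet>\<index>\<close> 75)
  Add :: "'m \<Rightarrow> 'm \<Rightarrow> 'm"  (infixl \<open>\<boxplus>\<index>\<close> 65)
  ZeroMor :: "'o \<Rightarrow> 'o \<Rightarrow> 'm"

definition Hom :: "('o, 'm) cat \<Rightarrow> 'o \<Rightarrow> 'o \<Rightarrow> 'm set" where
  "Hom C A B = {f \<in> Arr C. Dom C f = A \<and> Cod C f = B}"

locale category =
  fixes C :: "('o, 'm) cat" (structure)
  assumes Dom_Obj: "f \<in> Arr C \<Longrightarrow> Dom C f \<in> Obj C"
    and Cod_Obj: "f \<in> Arr C \<Longrightarrow> Cod C f \<in> Obj C"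
    and Ident_Hom: "A \<in> Obj C \<Longrightarrow> Ident C A \<in> Hom C A A"
    and Comp_Hom: "f \<in> Hom C A B \<Longrightarrow> g \<in> Hom C B D \<Longrightarrow> g \<bullet> f \<in> Hom C A D"
    and Ident_right: "f \<in> Hom C A B \<Longrightarrow> f \<bullet> Ident C A = f"
    and Ident_left: "f \<in> Hom C A B \<Longrightarrow> Ident C B \<bullet> f = f"
    and Comp_assoc: "f \<in> Hom C A B \<Longrightarrow> g \<in> Hom C B D \<Longrightarrow> h \<in> Hom C D E \<Longrightarrow>
      (h \<bullet> g) \<bullet> f = h \<bullet> (g \<bullet> f)"

definition hom_group :: "('o, 'm) cat \<Rightarrow> 'o \<Rightarrow> 'o \<Rightarrow> 'm monoid" where
  "hom_group C A B = \<lparr>carrier = Hom C A B, monoid.mult = Add C, one = ZeroMor C A B\<rparr>"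

definition neg :: "('o, 'm) cat \<Rightarrow> 'm \<Rightarrow> 'm" where
  "neg C f = inv\<^bsub>hom_group C (Dom C f) (Cod C f)\<^esub> f"

definition is_zero_object :: "('o, 'm) cat \<Rightarrow> 'o \<Rightarrow> bool" where
  "is_zero_object C Z \<longleftrightarrow> Z \<in> Obj C \<and>
     (\<forall>A\<in>Obj C. (\<exists>!f. f \<in> Hom C Z A) \<and> (\<exists>!f. f \<in> Hom C A Z))"

text \<open>\<open>S\<close> is the biproduct of \<open>A\<close> and \<open>B\<close> with injections \<open>j1\<close>, \<open>j2\<close> and projections \<open>q1\<close>, \<open>q2\<close>.\<close>

definition is_biproduct ::
  "('o, 'm) cat \<Rightarrow> 'o \<Rightarrow> 'o \<Rightarrow> 'o \<Rightarrow> 'm \<Rightarrow> 'm \<Rightarrow> 'm \<Rightarrow> 'm \<Rightarrow> bool" where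
  "is_biproduct C A B S j1 j2 q1 q2 \<longleftrightarrow>
     j1 \<in> Hom C A S \<and> j2 \<in> Hom C B S \<and> q1 \<in> Hom C S A \<and> q2 \<in> Hom C S B \<and>
     q1 \<bullet>\<^bsub>C\<^esub> j1 = Ident C A \<and> q2 \<bullet>\<^bsub>C\<^esub> j2 = Ident C B \<and>
     q1 \<bullet>\<^bsub>C\<^esub> j2 = ZeroMor C B A \<and> q2 \<bullet>\<^bsub>C\<^esub> j1 = ZeroMor C A B \<and>
     (j1 \<bullet>\<^bsub>C\<^esub> q1) \<boxplus>\<^bsub>C\<^esub> (j2 \<bullet>\<^bsub>C\<^esub> q2) = Ident C S"

locale additive_category = category +
  assumes Hom_group: "A \<in> Obj C \<Longrightarrow> B \<in> Obj C \<Longrightarrow> comm_group (hom_group C A B)"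
    and Comp_Add_left: "f \<in> Hom C A B \<Longrightarrow> g \<in> Hom C B D \<Longrightarrow> h \<in> Hom C B D \<Longrightarrow>
      (g \<boxplus> h) \<bullet> f = (g \<bullet> f) \<boxplus> (h \<bullet> f)"
    and Comp_Add_right: "f \<in> Hom C A B \<Longrightarrow> g \<in> Hom C A B \<Longrightarrow> h \<in> Hom C B D \<Longrightarrow>
      h \<bullet> (f \<boxplus> g) = (h \<bullet> f) \<boxplus> (h \<bullet> g)"
    and zero_object: "\<exists>Z. is_zero_object C Z"
    and biproducts: "A \<in> Obj C \<Longrightarrow> B \<in> Obj C \<Longrightarrow>
      \<exists>S j1 j2 q1 q2. is_biproduct C A B S j1 j2 q1 q2"

definition is_iso :: "('o, 'm) cat \<Rightarrow> 'm \<Rightarrow> bool" where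
  "is_iso C f \<longleftrightarrow> f \<in> Arr C \<and> (\<exists>g \<in> Hom C (Cod C f) (Dom C f).
     g \<bullet>\<^bsub>C\<^esub> f = Ident C (Dom C f) \<and> f \<bullet>\<^bsub>C\<^esub> g = Ident C (Cod C f))"

definition op_cat :: "('o, 'm) cat \<Rightarrow> ('o, 'm) cat" where
  "op_cat C = \<lparr>Obj = Obj C, Arr = Arr C, Dom = Cod C, Cod = Dom C, Ident = Ident C,
     Comp = (\<lambda>g f. f \<bullet>\<^bsub>C\<^esub> g), Add = Add C, ZeroMor = (\<lambda>A B. ZeroMor C B A)\<rparr>"

text \<open>The matrix \<open>[a 0; c d]\<close>, from a biproduct with projections \<open>q1\<close>, \<open>q2\<close> to a biproduct
  with injections \<open>j1\<close>, \<open>j2\<close>.\<close>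

definition lower_triangular ::
  "('o, 'm) cat \<Rightarrow> 'm \<Rightarrow> 'm \<Rightarrow> 'm \<Rightarrow> 'm \<Rightarrow> 'm \<Rightarrow> 'm \<Rightarrow> 'm \<Rightarrow> 'm" where
  "lower_triangular C j1 j2 q1 q2 a c d =
     (j1 \<bullet>\<^bsub>C\<^esub> a \<bullet>\<^bsub>C\<^esub> q1) \<boxplus>\<^bsub>C\<^esub> (j2 \<bullet>\<^bsub>C\<^esub> c \<bullet>\<^bsub>C\<^esub> q1) \<boxplus>\<^bsub>C\<^esub> (j2 \<bullet>\<^bsub>C\<^esub> d \<bullet>\<^bsub>C\<^esub> q2)"


section \<open>Functors\<close>

record ('o, 'm, 'p, 'q) functor_data =
  fob :: "'o \<Rightarrow> 'p"
  far :: "'m \<Rightarrow> 'q"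

definition is_functor ::
  "('o, 'm) cat \<Rightarrow> ('p, 'q) cat \<Rightarrow> ('o, 'm, 'p, 'q) functor_data \<Rightarrow> bool" where
  "is_functor C D F \<longleftrightarrow>
     (\<forall>A\<in>Obj C. fob F A \<in> Obj D \<and> far F (Ident C A) = Ident D (fob F A)) \<and>
     (\<forall>f\<in>Arr C. far F f \<in> Hom D (fob F (Dom C f)) (fob F (Cod C f))) \<and>
     (\<forall>f\<in>Arr C. \<forall>g\<in>Arr C. Cod C f = Dom C g \<longrightarrow>
        far F (g \<bullet>\<^bsub>C\<^esub> f) = far F g \<bullet>\<^bsub>D\<^esub> far F f)"

definition is_additive_functor ::
  "('o, 'm) cat \<Rightarrow> ('p, 'q) cat \<Rightarrow> ('o, 'm, 'p, 'q) functor_data \<Rightarrow> bool" where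
  "is_additive_functor C D F \<longleftrightarrow> is_functor C D F \<and>
     (\<forall>A\<in>Obj C. \<forall>B\<in>Obj C. \<forall>f\<in>Hom C A B. \<forall>g\<in>Hom C A B.
        far F (f \<boxplus>\<^bsub>C\<^esub> g) = far F f \<boxplus>\<^bsub>D\<^esub> far F g)"

definition id_functor :: "('o, 'm, 'o, 'm) functor_data" where
  "id_functor = \<lparr>fob = (\<lambda>A. A), far = (\<lambda>f. f)\<rparr>"

definition comp_functor :: "('p, 'q, 'r, 's) functor_data \<Rightarrow>
    ('o, 'm, 'p, 'q) functor_data \<Rightarrow> ('o, 'm, 'r, 's) functor_data" where
  "comp_functor G F = \<lparr>fob = fob G \<circ> fob F, far = far G \<circ> far F\<rparr>"

definition is_automorphism :: "('o, 'm) cat \<Rightarrow> ('o, 'm, 'o, 'm) functor_data \<Rightarrow> bool" where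
  "is_automorphism C F \<longleftrightarrow> is_functor C C F \<and>
     bij_betw (fob F) (Obj C) (Obj C) \<and> bij_betw (far F) (Arr C) (Arr C)"

definition is_nat_iso :: "('o, 'm) cat \<Rightarrow> ('p, 'q) cat \<Rightarrow> ('o, 'm, 'p, 'q) functor_data \<Rightarrow>
    ('o, 'm, 'p, 'q) functor_data \<Rightarrow> ('o \<Rightarrow> 'q) \<Rightarrow> bool" where
  "is_nat_iso C D F G \<eta> \<longleftrightarrow>
     (\<forall>A\<in>Obj C. \<eta> A \<in> Hom D (fob F A) (fob G A) \<and> is_iso D (\<eta> A)) \<and>
     (\<forall>f\<in>Arr C. far G f \<bullet>\<^bsub>D\<^esub> \<eta> (Dom C f) = \<eta> (Cod C f) \<bullet>\<^bsub>D\<^esub> far F f)"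

definition is_equivalence ::
  "('o, 'm) cat \<Rightarrow> ('p, 'q) cat \<Rightarrow> ('o, 'm, 'p, 'q) functor_data \<Rightarrow> bool" where
  "is_equivalence C D G \<longleftrightarrow> is_functor C D G \<and>
     (\<exists>H \<eta> \<epsilon>. is_functor D C H \<and>
        is_nat_iso C C id_functor (comp_functor H G) \<eta> \<and>
        is_nat_iso D D (comp_functor G H) id_functor \<epsilon>)"


section \<open>Sequences of morphisms\<close>

text \<open>A sequence \<open>A\<^sub>1 \<rightarrow> A\<^sub>2 \<rightarrow> \<dots> \<rightarrow> A\<^sub>k\<^sub>+\<^sub>1\<close> is given by a function \<open>\<alpha>\<close> whose values at
  \<open>1, \<dots>, k\<close> are its morphisms; other values of \<open>\<alpha>\<close> are irrelevant.  (Classes of sequences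
  below are closed under isomorphisms, hence insensitive to these values.)\<close>

definition obj_at :: "('o, 'm) cat \<Rightarrow> (nat \<Rightarrow> 'm) \<Rightarrow> nat \<Rightarrow> 'o" where
  "obj_at C \<alpha> i = (if i = 1 then Dom C (\<alpha> 1) else Cod C (\<alpha> (i - 1)))"

definition is_path :: "('o, 'm) cat \<Rightarrow> nat \<Rightarrow> (nat \<Rightarrow> 'm) \<Rightarrow> bool" where
  "is_path C k \<alpha> \<longleftrightarrow> (\<forall>i\<in>{1..k}. \<alpha> i \<in> Hom C (obj_at C \<alpha> i) (obj_at C \<alpha> (i + 1)))"

definition is_complex :: "('o, 'm) cat \<Rightarrow> nat \<Rightarrow> (nat \<Rightarrow> 'm) \<Rightarrow> bool" where
  "is_complex C k \<alpha> \<longleftrightarrow> is_path C k \<alpha> \<and>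
     (\<forall>i\<in>{1..<k}. \<alpha> (i + 1) \<bullet>\<^bsub>C\<^esub> \<alpha> i = ZeroMor C (obj_at C \<alpha> i) (obj_at C \<alpha> (i + 2)))"

definition is_path_mor ::
  "('o, 'm) cat \<Rightarrow> nat \<Rightarrow> (nat \<Rightarrow> 'm) \<Rightarrow> (nat \<Rightarrow> 'm) \<Rightarrow> (nat \<Rightarrow> 'm) \<Rightarrow> bool" where
  "is_path_mor C k \<alpha> \<beta> \<phi> \<longleftrightarrow>
     (\<forall>i\<in>{1..k + 1}. \<phi> i \<in> Hom C (obj_at C \<alpha> i) (obj_at C \<beta> i)) \<and>
     (\<forall>i\<in>{1..k}. \<phi> (i + 1) \<bullet>\<^bsub>C\<^esub> \<alpha> i = \<beta> i \<bullet>\<^bsub>C\<^esub> \<phi> i)"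

text \<open>The same \<open>k\<close> morphisms in the opposite category.\<close>

definition rev_seq :: "nat \<Rightarrow> (nat \<Rightarrow> 'm) \<Rightarrow> nat \<Rightarrow> 'm" where
  "rev_seq k \<alpha> = (\<lambda>i. \<alpha> (k + 1 - i))"


section \<open>\<open>n\<close>-angulated categories\<close>

definition is_sigma_seq ::
  "('o, 'm) cat \<Rightarrow> ('o, 'm, 'o, 'm) functor_data \<Rightarrow> nat \<Rightarrow> (nat \<Rightarrow> 'm) \<Rightarrow> bool" where
  "is_sigma_seq C S n \<alpha> \<longleftrightarrow> is_path C n \<alpha> \<and> obj_at C \<alpha> (n + 1) = fob S (obj_at C \<alpha> 1)"

definition is_sigma_mor :: "('o, 'm) cat \<Rightarrow> ('o, 'm, 'o, 'm) functor_data \<Rightarrow> nat \<Rightarrow>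
    (nat \<Rightarrow> 'm) \<Rightarrow> (nat \<Rightarrow> 'm) \<Rightarrow> (nat \<Rightarrow> 'm) \<Rightarrow> bool" where
  "is_sigma_mor C S n \<alpha> \<beta> \<phi> \<longleftrightarrow> is_path_mor C n \<alpha> \<beta> \<phi> \<and> \<phi> (n + 1) = far S (\<phi> 1)"

definition sigma_isomorphic :: "('o, 'm) cat \<Rightarrow> ('o, 'm, 'o, 'm) functor_data \<Rightarrow> nat \<Rightarrow>
    (nat \<Rightarrow> 'm) \<Rightarrow> (nat \<Rightarrow> 'm) \<Rightarrow> bool" where
  "sigma_isomorphic C S n \<alpha> \<beta> \<longleftrightarrow> is_sigma_seq C S n \<alpha> \<and> is_sigma_seq C S n \<beta> \<and>
     (\<exists>\<phi>. is_sigma_mor C S n \<alpha> \<beta> \<phi> \<and> (\<forall>i\<in>{1..n}. is_iso C (\<phi> i)))"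

definition left_rotation :: "('o, 'm) cat \<Rightarrow> ('o, 'm, 'o, 'm) functor_data \<Rightarrow> nat \<Rightarrow>
    (nat \<Rightarrow> 'm) \<Rightarrow> nat \<Rightarrow> 'm" where
  "left_rotation C S n \<alpha> = (\<lambda>i. if i < n then \<alpha> (i + 1)
     else if even n then far S (\<alpha> 1) else neg C (far S (\<alpha> 1)))"

definition is_candidate_angle ::
  "('o, 'm) cat \<Rightarrow> ('o, 'm, 'o, 'm) functor_data \<Rightarrow> nat \<Rightarrow> (nat \<Rightarrow> 'm) \<Rightarrow> bool" where
  "is_candidate_angle C S n \<alpha> \<longleftrightarrow> is_sigma_seq C S n \<alpha> \<and> is_complex C n \<alpha> \<and>
     far S (\<alpha> 1) \<bullet>\<^bsub>C\<^esub> \<alpha> n = ZeroMor C (obj_at C \<alpha> n) (fob S (obj_at C \<alpha> 2))"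

definition is_contractible ::
  "('o, 'm) cat \<Rightarrow> ('o, 'm, 'o, 'm) functor_data \<Rightarrow> nat \<Rightarrow> (nat \<Rightarrow> 'm) \<Rightarrow> bool" where
  "is_contractible C S n \<alpha> \<longleftrightarrow> is_candidate_angle C S n \<alpha> \<and>
     (\<exists>\<Theta>. (\<forall>i\<in>{1..n}. \<Theta> i \<in> Hom C (obj_at C \<alpha> (i + 1)) (obj_at C \<alpha> i)) \<and>
        (\<forall>i\<in>{2..n}. Ident C (obj_at C \<alpha> i) =
           (\<Theta> i \<bullet>\<^bsub>C\<^esub> \<alpha> i) \<boxplus>\<^bsub>C\<^esub> (\<alpha> (i - 1) \<bullet>\<^bsub>C\<^esub> \<Theta> (i - 1))) \<and>
        Ident C (obj_at C \<alpha> (n + 1)) =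
           (far S (\<Theta> 1) \<bullet>\<^bsub>C\<^esub> far S (\<alpha> 1)) \<boxplus>\<^bsub>C\<^esub> (\<alpha> n \<bullet>\<^bsub>C\<^esub> \<Theta> n))"

text \<open>\<open>\<delta>\<close> is a direct sum of \<open>\<alpha>\<close> and \<open>\<beta>\<close>: the structure morphisms of the biproducts in
  each degree are morphisms of sequences.\<close>

definition is_direct_sum :: "('o, 'm) cat \<Rightarrow> ('o, 'm, 'o, 'm) functor_data \<Rightarrow> nat \<Rightarrow>
    (nat \<Rightarrow> 'm) \<Rightarrow> (nat \<Rightarrow> 'm) \<Rightarrow> (nat \<Rightarrow> 'm) \<Rightarrow> bool" where
  "is_direct_sum C S n \<alpha> \<beta> \<delta> \<longleftrightarrow>
     is_sigma_seq C S n \<alpha> \<and> is_sigma_seq C S n \<beta> \<and> is_sigma_seq C S n \<delta> \<and>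
     (\<exists>j1 j2 q1 q2.
        is_sigma_mor C S n \<alpha> \<delta> j1 \<and> is_sigma_mor C S n \<beta> \<delta> j2 \<and>
        is_sigma_mor C S n \<delta> \<alpha> q1 \<and> is_sigma_mor C S n \<delta> \<beta> q2 \<and>
        (\<forall>i\<in>{1..n}. is_biproduct C (obj_at C \<alpha> i) (obj_at C \<beta> i) (obj_at C \<delta> i)
           (j1 i) (j2 i) (q1 i) (q2 i)))"

text \<open>\<open>\<gamma>\<close> is a mapping cone of \<open>\<phi>\<close>.  Its last object is \<open>\<Sigma>(A\<^sub>2 \<oplus> B\<^sub>1)\<close>, which is a biproduct of
  \<open>\<Sigma>A\<^sub>2\<close> and \<open>\<Sigma>B\<^sub>1\<close> via the images under \<open>\<Sigma>\<close> of the structure morphisms of \<open>A\<^sub>2 \<oplus> B\<^sub>1\<close>.\<close>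

definition is_mapping_cone :: "('o, 'm) cat \<Rightarrow> ('o, 'm, 'o, 'm) functor_data \<Rightarrow> nat \<Rightarrow>
    (nat \<Rightarrow> 'm) \<Rightarrow> (nat \<Rightarrow> 'm) \<Rightarrow> (nat \<Rightarrow> 'm) \<Rightarrow> (nat \<Rightarrow> 'm) \<Rightarrow> bool" where
  "is_mapping_cone C S n \<alpha> \<beta> \<phi> \<gamma> \<longleftrightarrow>
     (\<exists>T j1 j2 q1 q2.
        (\<forall>i\<in>{1..n}. is_biproduct C (obj_at C \<alpha> (i + 1)) (obj_at C \<beta> i) (T i)
           (j1 i) (j2 i) (q1 i) (q2 i)) \<and>
        (\<forall>i\<in>{1..<n}. \<gamma> i = lower_triangular C (j1 (i + 1)) (j2 (i + 1)) (q1 i) (q2 i)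
           (neg C (\<alpha> (i + 1))) (\<phi> (i + 1)) (\<beta> i)) \<and>
        \<gamma> n = lower_triangular C (far S (j1 1)) (far S (j2 1)) (q1 n) (q2 n)
           (neg C (far S (\<alpha> 1))) (far S (\<phi> 1)) (\<beta> n))"

locale n_angulated_category = additive_category C
  for C :: "('o, 'm) cat" (structure) +
  fixes S :: "('o, 'm, 'o, 'm) functor_data" and n :: nat and N :: "(nat \<Rightarrow> 'm) set"
  assumes n_ge_3: "n \<ge> 3"
    and automorphism: "is_automorphism C S"
    and N_sigma_seq: "\<alpha> \<in> N \<Longrightarrow> is_sigma_seq C S n \<alpha>"
    and N1_iso: "\<alpha> \<in> N \<Longrightarrow> sigma_isomorphic C S n \<alpha> \<beta> \<Longrightarrow> \<beta> \<in> N"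
    and N1_sum: "\<alpha> \<in> N \<Longrightarrow> \<beta> \<in> N \<Longrightarrow> is_direct_sum C S n \<alpha> \<beta> \<delta> \<Longrightarrow> \<delta> \<in> N"
    and N1_summand: "\<delta> \<in> N \<Longrightarrow> is_direct_sum C S n \<alpha> \<beta> \<delta> \<Longrightarrow> \<alpha> \<in> N"
    and N1_trivial: "is_sigma_seq C S n \<alpha> \<Longrightarrow> A \<in> Obj C \<Longrightarrow> \<alpha> 1 = Ident C A \<Longrightarrow>
      (\<And>i. i \<in> {3..n} \<Longrightarrow> is_zero_object C (obj_at C \<alpha> i)) \<Longrightarrow> \<alpha> \<in> N"
    and N1_first: "f \<in> Arr C \<Longrightarrow> \<exists>\<alpha>\<in>N. \<alpha> 1 = f"
    and N2: "is_sigma_seq C S n \<alpha> \<Longrightarrow> \<alpha> \<in> N \<longleftrightarrow> left_rotation C S n \<alpha> \<in> N"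
    and N3_N4: "\<alpha> \<in> N \<Longrightarrow> \<beta> \<in> N \<Longrightarrow>
      f \<in> Hom C (obj_at C \<alpha> 1) (obj_at C \<beta> 1) \<Longrightarrow> g \<in> Hom C (obj_at C \<alpha> 2) (obj_at C \<beta> 2) \<Longrightarrow>
      g \<bullet> \<alpha> 1 = \<beta> 1 \<bullet> f \<Longrightarrow>
      \<exists>\<phi>. \<phi> 1 = f \<and> \<phi> 2 = g \<and> is_sigma_mor C S n \<alpha> \<beta> \<phi> \<and>
        (\<exists>\<gamma>\<in>N. is_mapping_cone C S n \<alpha> \<beta> \<phi> \<gamma>)"

text \<open>The data \<open>(C, S, N)\<close> and \<open>(D, T, M)\<close> are equivalent as \<open>n\<close>-angulated categories.\<close>

definition image_seq :: "('p, 'q) cat \<Rightarrow> nat \<Rightarrow> ('o, 'm, 'p, 'q) functor_data \<Rightarrow> 'q \<Rightarrow>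
    (nat \<Rightarrow> 'm) \<Rightarrow> nat \<Rightarrow> 'q" where
  "image_seq D n G e \<alpha> = (\<lambda>i. if i = n then e \<bullet>\<^bsub>D\<^esub> far G (\<alpha> n) else far G (\<alpha> i))"

definition angulated_equivalent :: "nat \<Rightarrow>
    ('o, 'm) cat \<Rightarrow> ('o, 'm, 'o, 'm) functor_data \<Rightarrow> (nat \<Rightarrow> 'm) set \<Rightarrow>
    ('p, 'q) cat \<Rightarrow> ('p, 'q, 'p, 'q) functor_data \<Rightarrow> (nat \<Rightarrow> 'q) set \<Rightarrow> bool" where
  "angulated_equivalent n C S N D T M \<longleftrightarrow>
     (\<exists>G \<eta>. is_additive_functor C D G \<and> is_equivalence C D G \<and>
        is_nat_iso C D (comp_functor G S) (comp_functor T G) \<eta> \<and>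
        (\<forall>\<alpha>\<in>N. image_seq D n G (\<eta> (obj_at C \<alpha> 1)) \<alpha> \<in> M))"


section \<open>\<open>(n-2)\<close>-exact categories\<close>

text \<open>\<open>right_exact C k \<alpha>\<close>: the complex \<open>A\<^sub>1 \<rightarrow> \<dots> \<rightarrow> A\<^sub>k\<^sub>+\<^sub>1 \<rightarrow> 0\<close> is right \<open>(k-1)\<close>-exact; thus
  \<open>k = n - 1\<close> in the case of \<open>(n-2)\<close>-exactness.\<close>

definition right_exact :: "('o, 'm) cat \<Rightarrow> nat \<Rightarrow> (nat \<Rightarrow> 'm) \<Rightarrow> bool" where
  "right_exact C k \<alpha> \<longleftrightarrow> is_complex C k \<alpha> \<and>
     (\<forall>A\<in>Obj C.
        (\<forall>h\<in>Hom C (obj_at C \<alpha> (k + 1)) A.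
           h \<bullet>\<^bsub>C\<^esub> \<alpha> k = ZeroMor C (obj_at C \<alpha> k) A \<longrightarrow>
             h = ZeroMor C (obj_at C \<alpha> (k + 1)) A) \<and>
        (\<forall>i\<in>{2..k}. \<forall>h\<in>Hom C (obj_at C \<alpha> i) A.
           h \<bullet>\<^bsub>C\<^esub> \<alpha> (i - 1) = ZeroMor C (obj_at C \<alpha> (i - 1)) A \<longrightarrow>
             (\<exists>h'\<in>Hom C (obj_at C \<alpha> (i + 1)) A. h = h' \<bullet>\<^bsub>C\<^esub> \<alpha> i)))"

definition left_exact :: "('o, 'm) cat \<Rightarrow> nat \<Rightarrow> (nat \<Rightarrow> 'm) \<Rightarrow> bool" where
  "left_exact C k \<alpha> \<longleftrightarrow> right_exact (op_cat C) k (rev_seq k \<alpha>)"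

definition is_exact_seq :: "('o, 'm) cat \<Rightarrow> nat \<Rightarrow> (nat \<Rightarrow> 'm) \<Rightarrow> bool" where
  "is_exact_seq C n \<alpha> \<longleftrightarrow> right_exact C (n - 1) \<alpha> \<and> left_exact C (n - 1) \<alpha>"

text \<open>The mapping cone
  \<open>A\<^sub>1 \<rightarrow> A\<^sub>2 \<oplus> B\<^sub>1 \<rightarrow> \<dots> \<rightarrow> A\<^sub>n\<^sub>-\<^sub>1 \<oplus> B\<^sub>n\<^sub>-\<^sub>2 \<rightarrow> B\<^sub>n\<^sub>-\<^sub>1\<close>, where \<open>T i = A\<^sub>i \<oplus> B\<^sub>i\<^sub>-\<^sub>1\<close>.\<close>

definition is_pushout_cone :: "('o, 'm) cat \<Rightarrow> nat \<Rightarrow>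
    (nat \<Rightarrow> 'm) \<Rightarrow> (nat \<Rightarrow> 'm) \<Rightarrow> (nat \<Rightarrow> 'm) \<Rightarrow> (nat \<Rightarrow> 'm) \<Rightarrow> bool" where
  "is_pushout_cone C n \<alpha> \<beta> \<phi> \<gamma> \<longleftrightarrow>
     (\<exists>T j1 j2 q1 q2.
        (\<forall>i\<in>{2..n - 1}. is_biproduct C (obj_at C \<alpha> i) (obj_at C \<beta> (i - 1)) (T i)
           (j1 i) (j2 i) (q1 i) (q2 i)) \<and>
        \<gamma> 1 = (j1 2 \<bullet>\<^bsub>C\<^esub> neg C (\<alpha> 1)) \<boxplus>\<^bsub>C\<^esub> (j2 2 \<bullet>\<^bsub>C\<^esub> \<phi> 1) \<and>
        (\<forall>i\<in>{2..n - 2}. \<gamma> i = lower_triangular C (j1 (i + 1)) (j2 (i + 1)) (q1 i) (q2 i)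
           (neg C (\<alpha> i)) (\<phi> i) (\<beta> (i - 1))) \<and>
        \<gamma> (n - 1) = (\<phi> (n - 1) \<bullet>\<^bsub>C\<^esub> q1 (n - 1)) \<boxplus>\<^bsub>C\<^esub> (\<beta> (n - 2) \<bullet>\<^bsub>C\<^esub> q2 (n - 1)))"

definition is_pushout_diagram :: "('o, 'm) cat \<Rightarrow> nat \<Rightarrow>
    (nat \<Rightarrow> 'm) \<Rightarrow> (nat \<Rightarrow> 'm) \<Rightarrow> (nat \<Rightarrow> 'm) \<Rightarrow> bool" where
  "is_pushout_diagram C n \<alpha> \<beta> \<phi> \<longleftrightarrow>
     is_complex C (n - 2) \<alpha> \<and> is_complex C (n - 2) \<beta> \<and> is_path_mor C (n - 2) \<alpha> \<beta> \<phi> \<and>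
     (\<exists>\<gamma>. is_pushout_cone C n \<alpha> \<beta> \<phi> \<gamma> \<and> right_exact C (n - 1) \<gamma>)"

definition is_weak_iso :: "('o, 'm) cat \<Rightarrow> nat \<Rightarrow>
    (nat \<Rightarrow> 'm) \<Rightarrow> (nat \<Rightarrow> 'm) \<Rightarrow> (nat \<Rightarrow> 'm) \<Rightarrow> bool" where
  "is_weak_iso C n \<alpha> \<beta> \<phi> \<longleftrightarrow>
     is_exact_seq C n \<alpha> \<and> is_exact_seq C n \<beta> \<and> is_path_mor C (n - 1) \<alpha> \<beta> \<phi> \<and>
     (\<exists>k\<in>{1..n}. is_iso C (\<phi> k) \<and> is_iso C (\<phi> (if k = n then 1 else k + 1)))"

definition adm_monos :: "(nat \<Rightarrow> 'm) set \<Rightarrow> 'm set" where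
  "adm_monos X = {\<alpha> 1 | \<alpha>. \<alpha> \<in> X}"

text \<open>The class of sequences in \<open>op_cat C\<close> corresponding to \<open>X\<close>.  Its admissible monomorphisms
  are the admissible epimorphisms \<open>\<alpha> (n - 1)\<close>, \<open>\<alpha> \<in> X\<close>; the dual notions below are obtained by
  passing to it.\<close>

definition op_class :: "nat \<Rightarrow> (nat \<Rightarrow> 'm) set \<Rightarrow> (nat \<Rightarrow> 'm) set" where
  "op_class n X = {\<alpha>. rev_seq (n - 1) \<alpha> \<in> X}"

definition axiom_E1 :: "('o, 'm) cat \<Rightarrow> (nat \<Rightarrow> 'm) set \<Rightarrow> bool" where
  "axiom_E1 C X \<longleftrightarrow>
     (\<forall>f\<in>adm_monos X. \<forall>g\<in>adm_monos X. Cod C f = Dom C g \<longrightarrow> g \<bullet>\<^bsub>C\<^esub> f \<in> adm_monos X)"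

definition axiom_E2 :: "('o, 'm) cat \<Rightarrow> nat \<Rightarrow> (nat \<Rightarrow> 'm) set \<Rightarrow> bool" where
  "axiom_E2 C n X \<longleftrightarrow>
     (\<forall>\<alpha>\<in>X. \<forall>f\<in>Arr C. Dom C f = obj_at C \<alpha> 1 \<longrightarrow>
        (\<exists>\<beta> \<phi>. is_pushout_diagram C n \<alpha> \<beta> \<phi> \<and> \<phi> 1 = f \<and> \<beta> 1 \<in> adm_monos X))"

locale exact_category = additive_category E
  for E :: "('o, 'm) cat" (structure) +
  fixes n :: nat and X :: "(nat \<Rightarrow> 'm) set"
  assumes n_ge_3: "n \<ge> 3"
    and X_exact: "\<alpha> \<in> X \<Longrightarrow> is_exact_seq E n \<alpha>"
    and X_weak_iso: "is_weak_iso E n \<alpha> \<beta> \<phi> \<Longrightarrow> \<alpha> \<in> X \<longleftrightarrow> \<beta> \<in> X"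
    and E0: "is_zero_object E Z \<Longrightarrow> (\<lambda>i. ZeroMor E Z Z) \<in> X"
    and E1: "axiom_E1 E X"
    and E1_op: "axiom_E1 (op_cat E) (op_class n X)"
    and E2: "axiom_E2 E n X"
    and E2_op: "axiom_E2 (op_cat E) n (op_class n X)"


section \<open>Frobenius categories and their stable categories\<close>

definition injectives :: "('o, 'm) cat \<Rightarrow> (nat \<Rightarrow> 'm) set \<Rightarrow> 'o set" where
  "injectives E X = {I \<in> Obj E. \<forall>m\<in>adm_monos X. \<forall>h\<in>Hom E (Dom E m) I.
     \<exists>h'\<in>Hom E (Cod E m) I. h' \<bullet>\<^bsub>E\<^esub> m = h}"

definition projectives :: "('o, 'm) cat \<Rightarrow> nat \<Rightarrow> (nat \<Rightarrow> 'm) set \<Rightarrow> 'o set" where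
  "projectives E n X = injectives (op_cat E) (op_class n X)"

text \<open>\<open>\<alpha>\<close> is an admissible sequence \<open>0 \<rightarrow> A \<rightarrow> I\<^sub>1 \<rightarrow> \<dots> \<rightarrow> I\<^sub>n\<^sub>-\<^sub>2 \<rightarrow> B \<rightarrow> 0\<close> with injective \<open>I\<^sub>j\<close>.\<close>

definition is_inj_seq :: "('o, 'm) cat \<Rightarrow> nat \<Rightarrow> (nat \<Rightarrow> 'm) set \<Rightarrow> 'o \<Rightarrow> (nat \<Rightarrow> 'm) \<Rightarrow> bool" where
  "is_inj_seq E n X A \<alpha> \<longleftrightarrow> \<alpha> \<in> X \<and> obj_at E \<alpha> 1 = A \<and>
     (\<forall>i\<in>{2..n - 1}. obj_at E \<alpha> i \<in> injectives E X)"

locale frobenius_category = exact_category +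
  assumes enough_injectives: "A \<in> Obj E \<Longrightarrow> \<exists>\<alpha>. is_inj_seq E n X A \<alpha>"
    and enough_projectives:
      "A \<in> Obj E \<Longrightarrow> \<exists>\<alpha>. is_inj_seq (op_cat E) n (op_class n X) A \<alpha>"
    and projectives_eq_injectives: "projectives E n X = injectives E X"

text \<open>The class of a morphism modulo the morphisms factoring through an object of \<open>I\<close>.\<close>

definition stable_class :: "('o, 'm) cat \<Rightarrow> 'o set \<Rightarrow> 'm \<Rightarrow> 'm set" where
  "stable_class E I f = {g \<in> Hom E (Dom E f) (Cod E f).
     \<exists>J\<in>I. \<exists>u\<in>Hom E (Dom E f) J. \<exists>v\<in>Hom E J (Cod E f). g \<boxplus>\<^bsub>E\<^esub> neg E f = v \<bullet>\<^bsub>E\<^esub> u}"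

text \<open>The unions below are over sets which all coincide, by independence of representatives.\<close>

definition stable_category :: "('o, 'm) cat \<Rightarrow> 'o set \<Rightarrow> ('o, 'm set) cat" where
  "stable_category E I = \<lparr>Obj = Obj E, Arr = stable_class E I ` Arr E,
     Dom = (\<lambda>F. the_elem (Dom E ` F)), Cod = (\<lambda>F. the_elem (Cod E ` F)),
     Ident = (\<lambda>A. stable_class E I (Ident E A)),
     Comp = (\<lambda>G F. \<Union>g\<in>G. \<Union>f\<in>F. stable_class E I (g \<bullet>\<^bsub>E\<^esub> f)),
     Add = (\<lambda>F G. \<Union>f\<in>F. \<Union>g\<in>G. stable_class E I (f \<boxplus>\<^bsub>E\<^esub> g)),
     ZeroMor = (\<lambda>A B. stable_class E I (ZeroMor E A B))\<rparr>"

text \<open>\<open>J A\<close> is the chosen sequence \<open>0 \<rightarrow> A \<rightarrow> I\<^sub>1 \<rightarrow> \<dots> \<rightarrow> I\<^sub>n\<^sub>-\<^sub>2 \<rightarrow> \<Sigma>A \<rightarrow> 0\<close>.  On morphisms, \<open>\<Sigma>\<close> sends the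
  class of \<open>f\<close> to that of the last component of any extension of \<open>f\<close> to the chosen sequences.\<close>

definition stable_suspension :: "('o, 'm) cat \<Rightarrow> nat \<Rightarrow> 'o set \<Rightarrow> ('o \<Rightarrow> nat \<Rightarrow> 'm) \<Rightarrow>
    ('o, 'm set, 'o, 'm set) functor_data" where
  "stable_suspension E n I J = \<lparr>fob = (\<lambda>A. obj_at E (J A) n),
     far = (\<lambda>F. \<Union>{stable_class E I (\<phi> n) | \<phi>.
       \<phi> 1 \<in> F \<and> is_path_mor E (n - 1) (J (Dom E (\<phi> 1))) (J (Cod E (\<phi> 1))) \<phi>})\<rparr>"

text \<open>The sequence \<open>A \<rightarrow> B \<rightarrow> C\<^sub>1 \<rightarrow> \<dots> \<rightarrow> C\<^sub>n\<^sub>-\<^sub>2 \<rightarrow> \<Sigma>A\<close> of the stable category, where \<open>\<gamma>\<close> is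
  \<open>0 \<rightarrow> B \<rightarrow> C\<^sub>1 \<rightarrow> \<dots> \<rightarrow> C\<^sub>n\<^sub>-\<^sub>2 \<rightarrow> \<Sigma>A \<rightarrow> 0\<close>.\<close>

definition standard_angles :: "('o, 'm) cat \<Rightarrow> nat \<Rightarrow> (nat \<Rightarrow> 'm) set \<Rightarrow> ('o \<Rightarrow> nat \<Rightarrow> 'm) \<Rightarrow>
    (nat \<Rightarrow> 'm set) set" where
  "standard_angles E n X J =
     {(\<lambda>i. stable_class E (injectives E X) (if i = 1 then f else \<gamma> (i - 1))) | f \<gamma> \<phi>.
        f \<in> Arr E \<and> \<gamma> \<in> X \<and>
        obj_at E \<gamma> 1 = Cod E f \<and> obj_at E \<gamma> n = obj_at E (J (Dom E f)) n \<and>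
        is_path_mor E (n - 1) (J (Dom E f)) \<gamma> \<phi> \<and>
        \<phi> 1 = f \<and> \<phi> n = Ident E (obj_at E \<gamma> n) \<and>
        is_pushout_diagram E n (J (Dom E f)) \<gamma> \<phi>}"

definition natural_angulation :: "('o, 'm) cat \<Rightarrow> nat \<Rightarrow> (nat \<Rightarrow> 'm) set \<Rightarrow>
    ('o \<Rightarrow> nat \<Rightarrow> 'm) \<Rightarrow> (nat \<Rightarrow> 'm set) set" where
  "natural_angulation E n X J =
     {\<delta>. \<exists>\<delta>'\<in>standard_angles E n X J.
        sigma_isomorphic (stable_category E (injectives E X))
          (stable_suspension E n (injectives E X) J) n \<delta> \<delta>'}"

text \<open>The two type arguments are the types of objects and morphisms over which the Frobenius
  category \<open>E\<close> ranges; leaving them schematic in a theorem quantifies over all types.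
  The definition refers to the data \<open>(C, S, N)\<close> only, without requiring that they satisfy the
  axioms of \<open>n_angulated_category\<close>; so \<open>\<not> algebraic\<close> cannot hold by failure of these axioms alone.\<close>

definition algebraic :: "'o itself \<Rightarrow> 'm itself \<Rightarrow> nat \<Rightarrow>
    ('c, 'd) cat \<Rightarrow> ('c, 'd, 'c, 'd) functor_data \<Rightarrow> (nat \<Rightarrow> 'd) set \<Rightarrow> bool" where
  "algebraic TO TM n C S N \<longleftrightarrow>
     (\<exists>(E :: ('o, 'm) cat) X J. frobenius_category E n X \<and>
        (\<forall>A\<in>Obj E. is_inj_seq E n X A (J A)) \<and>
        angulated_equivalent n C S N
          (stable_category E (injectives E X))
          (stable_suspension E n (injectives E X) J)
          (natural_angulation E n X J))"


section \<open>Finitely generated free modules over a local ring\<close>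

definition local_ring :: "('a, 'x) ring_scheme \<Rightarrow> bool" where
  "local_ring R \<longleftrightarrow> cring R \<and> (\<exists>!M. maximalideal M R)"

definition fg_free :: "('a, 'x) ring_scheme \<Rightarrow> ('a, 'b) module \<Rightarrow> bool" where
  "fg_free R M \<longleftrightarrow> module R M \<and> (\<exists>B. finite B \<and> B \<subseteq> carrier M \<and>
     (\<forall>x\<in>carrier M. \<exists>!c. c \<in> B \<rightarrow>\<^sub>E carrier R \<and> x = (\<Oplus>\<^bsub>M\<^esub>b\<in>B. c b \<odot>\<^bsub>M\<^esub> b)))"

definition linear_maps ::
  "('a, 'x) ring_scheme \<Rightarrow> ('a, 'b) module \<Rightarrow> ('a, 'b) module \<Rightarrow> ('b \<Rightarrow> 'b) set" where
  "linear_maps R M N = {f \<in> carrier M \<rightarrow>\<^sub>E carrier N.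
     (\<forall>x\<in>carrier M. \<forall>y\<in>carrier M. f (x \<oplus>\<^bsub>M\<^esub> y) = f x \<oplus>\<^bsub>N\<^esub> f y) \<and>
     (\<forall>a\<in>carrier R. \<forall>x\<in>carrier M. f (a \<odot>\<^bsub>M\<^esub> x) = a \<odot>\<^bsub>N\<^esub> f x)}"

text \<open>The finitely generated free \<open>R\<close>-modules with underlying set in the type \<open>'b\<close>; morphisms
  are triples of domain, codomain and map.  If the lists over \<open>carrier R\<close> embed into \<open>'b\<close>, every
  finitely generated free \<open>R\<close>-module is isomorphic to one of these.\<close>

definition free_modules :: "('a, 'x) ring_scheme \<Rightarrow>
    (('a, 'b) module, ('a, 'b) module \<times> ('a, 'b) module \<times> ('b \<Rightarrow> 'b)) cat" where
  "free_modules R = \<lparr>Obj = {M. fg_free R M},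
     Arr = {(M, N, f). fg_free R M \<and> fg_free R N \<and> f \<in> linear_maps R M N},
     Dom = (\<lambda>(M, N, f). M), Cod = (\<lambda>(M, N, f). N),
     Ident = (\<lambda>M. (M, M, \<lambda>x\<in>carrier M. x)),
     Comp = (\<lambda>(L', N, g) (M, L, f). (M, N, compose (carrier M) g f)),
     Add = (\<lambda>(M, N, f) (M', N', g). (M, N, \<lambda>x\<in>carrier M. f x \<oplus>\<^bsub>N\<^esub> g x)),
     ZeroMor = (\<lambda>M N. (M, N, \<lambda>x\<in>carrier M. \<zero>\<^bsub>N\<^esub>))\<rparr>"

text \<open>The sequence \<open>F \<rightarrow> F \<rightarrow> \<dots> \<rightarrow> F \<rightarrow> F\<close> of multiplications by \<open>p\<close>.\<close>

definition mult_seq :: "'a \<Rightarrow> ('a, 'b) module \<Rightarrow>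
    nat \<Rightarrow> ('a, 'b) module \<times> ('a, 'b) module \<times> ('b \<Rightarrow> 'b)" where
  "mult_seq p F = (\<lambda>i. (F, F, \<lambda>x\<in>carrier F. p \<odot>\<^bsub>F\<^esub> x))"

definition free_angles :: "('a, 'x) ring_scheme \<Rightarrow> 'a \<Rightarrow> nat \<Rightarrow>
    (nat \<Rightarrow> ('a, 'b) module \<times> ('a, 'b) module \<times> ('b \<Rightarrow> 'b)) set" where
  "free_angles R p n = {\<alpha>. \<exists>\<gamma> F \<delta>.
     is_contractible (free_modules R) id_functor n \<gamma> \<and> fg_free R F \<and>
     is_direct_sum (free_modules R) id_functor n \<gamma> (mult_seq p F) \<delta> \<and>
     sigma_isomorphic (free_modules R) id_functor n \<alpha> \<delta>}"

end

theory Submission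
  imports Defs
begin

text \<open>An algebraic \<open>n\<close>-angulated category satisfies a relation between multiplication by an integer \<open>d\<close>
and its \<open>n\<close>-angles which, for odd \<open>n\<close>, the sequence \<open>R \<rightarrow> R \<rightarrow> \<dots> \<rightarrow> R\<close> of multiplications by \<open>p\<close>
violates.

The relation.  Let \<open>A \<rightarrow> B \<rightarrow> C\<^sub>1 \<rightarrow> \<dots> \<rightarrow> \<Sigma>A\<close> be a standard \<open>n\<close>-angle of a stable category, with
first map \<open>f\<close> and second row \<open>\<gamma>\<close>, and let \<open>\<phi>\<close> be the given morphism from the injective row of \<open>A\<close>
to \<open>\<gamma>\<close>, which is \<open>f\<close> at the left end and the identity at the right end.  Suppose that \<open>g : B \<rightarrow> A\<close>
satisfies \<open>f g = d\<close> stably.  By injectivity \<open>g\<close> extends to a morphism \<open>\<psi>\<close> from \<open>\<gamma>\<close> to the injective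
row of \<open>A\<close>.  Both \<open>d\<close> and \<open>\<phi>\<psi>\<close> are endomorphisms of the complex \<open>\<gamma>\<close>, and they agree stably at the
left end, so they differ by a chain homotopy \<open>h\<close> whose first component is stably zero.  The middle
components of \<open>\<phi>\<psi>\<close> factor through injectives.  Hence, stably,
\<open>d = h\<^sub>2 \<gamma>\<^sub>2\<close>, then \<open>d = \<gamma>\<^sub>i\<^sub>-\<^sub>1 h\<^sub>i\<^sub>-\<^sub>1 + h\<^sub>i \<gamma>\<^sub>i\<close>, and at the right end \<open>d = \<Psi> + \<gamma>\<^sub>n\<^sub>-\<^sub>1 h\<^sub>n\<^sub>-\<^sub>1\<close>, where \<open>\<Psi>\<close> is
the last component of \<open>\<psi>\<close>.  Moreover, if \<open>\<Psi>\<close> is stably zero then it factors through a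
projective, and left exactness of the injective row carries this back to the left end: \<open>g\<close> factors
through \<open>\<gamma>\<^sub>1\<close>.  This is \<open>standard_angle_relations\<close>.

The violation.  If the free modules were algebraic, an equivalence would send the sequence of
multiplications by \<open>p\<close> to an \<open>n\<close>-angle isomorphic to a standard one.  All objects of that angle are
isomorphic to the image of \<open>R\<close>, whose endomorphism ring is \<open>R\<close>, so maps between them are given by
elements of \<open>R\<close> and all maps of the angle by \<open>p\<close>.  Write \<open>d = p u\<close> in \<open>R\<close> and let \<open>g\<close> correspond to
\<open>u\<close>; let \<open>h\<^sub>i\<close> correspond to \<open>x\<^sub>i\<close>.  The relations become \<open>d = p x\<^sub>2\<close> and \<open>d = p x\<^sub>i\<^sub>-\<^sub>1 + p x\<^sub>i\<close>, so that
\<open>p x\<^sub>i\<close> is alternately \<open>d\<close> and \<open>0\<close>.  As \<open>n - 1\<close> is even, \<open>p x\<^sub>n\<^sub>-\<^sub>1 = d\<close> and therefore \<open>\<Psi> = 0\<close>.  So \<open>g\<close>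
factors through \<open>\<gamma>\<^sub>1\<close>, that is \<open>u = y p\<close>, and \<open>d = p u = y p\<^sup>2 = 0\<close>, a contradiction.  This is
\<open>relations_contradiction\<close>.

The isomorphism onto the standard angle is arbitrary in its first component \<open>\<theta>\<close>, and the last object
\<open>\<Sigma>A\<close> is reached through \<open>\<Sigma>\<theta>\<close>.  The argument needs only that \<open>\<Sigma>\<theta>\<close> is a split epimorphism
(\<open>suspension_split_epi\<close>), which is another application of the homotopy lemma.\<close>

section \<open>Preadditive categories\<close>

text \<open>The same calculus of sums and composites is applied in an additive category, in its opposite and in
its stable category.  For the last two it is enough to verify these axioms.\<close>

locale preadditive = category +
  assumes Hom_group: "A \<in> Obj C \<Longrightarrow> B \<in> Obj C \<Longrightarrow> comm_group (hom_group C A B)"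
    and Comp_Add_left: "f \<in> Hom C A B \<Longrightarrow> g \<in> Hom C B D \<Longrightarrow> h \<in> Hom C B D \<Longrightarrow>
      (g \<boxplus> h) \<bullet> f = (g \<bullet> f) \<boxplus> (h \<bullet> f)"
    and Comp_Add_right: "f \<in> Hom C A B \<Longrightarrow> g \<in> Hom C A B \<Longrightarrow> h \<in> Hom C B D \<Longrightarrow>
      h \<bullet> (f \<boxplus> g) = (h \<bullet> f) \<boxplus> (h \<bullet> g)"

sublocale additive_category \<subseteq> preadditive
proof (intro preadditive.intro preadditive_axioms.intro)
qed (fact category_axioms Hom_group Comp_Add_left Comp_Add_right)+

context category
begin

lemma Hom_Obj: "f \<in> Hom C A B \<Longrightarrow> A \<in> Obj C" "f \<in> Hom C A B \<Longrightarrow> B \<in> Obj C"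
  using Dom_Obj Cod_Obj by (auto simp: Hom_def)

lemma Comp_simps [simp]:
  assumes "f \<in> Arr C" "g \<in> Arr C" "Cod C f = Dom C g"
  shows "g \<bullet> f \<in> Arr C" "Dom C (g \<bullet> f) = Dom C f" "Cod C (g \<bullet> f) = Cod C g"
  using Comp_Hom[of f "Dom C f" "Cod C f" g "Cod C g"] assms by (auto simp: Hom_def)

lemma Ident_simps [simp]:
  assumes "A \<in> Obj C"
  shows "Ident C A \<in> Arr C" "Dom C (Ident C A) = A" "Cod C (Ident C A) = A"
  using Ident_Hom[OF assms] by (auto simp: Hom_def)

lemma Ident_comp [simp]:
  assumes "f \<in> Arr C"
  shows "Dom C f = A \<Longrightarrow> f \<bullet> Ident C A = f" "Cod C f = A \<Longrightarrow> Ident C A \<bullet> f = f"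
  using Ident_left Ident_right assms by (auto simp: Hom_def)

lemma Comp_assoc_Arr:
  assumes "f \<in> Arr C" "g \<in> Arr C" "h \<in> Arr C" "Cod C f = Dom C g" "Cod C g = Dom C h"
  shows "(h \<bullet> g) \<bullet> f = h \<bullet> (g \<bullet> f)"
  by (rule Comp_assoc[of f "Dom C f" "Cod C f" g "Cod C g" h "Cod C h"])
    (use assms in \<open>auto simp: Hom_def\<close>)

lemma op_category: "category (op_cat C)"
  by unfold_locales
    (auto simp: op_cat_def Hom_def Dom_Obj Cod_Obj Comp_assoc_Arr)

end

lemma Hom_op [simp]: "Hom (op_cat C) A B = Hom C B A"
  by (auto simp: Hom_def op_cat_def)

lemma op_cat_simps [simp]:
  "Obj (op_cat C) = Obj C" "Arr (op_cat C) = Arr C" "Dom (op_cat C) = Cod C"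
  "Cod (op_cat C) = Dom C" "Ident (op_cat C) = Ident C" "Add (op_cat C) = Add C"
  "Comp (op_cat C) g f = Comp C f g" "ZeroMor (op_cat C) A B = ZeroMor C B A"
  by (simp_all add: op_cat_def)

lemma hom_group_simps [simp]:
  "carrier (hom_group C A B) = Hom C A B" "monoid.mult (hom_group C A B) = Add C"
  "one (hom_group C A B) = ZeroMor C A B"
  by (simp_all add: hom_group_def)

context preadditive
begin

lemma Add_Hom: "f \<in> Hom C A B \<Longrightarrow> g \<in> Hom C A B \<Longrightarrow> f \<boxplus> g \<in> Hom C A B"
  using comm_group.axioms(2)[OF Hom_group] group.is_monoid monoid.m_closed Hom_Obj
  by (metis hom_group_simps(1,2))

lemma Add_simps [simp]:
  assumes "f \<in> Arr C" "g \<in> Arr C" "Dom C f = Dom C g" "Cod C f = Cod C g"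
  shows "f \<boxplus> g \<in> Arr C" "Dom C (f \<boxplus> g) = Dom C g" "Cod C (f \<boxplus> g) = Cod C g"
  using Add_Hom[of f "Dom C f" "Cod C f" g] assms by (auto simp: Hom_def)

lemma Zero_Hom: "A \<in> Obj C \<Longrightarrow> B \<in> Obj C \<Longrightarrow> ZeroMor C A B \<in> Hom C A B"
  using comm_group.axioms(2)[OF Hom_group] group.is_monoid monoid.one_closed
  by (metis hom_group_simps(1,3))

lemma Zero_simps [simp]:
  assumes "A \<in> Obj C" "B \<in> Obj C"
  shows "ZeroMor C A B \<in> Arr C" "Dom C (ZeroMor C A B) = A" "Cod C (ZeroMor C A B) = B"
  using Zero_Hom[OF assms] by (auto simp: Hom_def)

lemma Add_assoc:
  assumes "f \<in> Hom C A B" "g \<in> Hom C A B" "h \<in> Hom C A B"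
  shows "(f \<boxplus> g) \<boxplus> h = f \<boxplus> (g \<boxplus> h)"
proof -
  interpret G: comm_group "hom_group C A B" using Hom_group Hom_Obj assms by blast
  show ?thesis using G.m_assoc assms by simp
qed

lemma Add_commute:
  assumes "f \<in> Hom C A B" "g \<in> Hom C A B"
  shows "f \<boxplus> g = g \<boxplus> f"
proof -
  interpret G: comm_group "hom_group C A B" using Hom_group Hom_Obj assms by blast
  show ?thesis using G.m_comm assms by simp
qed

lemma Add_Zero [simp]:
  assumes "f \<in> Arr C" "Dom C f = A" "Cod C f = B"
  shows "f \<boxplus> ZeroMor C A B = f" "ZeroMor C A B \<boxplus> f = f"
proof -
  interpret G: comm_group "hom_group C A B" using Hom_group Dom_Obj Cod_Obj assms by blast
  have "f \<in> Hom C A B" using assms by (simp add: Hom_def)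
  then show "f \<boxplus> ZeroMor C A B = f" "ZeroMor C A B \<boxplus> f = f"
    using G.r_one G.l_one by auto
qed

lemma Add_right_cancel:
  assumes "f \<in> Hom C A B" "g \<in> Hom C A B" "h \<in> Hom C A B" "f \<boxplus> h = g \<boxplus> h"
  shows "f = g"
proof -
  interpret G: comm_group "hom_group C A B" using Hom_group Hom_Obj assms by blast
  show ?thesis using G.right_cancel assms by simp
qed

lemma Add_eq_right_imp_Zero:
  assumes "f \<in> Hom C A B" "h \<in> Hom C A B" "f \<boxplus> h = h"
  shows "f = ZeroMor C A B"
  by (rule Add_right_cancel[of f A B _ h]) (use assms Hom_Obj Zero_Hom in \<open>auto simp: Hom_def\<close>)

text \<open>Subtraction enters only through this lemma: a relation \<open>f - h = c\<close> is always used in the form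
\<open>f = c + h\<close>, which avoids computing with negatives of morphisms.\<close>

lemma difference:
  assumes "f \<in> Hom C A B" "h \<in> Hom C A B"
  obtains c where "c \<in> Hom C A B" "f = c \<boxplus> h"
proof -
  interpret G: comm_group "hom_group C A B" using Hom_group Hom_Obj assms by blast
  have "f = (f \<boxplus> inv\<^bsub>hom_group C A B\<^esub> h) \<boxplus> h"
    using G.m_assoc[of f "inv\<^bsub>hom_group C A B\<^esub> h" h] G.l_inv[of h] G.r_one[of f] G.inv_closed[of h] assms by simp
  moreover have "f \<boxplus> inv\<^bsub>hom_group C A B\<^esub> h \<in> Hom C A B"
    using G.inv_closed G.m_closed assms by simp
  ultimately show thesis using that by blast
qed

lemma Comp_Zero:
  assumes "f \<in> Hom C A B" "D \<in> Obj C"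
  shows "ZeroMor C B D \<bullet> f = ZeroMor C A D" "f \<bullet> ZeroMor C D A = ZeroMor C D B"
proof -
  have AB: "A \<in> Obj C" "B \<in> Obj C" using Hom_Obj assms by blast+
  have 1: "ZeroMor C B D \<bullet> f \<in> Hom C A D" "f \<bullet> ZeroMor C D A \<in> Hom C D B"
    using assms AB Comp_Hom Zero_Hom by blast+
  show "ZeroMor C B D \<bullet> f = ZeroMor C A D"
    by (rule Add_eq_right_imp_Zero[OF 1(1) 1(1)])
      (use assms AB Zero_Hom Comp_Add_left[of f A B "ZeroMor C B D" D "ZeroMor C B D"] in auto)
  show "f \<bullet> ZeroMor C D A = ZeroMor C D B"
    by (rule Add_eq_right_imp_Zero[OF 1(2) 1(2)])
      (use assms AB Zero_Hom Comp_Add_right[of "ZeroMor C D A" D A "ZeroMor C D A" f B] in auto)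
qed

lemma op_preadditive: "preadditive (op_cat C)"
proof -
  have eq: "hom_group (op_cat C) A B = hom_group C B A" for A B
    by (simp add: hom_group_def)
  show ?thesis
    by (intro preadditive.intro preadditive_axioms.intro op_category)
      (simp_all add: eq Hom_group Comp_Add_left Comp_Add_right)
qed

end

section \<open>Morphisms of sequences and homotopies\<close>

lemma finite_dependent_choice:
  fixes k :: nat
  assumes "P 1 x" "\<And>i x. 1 \<le> i \<Longrightarrow> i < k \<Longrightarrow> P i x \<Longrightarrow> \<exists>y. P (i + 1) y \<and> Q i x y"
  shows "\<exists>f. f 1 = x \<and> (\<forall>i\<in>{1..k}. P i (f i)) \<and> (\<forall>i\<in>{1..<k}. Q i (f i) (f (i + 1)))"
proof -
  define next_val where "next_val i x = (SOME y. P (i + 1) y \<and> Q i x y)" for i x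
  define f where "f = rec_nat undefined (\<lambda>i y. if i = 0 then x else next_val i y)"
  have f1: "f 1 = x" and fS: "\<And>i. 1 \<le> i \<Longrightarrow> f (i + 1) = next_val i (f i)"
    by (auto simp: f_def)
  have step: "P (i + 1) (f (i + 1)) \<and> Q i (f i) (f (i + 1))"
    if "1 \<le> i" "i < k" "P i (f i)" for i
    unfolding fS[OF that(1)] next_val_def by (rule someI_ex) (rule assms(2)[OF that])
  have "i \<le> k \<longrightarrow> P i (f i)" if "1 \<le> i" for i
    using that by (induction i rule: dec_induct) (use f1 assms(1) step in auto)
  then show ?thesis using f1 step by (intro exI[of _ f]) auto
qed

lemma is_pathD:
  assumes "is_path C k \<alpha>" "1 \<le> i" "i \<le> k"
  shows "\<alpha> i \<in> Hom C (obj_at C \<alpha> i) (obj_at C \<alpha> (Suc i))"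
  using assms by (auto simp: is_path_def)

lemma is_complexD:
  assumes "is_complex C k \<alpha>"
  shows "is_path C k \<alpha>"
    "1 \<le> i \<Longrightarrow> i < k \<Longrightarrow> \<alpha> (Suc i) \<bullet>\<^bsub>C\<^esub> \<alpha> i = ZeroMor C (obj_at C \<alpha> i) (obj_at C \<alpha> (i + 2))"
  using assms by (auto simp: is_complex_def)

lemma is_path_morD:
  assumes "is_path_mor C k \<alpha> \<beta> \<phi>"
  shows "1 \<le> i \<Longrightarrow> i \<le> Suc k \<Longrightarrow> \<phi> i \<in> Hom C (obj_at C \<alpha> i) (obj_at C \<beta> i)"
    "1 \<le> i \<Longrightarrow> i \<le> k \<Longrightarrow> \<phi> (Suc i) \<bullet>\<^bsub>C\<^esub> \<alpha> i = \<beta> i \<bullet>\<^bsub>C\<^esub> \<phi> i"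
  using assms by (auto simp: is_path_mor_def)

lemma right_exactD:
  assumes "right_exact C k \<alpha>" "A \<in> Obj C"
  shows "h \<in> Hom C (obj_at C \<alpha> (Suc k)) A \<Longrightarrow> h \<bullet>\<^bsub>C\<^esub> \<alpha> k = ZeroMor C (obj_at C \<alpha> k) A \<Longrightarrow>
      h = ZeroMor C (obj_at C \<alpha> (Suc k)) A"
    and "2 \<le> i \<Longrightarrow> i \<le> k \<Longrightarrow> h \<in> Hom C (obj_at C \<alpha> i) A \<Longrightarrow>
      h \<bullet>\<^bsub>C\<^esub> \<alpha> (i - 1) = ZeroMor C (obj_at C \<alpha> (i - 1)) A \<Longrightarrow>
      \<exists>h'\<in>Hom C (obj_at C \<alpha> (Suc i)) A. h = h' \<bullet>\<^bsub>C\<^esub> \<alpha> i"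
  using assms by (auto simp: right_exact_def)

lemma right_exact_complex: "right_exact C k \<alpha> \<Longrightarrow> is_complex C k \<alpha>"
  by (simp add: right_exact_def)

text \<open>Reversing twice changes the irrelevant values of a sequence, so this holds only for indices in the
range of the sequence.\<close>

lemma rev_seq_rev_seq: "1 \<le> i \<Longrightarrow> i \<le> k \<Longrightarrow> rev_seq k (rev_seq k \<alpha>) i = \<alpha> i"
  by (simp add: rev_seq_def)

lemma obj_at_rev_seq:
  assumes "is_path C k \<alpha>" "1 \<le> k" "1 \<le> i" "i \<le> Suc k"
  shows "obj_at (op_cat C) (rev_seq k \<alpha>) i = obj_at C \<alpha> (k + 2 - i)"
proof (cases "i = 1")
  case True
  then show ?thesis using assms by (auto simp: obj_at_def rev_seq_def)
next
  case False
  then have "obj_at (op_cat C) (rev_seq k \<alpha>) i = Dom C (\<alpha> (k + 2 - i))"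
    using assms by (auto simp: obj_at_def rev_seq_def Suc_diff_le numeral_2_eq_2)
  then show ?thesis
    using is_pathD[OF assms(1), of "k + 2 - i"] assms False by (auto simp: Hom_def)
qed

lemma rev_seq_at: "rev_seq k \<alpha> i = \<alpha> (k + 1 - i)"
  by (simp add: rev_seq_def)

lemma is_path_rev_seq:
  assumes "is_path C k \<alpha>" "1 \<le> k"
  shows "is_path (op_cat C) k (rev_seq k \<alpha>)"
  unfolding is_path_def
proof
  fix i assume i: "i \<in> {1..k}"
  have "Suc (k + 2 - (i + 1)) = k + 2 - i" "k + 2 - (i + 1) = k + 1 - i" using i by auto
  then show "rev_seq k \<alpha> i \<in> Hom (op_cat C) (obj_at (op_cat C) (rev_seq k \<alpha>) i)
      (obj_at (op_cat C) (rev_seq k \<alpha>) (i + 1))"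
    using i is_pathD[OF assms(1), of "k + 1 - i"] assms
    by (auto simp: obj_at_rev_seq rev_seq_at)
qed

lemma is_complex_rev_seq:
  assumes "is_complex C k \<alpha>" "1 \<le> k"
  shows "is_complex (op_cat C) k (rev_seq k \<alpha>)"
  unfolding is_complex_def
proof (intro conjI ballI)
  show "is_path (op_cat C) k (rev_seq k \<alpha>)"
    using is_path_rev_seq is_complexD assms by blast
  fix i assume i: "i \<in> {1..<k}"
  have "Suc (k - i) = k + 1 - i" "Suc (Suc k - i) = Suc (Suc k) - i" using i by auto
  then show "rev_seq k \<alpha> (i + 1) \<bullet>\<^bsub>op_cat C\<^esub> rev_seq k \<alpha> i =
      ZeroMor (op_cat C) (obj_at (op_cat C) (rev_seq k \<alpha>) i) (obj_at (op_cat C) (rev_seq k \<alpha>) (i + 2))"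
    using i is_complexD(2)[OF assms(1), of "k - i"] is_complexD(1)[OF assms(1)] assms(2)
    by (auto simp: obj_at_rev_seq rev_seq_at)
qed

lemma is_path_mor_rev_seq:
  assumes "is_path_mor C k \<alpha> \<beta> \<phi>" "is_path C k \<alpha>" "is_path C k \<beta>" "1 \<le> k"
  shows "is_path_mor (op_cat C) k (rev_seq k \<beta>) (rev_seq k \<alpha>) (\<lambda>i. \<phi> (k + 2 - i))"
  unfolding is_path_mor_def
proof (intro conjI ballI)
  fix i assume "i \<in> {1..k + 1}"
  then show "\<phi> (k + 2 - i) \<in> Hom (op_cat C) (obj_at (op_cat C) (rev_seq k \<beta>) i)
      (obj_at (op_cat C) (rev_seq k \<alpha>) i)"
    using is_path_morD(1)[OF assms(1), of "k + 2 - i"] assms by (auto simp: obj_at_rev_seq)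
next
  fix i assume i: "i \<in> {1..k}"
  have "Suc (k + 1 - i) = k + 2 - i" "k + 2 - (i + 1) = k + 1 - i" using i by auto
  then show "\<phi> (k + 2 - (i + 1)) \<bullet>\<^bsub>op_cat C\<^esub> rev_seq k \<beta> i =
      rev_seq k \<alpha> i \<bullet>\<^bsub>op_cat C\<^esub> \<phi> (k + 2 - i)"
    using i is_path_morD(2)[OF assms(1), of "k + 1 - i"] assms by (auto simp: rev_seq_at)
qed

context preadditive
begin

text \<open>The comparison theorem for a right exact source.  A homotopy between \<open>\<mu>\<close> and \<open>\<nu>\<close> is built from left to
right, starting from the given \<open>t\<close>: when \<open>h\<^sub>1, \<dots>, h\<^sub>i\<close> are known, the defect
\<open>c = \<mu>\<^sub>i\<^sub>+\<^sub>1 - \<nu>\<^sub>i\<^sub>+\<^sub>1 - \<beta>\<^sub>i h\<^sub>i\<close> is killed by \<open>\<alpha>\<^sub>i\<close>, hence factors through \<open>\<alpha>\<^sub>i\<^sub>+\<^sub>1\<close>, or vanishes at the right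
end, where \<open>\<alpha>\<^sub>k\<close> is an epimorphism.\<close>

lemma homotopy_right_exact:
  assumes \<alpha>: "right_exact C k \<alpha>" and \<beta>: "is_complex C k \<beta>" and k: "1 \<le> k"
    and \<mu>: "is_path_mor C k \<alpha> \<beta> \<mu>" and \<nu>: "is_path_mor C k \<alpha> \<beta> \<nu>"
    and t: "t \<in> Hom C (obj_at C \<alpha> 2) (obj_at C \<beta> 1)" and \<mu>1: "\<mu> 1 = \<nu> 1 \<boxplus> (t \<bullet> \<alpha> 1)"
  shows "\<exists>h. h 1 = t \<and> (\<forall>i\<in>{1..k}. h i \<in> Hom C (obj_at C \<alpha> (Suc i)) (obj_at C \<beta> i)) \<and>
    (\<forall>i\<in>{2..k}. \<mu> i = (\<nu> i \<boxplus> (\<beta> (i - 1) \<bullet> h (i - 1))) \<boxplus> (h i \<bullet> \<alpha> i)) \<and>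
    \<mu> (Suc k) = \<nu> (Suc k) \<boxplus> (\<beta> k \<bullet> h k)"
proof -
  let ?a = "obj_at C \<alpha>" and ?b = "obj_at C \<beta>"
  have \<alpha>h: "\<alpha> i \<in> Hom C (?a i) (?a (Suc i))" if "1 \<le> i" "i \<le> k" for i
    using is_pathD[OF is_complexD(1)[OF right_exact_complex[OF \<alpha>]]] that by blast
  have \<beta>h: "\<beta> i \<in> Hom C (?b i) (?b (Suc i))" if "1 \<le> i" "i \<le> k" for i
    using is_pathD[OF is_complexD(1)[OF \<beta>]] that by blast
  have \<mu>h: "\<mu> i \<in> Hom C (?a i) (?b i)" and \<nu>h: "\<nu> i \<in> Hom C (?a i) (?b i)" if "1 \<le> i" "i \<le> Suc k" for i
    using is_path_morD(1)[OF \<mu>] is_path_morD(1)[OF \<nu>] that by blast+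
  \<comment> \<open>What step i + 1 needs to know about \<open>h\<^sub>i\<close>: this equation is the vanishing of the defect on \<open>\<alpha>\<^sub>i\<close>.
It does not mention \<open>h\<^sub>i\<^sub>-\<^sub>1\<close>, because \<open>\<beta>\<^sub>i \<beta>\<^sub>i\<^sub>-\<^sub>1 = 0\<close>.\<close>
  define P where "P i h \<longleftrightarrow> h \<in> Hom C (?a (Suc i)) (?b i) \<and>
    \<beta> i \<bullet> \<mu> i = \<beta> i \<bullet> (\<nu> i \<boxplus> (h \<bullet> \<alpha> i))" for i h
  have defect: "\<exists>c\<in>Hom C (?a (Suc i)) (?b (Suc i)). \<mu> (Suc i) = c \<boxplus> (\<nu> (Suc i) \<boxplus> (\<beta> i \<bullet> h)) \<and>
      c \<bullet> \<alpha> i = ZeroMor C (?a i) (?b (Suc i))"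
    if i: "1 \<le> i" "i \<le> k" and P: "P i h" for i h
  proof -
    have h: "h \<in> Hom C (?a (Suc i)) (?b i)" using P by (simp add: P_def)
    note hs = \<alpha>h[OF i] \<beta>h[OF i] h \<mu>h[of "Suc i"] \<nu>h[of "Suc i"] \<mu>h[of i] \<nu>h[of i]
    have "\<mu> (Suc i) \<in> Hom C (?a (Suc i)) (?b (Suc i))"
      "\<nu> (Suc i) \<boxplus> (\<beta> i \<bullet> h) \<in> Hom C (?a (Suc i)) (?b (Suc i))"
      using hs i by (auto simp: Hom_def)
    then obtain c where c: "c \<in> Hom C (?a (Suc i)) (?b (Suc i))"
      and eq: "\<mu> (Suc i) = c \<boxplus> (\<nu> (Suc i) \<boxplus> (\<beta> i \<bullet> h))"
      using difference by blast
    let ?r = "(\<nu> (Suc i) \<boxplus> (\<beta> i \<bullet> h)) \<bullet> \<alpha> i"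
    have "?r = (\<nu> (Suc i) \<bullet> \<alpha> i) \<boxplus> ((\<beta> i \<bullet> h) \<bullet> \<alpha> i)"
      by (rule Comp_Add_left[of _ "?a i" "?a (Suc i)" _ "?b (Suc i)"])
        (use hs i in \<open>auto simp: Hom_def\<close>)
    also have "\<dots> = (\<beta> i \<bullet> \<nu> i) \<boxplus> (\<beta> i \<bullet> (h \<bullet> \<alpha> i))"
      using hs i is_path_morD(2)[OF \<nu>, of i] Comp_assoc by auto
    also have "\<dots> = \<beta> i \<bullet> (\<nu> i \<boxplus> (h \<bullet> \<alpha> i))"
      by (rule Comp_Add_right[symmetric, of _ "?a i" "?b i" _ _ "?b (Suc i)"])
        (use hs i in \<open>auto simp: Hom_def\<close>)
    also have "\<dots> = \<mu> (Suc i) \<bullet> \<alpha> i" using P is_path_morD(2)[OF \<mu>, of i] i by (simp add: P_def)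
    also have "\<dots> = (c \<bullet> \<alpha> i) \<boxplus> ?r"
      unfolding eq by (rule Comp_Add_left[of _ "?a i" "?a (Suc i)" _ "?b (Suc i)"])
        (use hs i c in \<open>auto simp: Hom_def\<close>)
    finally have "(c \<bullet> \<alpha> i) \<boxplus> ?r = ?r" by simp
    then have "c \<bullet> \<alpha> i = ZeroMor C (?a i) (?b (Suc i))"
      by (rule Add_eq_right_imp_Zero[rotated 2]) (use hs i c in \<open>auto simp: Hom_def\<close>)
    then show ?thesis using c eq by blast
  qed
  define Q where "Q i h h' \<longleftrightarrow> \<mu> (Suc i) = (\<nu> (Suc i) \<boxplus> (\<beta> i \<bullet> h)) \<boxplus> (h' \<bullet> \<alpha> (Suc i))" for i h h'
  have P1: "P 1 t" using t \<mu>1 by (simp add: P_def numeral_2_eq_2)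
  have step: "\<exists>h'. P (i + 1) h' \<and> Q i h h'" if i: "1 \<le> i" "i < k" and P: "P i h" for i h
  proof -
    have h: "h \<in> Hom C (?a (Suc i)) (?b i)" using P by (simp add: P_def)
    obtain c where c: "c \<in> Hom C (?a (Suc i)) (?b (Suc i))"
      and eq: "\<mu> (Suc i) = c \<boxplus> (\<nu> (Suc i) \<boxplus> (\<beta> i \<bullet> h))"
      and c0: "c \<bullet> \<alpha> i = ZeroMor C (?a i) (?b (Suc i))"
      using defect[of i h] i P by auto
    obtain h' where h': "h' \<in> Hom C (?a (Suc (Suc i))) (?b (Suc i))" and ch': "c = h' \<bullet> \<alpha> (Suc i)"
      using right_exactD(2)[OF \<alpha>, of "?b (Suc i)" "Suc i" c] c c0 i Hom_Obj by auto
    note hs = \<alpha>h[of i] \<beta>h[of i] \<alpha>h[of "Suc i"] \<beta>h[of "Suc i"] h h' \<mu>h[of "Suc i"] \<nu>h[of "Suc i"]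
    have Q: "Q i h h'"
      unfolding Q_def eq ch'[symmetric]
      by (rule Add_commute[of _ "?a (Suc i)" "?b (Suc i)"]) (use hs i c in \<open>auto simp: Hom_def\<close>)
    have "\<beta> (Suc i) \<bullet> (\<nu> (Suc i) \<boxplus> (\<beta> i \<bullet> h)) = (\<beta> (Suc i) \<bullet> \<nu> (Suc i)) \<boxplus> (\<beta> (Suc i) \<bullet> (\<beta> i \<bullet> h))"
      by (rule Comp_Add_right[of _ "?a (Suc i)" "?b (Suc i)" _ _ "?b (Suc (Suc i))"])
        (use hs i in \<open>auto simp: Hom_def\<close>)
    also have "\<beta> (Suc i) \<bullet> (\<beta> i \<bullet> h) = (\<beta> (Suc i) \<bullet> \<beta> i) \<bullet> h"
      by (rule Comp_assoc[symmetric]) (use hs i in auto)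
    also have "\<beta> (Suc i) \<bullet> \<beta> i = ZeroMor C (?b i) (?b (Suc (Suc i)))"
      using is_complexD(2)[OF \<beta>, of i] i by simp
    also have "\<dots> \<bullet> h = ZeroMor C (?a (Suc i)) (?b (Suc (Suc i)))"
      by (rule Comp_Zero[OF h]) (use Hom_Obj hs i in auto)
    also have "(\<beta> (Suc i) \<bullet> \<nu> (Suc i)) \<boxplus> ZeroMor C (?a (Suc i)) (?b (Suc (Suc i))) = \<beta> (Suc i) \<bullet> \<nu> (Suc i)"
      by (rule Add_Zero) (use hs i in \<open>auto simp: Hom_def\<close>)
    finally have 1: "\<beta> (Suc i) \<bullet> (\<nu> (Suc i) \<boxplus> (\<beta> i \<bullet> h)) = \<beta> (Suc i) \<bullet> \<nu> (Suc i)" .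
    have "\<beta> (Suc i) \<bullet> \<mu> (Suc i) =
        (\<beta> (Suc i) \<bullet> (\<nu> (Suc i) \<boxplus> (\<beta> i \<bullet> h))) \<boxplus> (\<beta> (Suc i) \<bullet> (h' \<bullet> \<alpha> (Suc i)))"
      unfolding Q[unfolded Q_def]
      by (rule Comp_Add_right[of _ "?a (Suc i)" "?b (Suc i)" _ _ "?b (Suc (Suc i))"])
        (use hs i in \<open>auto simp: Hom_def\<close>)
    also have "\<dots> = \<beta> (Suc i) \<bullet> (\<nu> (Suc i) \<boxplus> (h' \<bullet> \<alpha> (Suc i)))"
      unfolding 1 by (rule Comp_Add_right[symmetric, of _ "?a (Suc i)" "?b (Suc i)" _ _ "?b (Suc (Suc i))"])
        (use hs i in \<open>auto simp: Hom_def\<close>)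
    finally have "P (i + 1) h'" using h' by (simp add: P_def)
    then show ?thesis using Q by blast
  qed
  obtain h where h1: "h 1 = t" and hP: "\<forall>i\<in>{1..k}. P i (h i)"
    and hQ: "\<forall>i\<in>{1..<k}. Q i (h i) (h (i + 1))"
    using finite_dependent_choice[of P t k Q] P1 step by blast
  have "\<mu> (Suc k) = \<nu> (Suc k) \<boxplus> (\<beta> k \<bullet> h k)"
  proof -
    obtain c where c: "c \<in> Hom C (?a (Suc k)) (?b (Suc k))"
      and eq: "\<mu> (Suc k) = c \<boxplus> (\<nu> (Suc k) \<boxplus> (\<beta> k \<bullet> h k))"
      and c0: "c \<bullet> \<alpha> k = ZeroMor C (?a k) (?b (Suc k))"
      using defect[of k "h k"] k hP by auto
    have "c = ZeroMor C (?a (Suc k)) (?b (Suc k))"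
      using right_exactD(1)[OF \<alpha>] c c0 Hom_Obj by blast
    moreover have "\<nu> (Suc k) \<boxplus> (\<beta> k \<bullet> h k) \<in> Hom C (?a (Suc k)) (?b (Suc k))"
      using \<nu>h[of "Suc k"] \<beta>h[of k] hP k by (auto simp: Hom_def P_def)
    ultimately show ?thesis using eq by (auto simp: Hom_def)
  qed
  moreover have "\<mu> i = (\<nu> i \<boxplus> (\<beta> (i - 1) \<bullet> h (i - 1))) \<boxplus> (h i \<bullet> \<alpha> i)" if "i \<in> {2..k}" for i
  proof -
    have "i - 1 \<in> {1..<k}" "Suc (i - 1) = i" using that by auto
    then show ?thesis using hQ[rule_format, of "i - 1"] by (simp add: Q_def)
  qed
  ultimately show ?thesis using h1 hP by (intro exI[of _ h]) (auto simp: P_def)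
qed

text \<open>The previous lemma in the opposite category.  Only the left end of the homotopy is kept: it says how
a factorization of \<open>\<mu> - \<nu>\<close> at the right end forces one at the left end.\<close>

lemma homotopy_left_exact:
  assumes \<alpha>: "is_complex C k \<alpha>" and \<beta>: "is_complex C k \<beta>" and ex: "left_exact C k \<beta>" and k: "1 \<le> k"
    and \<mu>: "is_path_mor C k \<alpha> \<beta> \<mu>" and \<nu>: "is_path_mor C k \<alpha> \<beta> \<nu>"
    and s: "s \<in> Hom C (obj_at C \<alpha> (Suc k)) (obj_at C \<beta> k)"
    and eq: "\<mu> (Suc k) = \<nu> (Suc k) \<boxplus> (\<beta> k \<bullet> s)"
  shows "\<exists>t\<in>Hom C (obj_at C \<alpha> 2) (obj_at C \<beta> 1). \<mu> 1 = \<nu> 1 \<boxplus> (t \<bullet> \<alpha> 1)"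
proof -
  interpret op: preadditive "op_cat C" by (rule op_preadditive)
  note p = is_complexD(1)[OF \<alpha>] is_complexD(1)[OF \<beta>]
  note r = obj_at_rev_seq[OF p(1) k] obj_at_rev_seq[OF p(2) k]
  have "\<exists>h. h 1 = s \<and> (\<forall>i\<in>{1..k}. h i \<in> Hom (op_cat C) (obj_at (op_cat C) (rev_seq k \<beta>) (Suc i))
      (obj_at (op_cat C) (rev_seq k \<alpha>) i)) \<and>
    (\<forall>i\<in>{2..k}. \<mu> (k + 2 - i) = (\<nu> (k + 2 - i) \<boxplus>\<^bsub>op_cat C\<^esub> (rev_seq k \<alpha> (i - 1) \<bullet>\<^bsub>op_cat C\<^esub> h (i - 1)))
      \<boxplus>\<^bsub>op_cat C\<^esub> (h i \<bullet>\<^bsub>op_cat C\<^esub> rev_seq k \<beta> i)) \<and>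
    \<mu> (k + 2 - Suc k) = \<nu> (k + 2 - Suc k) \<boxplus>\<^bsub>op_cat C\<^esub> (rev_seq k \<alpha> k \<bullet>\<^bsub>op_cat C\<^esub> h k)"
    by (rule op.homotopy_right_exact[OF _ is_complex_rev_seq[OF \<alpha> k] k is_path_mor_rev_seq[OF \<mu> p k]
          is_path_mor_rev_seq[OF \<nu> p k]])
      (use ex s eq k r in \<open>auto simp: left_exact_def rev_seq_at\<close>)
  then obtain h where h: "\<forall>i\<in>{1..k}. h i \<in> Hom (op_cat C) (obj_at (op_cat C) (rev_seq k \<beta>) (Suc i))
      (obj_at (op_cat C) (rev_seq k \<alpha>) i)"
    and "\<mu> (k + 2 - Suc k) = \<nu> (k + 2 - Suc k) \<boxplus>\<^bsub>op_cat C\<^esub> (rev_seq k \<alpha> k \<bullet>\<^bsub>op_cat C\<^esub> h k)"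
    by blast
  then have "\<mu> 1 = \<nu> 1 \<boxplus> (h k \<bullet> \<alpha> 1)" by (simp add: rev_seq_at)
  moreover have "h k \<in> Hom C (obj_at C \<alpha> 2) (obj_at C \<beta> 1)"
    using bspec[OF h, of k] k by (simp add: r)
  ultimately show ?thesis by blast
qed

text \<open>Beyond the first square, right exactness of the source alone produces the components: \<open>\<beta>\<^sub>i\<^sub>+\<^sub>1 \<psi>\<^sub>i\<^sub>+\<^sub>1\<close>
is killed by \<open>\<alpha>\<^sub>i\<close>, hence factors through \<open>\<alpha>\<^sub>i\<^sub>+\<^sub>1\<close>.\<close>

lemma extend_to_path_mor:
  assumes \<alpha>: "right_exact C k \<alpha>" and \<beta>: "is_complex C k \<beta>" and k: "1 \<le> k"
    and g: "g \<in> Hom C (obj_at C \<alpha> 1) (obj_at C \<beta> 1)"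
    and x: "x \<in> Hom C (obj_at C \<alpha> 2) (obj_at C \<beta> 2)" "x \<bullet> \<alpha> 1 = \<beta> 1 \<bullet> g"
  shows "\<exists>\<psi>. is_path_mor C k \<alpha> \<beta> \<psi> \<and> \<psi> 1 = g"
proof -
  let ?a = "obj_at C \<alpha>" and ?b = "obj_at C \<beta>"
  have \<alpha>h: "\<alpha> i \<in> Hom C (?a i) (?a (Suc i))" if "1 \<le> i" "i \<le> k" for i
    using is_pathD[OF is_complexD(1)[OF right_exact_complex[OF \<alpha>]]] that by blast
  have \<beta>h: "\<beta> i \<in> Hom C (?b i) (?b (Suc i))" if "1 \<le> i" "i \<le> k" for i
    using is_pathD[OF is_complexD(1)[OF \<beta>]] that by blast
  define P where "P i y \<longleftrightarrow> y \<in> Hom C (?a i) (?b i) \<and>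
    (i \<le> k \<longrightarrow> (\<exists>y'\<in>Hom C (?a (Suc i)) (?b (Suc i)). y' \<bullet> \<alpha> i = \<beta> i \<bullet> y))" for i y
  have P1: "P 1 g" using g x by (auto simp: P_def numeral_2_eq_2)
  have step: "\<exists>y'. P (i + 1) y' \<and> y' \<bullet> \<alpha> i = \<beta> i \<bullet> y"
    if i: "1 \<le> i" "i < Suc k" and P: "P i y" for i y
  proof -
    obtain y' where y': "y' \<in> Hom C (?a (Suc i)) (?b (Suc i))" "y' \<bullet> \<alpha> i = \<beta> i \<bullet> y"
      using P i by (auto simp: P_def)
    have y: "y \<in> Hom C (?a i) (?b i)" using P by (simp add: P_def)
    have "\<exists>y''\<in>Hom C (?a (Suc (Suc i))) (?b (Suc (Suc i))). y'' \<bullet> \<alpha> (Suc i) = \<beta> (Suc i) \<bullet> y'"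
      if "Suc i \<le> k"
    proof -
      have "(\<beta> (Suc i) \<bullet> y') \<bullet> \<alpha> i = \<beta> (Suc i) \<bullet> (\<beta> i \<bullet> y)"
        using Comp_assoc[OF \<alpha>h y'(1) \<beta>h] y'(2) i that by auto
      also have "\<dots> = (\<beta> (Suc i) \<bullet> \<beta> i) \<bullet> y"
        by (rule Comp_assoc[symmetric, OF y \<beta>h \<beta>h]) (use i that in auto)
      also have "\<beta> (Suc i) \<bullet> \<beta> i = ZeroMor C (?b i) (?b (Suc (Suc i)))"
        using is_complexD(2)[OF \<beta>, of i] i that by simp
      also have "\<dots> \<bullet> y = ZeroMor C (?a i) (?b (Suc (Suc i)))"
        by (rule Comp_Zero[OF y]) (use Hom_Obj \<beta>h[of "Suc i"] that in auto)
      finally show ?thesis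
        using right_exactD(2)[OF \<alpha>, of "?b (Suc (Suc i))" "Suc i" "\<beta> (Suc i) \<bullet> y'"] i that
          Comp_Hom[OF y'(1) \<beta>h] Hom_Obj \<beta>h[of "Suc i"] by fastforce
    qed
    then have "P (i + 1) y'" using y' by (simp add: P_def)
    then show ?thesis using y' by blast
  qed
  obtain \<psi> where "\<psi> 1 = g" "\<forall>i\<in>{1..Suc k}. P i (\<psi> i)"
    "\<forall>i\<in>{1..<Suc k}. \<psi> (i + 1) \<bullet> \<alpha> i = \<beta> i \<bullet> \<psi> i"
    using finite_dependent_choice[of P g "Suc k" "\<lambda>i y y'. y' \<bullet> \<alpha> i = \<beta> i \<bullet> y"] P1 step by blast
  then show ?thesis by (intro exI[of _ \<psi>]) (auto simp: is_path_mor_def P_def)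
qed

lemma is_path_mor_Zero:
  assumes "is_path C k \<alpha>" "is_path C k \<beta>" "1 \<le> k"
  shows "is_path_mor C k \<alpha> \<beta> (\<lambda>i. ZeroMor C (obj_at C \<alpha> i) (obj_at C \<beta> i))"
proof -
  have o: "obj_at C \<gamma> i \<in> Obj C" if "is_path C k \<gamma>" "1 \<le> i" "i \<le> Suc k" for i \<gamma>
    using is_pathD[OF that(1), of i] is_pathD[OF that(1), of "i - 1"] Hom_Obj that \<open>1 \<le> k\<close>
    by (cases "i = Suc k") auto
  show ?thesis unfolding is_path_mor_def
  proof (intro conjI ballI)
    fix i assume "i \<in> {1..k + 1}"
    then show "ZeroMor C (obj_at C \<alpha> i) (obj_at C \<beta> i) \<in> Hom C (obj_at C \<alpha> i) (obj_at C \<beta> i)"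
      using Zero_Hom o assms by auto
  next
    fix i assume i: "i \<in> {1..k}"
    then show "ZeroMor C (obj_at C \<alpha> (i + 1)) (obj_at C \<beta> (i + 1)) \<bullet> \<alpha> i =
        \<beta> i \<bullet> ZeroMor C (obj_at C \<alpha> i) (obj_at C \<beta> i)"
      using Comp_Zero(1)[OF is_pathD[OF assms(1), of i] o[OF assms(2), of "Suc i"]]
        Comp_Zero(2)[OF is_pathD[OF assms(2), of i] o[OF assms(1), of i]] by auto
  qed
qed

lemma is_path_mor_Comp:
  assumes "is_path_mor C k \<alpha> \<beta> \<phi>" "is_path_mor C k \<beta> \<gamma> \<psi>"
    "is_path C k \<alpha>" "is_path C k \<beta>" "is_path C k \<gamma>"
  shows "is_path_mor C k \<alpha> \<gamma> (\<lambda>i. \<psi> i \<bullet> \<phi> i)"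
  unfolding is_path_mor_def
proof (intro conjI ballI)
  fix i assume "i \<in> {1..k + 1}"
  then show "\<psi> i \<bullet> \<phi> i \<in> Hom C (obj_at C \<alpha> i) (obj_at C \<gamma> i)"
    using Comp_Hom[OF is_path_morD(1)[OF assms(1)] is_path_morD(1)[OF assms(2)]] by auto
next
  fix i assume i: "i \<in> {1..k}"
  note hs = is_path_morD(1)[OF assms(1), of i] is_path_morD(1)[OF assms(1), of "Suc i"]
    is_path_morD(1)[OF assms(2), of i] is_path_morD(1)[OF assms(2), of "Suc i"]
    is_pathD[OF assms(3), of i] is_pathD[OF assms(4), of i] is_pathD[OF assms(5), of i]
  have "(\<psi> (Suc i) \<bullet> \<phi> (Suc i)) \<bullet> \<alpha> i = \<psi> (Suc i) \<bullet> (\<beta> i \<bullet> \<phi> i)"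
    using hs i Comp_assoc is_path_morD(2)[OF assms(1), of i] by auto
  also have "\<dots> = (\<gamma> i \<bullet> \<psi> i) \<bullet> \<phi> i"
    using hs i Comp_assoc[of "\<phi> i" "obj_at C \<alpha> i" "obj_at C \<beta> i" "\<beta> i" "obj_at C \<beta> (Suc i)"
      "\<psi> (Suc i)" "obj_at C \<gamma> (Suc i)"] is_path_morD(2)[OF assms(2), of i] by auto
  finally show "(\<psi> (i + 1) \<bullet> \<phi> (i + 1)) \<bullet> \<alpha> i = \<gamma> i \<bullet> (\<psi> i \<bullet> \<phi> i)"
    using hs i Comp_assoc by auto
qed

end

section \<open>Integers acting on a preadditive category\<close>

text \<open>The integer multiples of identities are natural, and they are preserved by every additive functor
because they are powers in the groups of endomorphisms.\<close>

definition int_id :: "('o, 'm) cat \<Rightarrow> int \<Rightarrow> 'o \<Rightarrow> 'm" where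
  "int_id C d A = Ident C A [^]\<^bsub>hom_group C A A\<^esub> d"

context preadditive
begin

lemma int_id_Hom: "A \<in> Obj C \<Longrightarrow> int_id C d A \<in> Hom C A A"
proof -
  assume A: "A \<in> Obj C"
  interpret G: comm_group "hom_group C A A" using Hom_group A by blast
  show ?thesis using G.int_pow_closed[of "Ident C A" d] Ident_Hom A by (simp add: int_id_def)
qed

lemma int_id_comp:
  assumes f: "f \<in> Hom C A B"
  shows "f \<bullet> int_id C d A = int_id C d B \<bullet> f"
proof -
  have AB: "A \<in> Obj C" "B \<in> Obj C" using Hom_Obj f by blast+
  interpret GA: comm_group "hom_group C A A" using Hom_group AB by blast
  interpret GB: comm_group "hom_group C B B" using Hom_group AB by blast
  interpret GAB: comm_group "hom_group C A B" using Hom_group AB by blast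
  have "(\<lambda>x. f \<bullet> x) \<in> hom (hom_group C A A) (hom_group C A B)"
    using f Comp_Hom Comp_Add_right by (auto simp: hom_def)
  then have 1: "f \<bullet> int_id C d A = (f \<bullet> Ident C A) [^]\<^bsub>hom_group C A B\<^esub> d"
    unfolding int_id_def by (rule hom_int_pow) (use Ident_Hom AB GA.is_group GAB.is_group in auto)
  have "(\<lambda>x. x \<bullet> f) \<in> hom (hom_group C B B) (hom_group C A B)"
    using f Comp_Hom Comp_Add_left by (auto simp: hom_def)
  then have 2: "int_id C d B \<bullet> f = (Ident C B \<bullet> f) [^]\<^bsub>hom_group C A B\<^esub> d"
    unfolding int_id_def by (rule hom_int_pow) (use Ident_Hom AB GB.is_group GAB.is_group in auto)
  show ?thesis using 1 2 Ident_left[OF f] Ident_right[OF f] by simp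
qed

lemma is_path_mor_int_id:
  assumes "is_path C k \<alpha>" "1 \<le> k"
  shows "is_path_mor C k \<alpha> \<alpha> (\<lambda>i. int_id C d (obj_at C \<alpha> i))"
proof -
  have o: "obj_at C \<alpha> i \<in> Obj C" if "1 \<le> i" "i \<le> Suc k" for i
    using is_pathD[OF assms(1), of i] is_pathD[OF assms(1), of "i - 1"] Hom_Obj that \<open>1 \<le> k\<close>
    by (cases "i = Suc k") auto
  show ?thesis unfolding is_path_mor_def
    using int_id_Hom o int_id_comp[OF is_pathD[OF assms(1)]] by auto
qed

end

section \<open>The stable category\<close>

text \<open>The hypotheses make the morphisms that factor through \<open>I\<close> a two-sided ideal; closure under
biproducts is what makes it closed under addition.\<close>

locale stabilization = additive_category E for E :: "('o, 'm) cat" (structure) +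
  fixes I :: "'o set"
  assumes I_Obj: "I \<subseteq> Obj E"
    and I_nonempty: "I \<noteq> {}"
    and I_sum: "J \<in> I \<Longrightarrow> K \<in> I \<Longrightarrow> \<exists>S\<in>I. \<exists>j1 j2 q1 q2. is_biproduct E J K S j1 j2 q1 q2"
begin

definition null :: "'o \<Rightarrow> 'o \<Rightarrow> 'm set" where
  "null A B = {v \<bullet> u | u v J. J \<in> I \<and> u \<in> Hom E A J \<and> v \<in> Hom E J B}"

abbreviation cl :: "'m \<Rightarrow> 'm set" where "cl \<equiv> stable_class E I"
abbreviation St :: "('o, 'm set) cat" where "St \<equiv> stable_category E I"

lemma nullI: "J \<in> I \<Longrightarrow> u \<in> Hom E A J \<Longrightarrow> v \<in> Hom E J B \<Longrightarrow> v \<bullet> u \<in> null A B"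
  by (auto simp: null_def)

lemma null_Hom: "z \<in> null A B \<Longrightarrow> z \<in> Hom E A B"
  using Comp_Hom by (auto simp: null_def)

lemma null_Zero: "A \<in> Obj E \<Longrightarrow> B \<in> Obj E \<Longrightarrow> ZeroMor E A B \<in> null A B"
proof -
  assume AB: "A \<in> Obj E" "B \<in> Obj E"
  obtain J where "J \<in> I" "J \<in> Obj E" using I_Obj I_nonempty by blast
  then show ?thesis
    using nullI[OF \<open>J \<in> I\<close>, of "ZeroMor E A J" A "ZeroMor E J B" B] AB Zero_Hom
      Comp_Zero(1)[of "ZeroMor E A J" A J B] by simp
qed

lemma null_Comp:
  assumes "z \<in> null A B"
  shows "f \<in> Hom E B D \<Longrightarrow> f \<bullet> z \<in> null A D" "f \<in> Hom E D A \<Longrightarrow> z \<bullet> f \<in> null D B"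
proof -
  obtain u v J where z: "z = v \<bullet> u" "J \<in> I" "u \<in> Hom E A J" "v \<in> Hom E J B"
    using assms by (auto simp: null_def)
  show "f \<bullet> z \<in> null A D" if f: "f \<in> Hom E B D"
    using nullI[OF z(2,3) Comp_Hom[OF z(4) f]] Comp_assoc[OF z(3,4) f] z(1) by simp
  show "z \<bullet> f \<in> null D B" if f: "f \<in> Hom E D A"
    using nullI[OF z(2) Comp_Hom[OF f z(3)] z(4)] Comp_assoc[OF f z(3,4)] z(1) by simp
qed

text \<open>If \<open>z\<close> factors through \<open>J\<close> and \<open>w\<close> through \<open>K\<close>, then \<open>z + w\<close> factors through \<open>J \<oplus> K\<close>.\<close>

lemma null_Add:
  assumes "z \<in> null A B" "w \<in> null A B"
  shows "z \<boxplus> w \<in> null A B"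
proof -
  obtain u1 v1 J where z: "z = v1 \<bullet> u1" "J \<in> I" "u1 \<in> Hom E A J" "v1 \<in> Hom E J B"
    using assms by (auto simp: null_def)
  obtain u2 v2 K where w: "w = v2 \<bullet> u2" "K \<in> I" "u2 \<in> Hom E A K" "v2 \<in> Hom E K B"
    using assms by (auto simp: null_def)
  obtain S j1 j2 q1 q2 where S: "S \<in> I" and b: "is_biproduct E J K S j1 j2 q1 q2"
    using I_sum z w by blast
  have h: "j1 \<in> Hom E J S" "j2 \<in> Hom E K S" "q1 \<in> Hom E S J" "q2 \<in> Hom E S K"
    and q: "q1 \<bullet> j1 = Ident E J" "q2 \<bullet> j2 = Ident E K"
      "q1 \<bullet> j2 = ZeroMor E K J" "q2 \<bullet> j1 = ZeroMor E J K"
    using b by (auto simp: is_biproduct_def)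
  have O: "J \<in> Obj E" "K \<in> Obj E" using h Hom_Obj by blast+
  define u where "u = (j1 \<bullet> u1) \<boxplus> (j2 \<bullet> u2)"
  define v where "v = (v1 \<bullet> q1) \<boxplus> (v2 \<bullet> q2)"
  have ju: "j1 \<bullet> u1 \<in> Hom E A S" "j2 \<bullet> u2 \<in> Hom E A S" using h z w Comp_Hom by blast+
  have vq: "v1 \<bullet> q1 \<in> Hom E S B" "v2 \<bullet> q2 \<in> Hom E S B" using h z w Comp_Hom by blast+
  have u: "u \<in> Hom E A S" unfolding u_def using ju Add_Hom by blast
  have v: "v \<in> Hom E S B" unfolding v_def using vq Add_Hom by blast
  have "q1 \<bullet> u = (q1 \<bullet> (j1 \<bullet> u1)) \<boxplus> (q1 \<bullet> (j2 \<bullet> u2))"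
    unfolding u_def by (rule Comp_Add_right[OF ju h(3)])
  also have "\<dots> = ((q1 \<bullet> j1) \<bullet> u1) \<boxplus> ((q1 \<bullet> j2) \<bullet> u2)"
    using Comp_assoc h z w by metis
  also have "\<dots> = u1" using q O z(3) Comp_Zero(1)[OF w(3)] by (auto simp: Hom_def)
  finally have 1: "q1 \<bullet> u = u1" .
  have "q2 \<bullet> u = (q2 \<bullet> (j1 \<bullet> u1)) \<boxplus> (q2 \<bullet> (j2 \<bullet> u2))"
    unfolding u_def by (rule Comp_Add_right[OF ju h(4)])
  also have "\<dots> = ((q2 \<bullet> j1) \<bullet> u1) \<boxplus> ((q2 \<bullet> j2) \<bullet> u2)"
    using Comp_assoc h z w by metis
  also have "\<dots> = u2" using q O w(3) Comp_Zero(1)[OF z(3)] by (auto simp: Hom_def)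
  finally have 2: "q2 \<bullet> u = u2" .
  have "v \<bullet> u = ((v1 \<bullet> q1) \<bullet> u) \<boxplus> ((v2 \<bullet> q2) \<bullet> u)"
    unfolding v_def by (rule Comp_Add_left[OF u vq])
  also have "\<dots> = z \<boxplus> w"
    using Comp_assoc[OF u h(3) z(4)] Comp_assoc[OF u h(4) w(4)] 1 2 z w by simp
  finally show ?thesis using nullI[OF S u v] by simp
qed

lemma null_negative:
  assumes z: "z \<in> null A B" and c: "c \<in> Hom E A B" "c \<boxplus> z = ZeroMor E A B"
  shows "c \<in> null A B"
proof -
  obtain u v J where uv: "z = v \<bullet> u" "J \<in> I" "u \<in> Hom E A J" "v \<in> Hom E J B"
    using z by (auto simp: null_def)
  have O: "J \<in> Obj E" "B \<in> Obj E" using uv Hom_Obj by blast+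
  obtain v' where v': "v' \<in> Hom E J B" "ZeroMor E J B = v' \<boxplus> v"
    using difference[OF Zero_Hom[OF O] uv(4)] by blast
  have "(v' \<bullet> u) \<boxplus> z = c \<boxplus> z"
    using Comp_Add_left[OF uv(3) v'(1) uv(4)] v'(2) Comp_Zero(1)[OF uv(3) O(2)] c uv(1) by simp
  then have "c = v' \<bullet> u"
    using Add_right_cancel c null_Hom[OF z] Comp_Hom[OF uv(3) v'(1)] by metis
  then show ?thesis using nullI uv v' by blast
qed

definition stably_equal :: "'o \<Rightarrow> 'o \<Rightarrow> 'm \<Rightarrow> 'm \<Rightarrow> bool" where
  "stably_equal A B f g \<longleftrightarrow> f \<in> Hom E A B \<and> g \<in> Hom E A B \<and> (\<exists>z\<in>null A B. f = z \<boxplus> g)"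

lemma stably_equal_refl: "f \<in> Hom E A B \<Longrightarrow> stably_equal A B f f"
  unfolding stably_equal_def
  by (intro conjI bexI[of _ "ZeroMor E A B"] null_Zero) (use Hom_Obj in \<open>auto simp: Hom_def\<close>)

lemma stably_equal_trans:
  assumes "stably_equal A B f g" "stably_equal A B g h"
  shows "stably_equal A B f h"
proof -
  obtain z w where z: "z \<in> null A B" "f = z \<boxplus> g" and w: "w \<in> null A B" "g = w \<boxplus> h"
    and fh: "f \<in> Hom E A B" "h \<in> Hom E A B"
    using assms by (auto simp: stably_equal_def)
  have "f = (z \<boxplus> w) \<boxplus> h"
    using Add_assoc[OF null_Hom[OF z(1)] null_Hom[OF w(1)] fh(2)] z w by simp
  then show ?thesis using null_Add[OF z(1) w(1)] fh unfolding stably_equal_def by blast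
qed

lemma stably_equal_sym:
  assumes "stably_equal A B f g"
  shows "stably_equal A B g f"
proof -
  obtain z where z: "z \<in> null A B" "f = z \<boxplus> g" and fg: "f \<in> Hom E A B" "g \<in> Hom E A B"
    using assms by (auto simp: stably_equal_def)
  have O: "A \<in> Obj E" "B \<in> Obj E" using fg Hom_Obj by blast+
  obtain c where c: "c \<in> Hom E A B" "ZeroMor E A B = c \<boxplus> z"
    using difference[OF Zero_Hom[OF O] null_Hom[OF z(1)]] by blast
  have "g = c \<boxplus> f"
  proof -
    have "c \<boxplus> f = ZeroMor E A B \<boxplus> g" using Add_assoc[OF c(1) null_Hom[OF z(1)] fg(2)] z(2) c(2) by simp
    then show ?thesis using fg by (simp add: Hom_def)
  qed
  then show ?thesis using null_negative[OF z(1) c(1)] c fg by (auto simp: stably_equal_def)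
qed

text \<open>From here on the classes are those of an equivalence relation stated without negatives.\<close>

lemma mem_class_iff:
  assumes f: "f \<in> Hom E A B"
  shows "g \<in> cl f \<longleftrightarrow> stably_equal A B g f"
proof -
  interpret G: comm_group "hom_group E A B" using Hom_group Hom_Obj f by blast
  have d: "Dom E f = A" "Cod E f = B" using f by (auto simp: Hom_def)
  have "g \<boxplus> inv\<^bsub>hom_group E A B\<^esub> f = z \<longleftrightarrow> g = z \<boxplus> f" if "g \<in> Hom E A B" "z \<in> Hom E A B" for z
    using G.inv_solve_right[of z g f] that f by auto
  then have iff: "g \<boxplus> inv\<^bsub>hom_group E A B\<^esub> f = z \<longleftrightarrow> g = z \<boxplus> f" if "g \<in> Hom E A B" "z \<in> null A B" for z
    using that null_Hom by blast
  have "g \<in> cl f \<longleftrightarrow> g \<in> Hom E A B \<and> (\<exists>z\<in>null A B. g \<boxplus> inv\<^bsub>hom_group E A B\<^esub> f = z)"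
    unfolding stable_class_def neg_def d null_def by blast
  also have "\<dots> \<longleftrightarrow> g \<in> Hom E A B \<and> (\<exists>z\<in>null A B. g = z \<boxplus> f)" using iff by blast
  finally show ?thesis using f by (simp add: stably_equal_def)
qed

lemma class_self: "f \<in> Hom E A B \<Longrightarrow> f \<in> cl f"
  by (simp add: mem_class_iff stably_equal_refl)

lemma class_eq_iff:
  assumes f: "f \<in> Hom E A B" and g: "g \<in> Hom E A B"
  shows "cl f = cl g \<longleftrightarrow> stably_equal A B f g"
proof
  assume "cl f = cl g"
  then show "stably_equal A B f g" using class_self[OF f] mem_class_iff[OF g] by simp
next
  assume fg: "stably_equal A B f g"
  show "cl f = cl g"
  proof (rule Set.set_eqI)
    fix x
    show "x \<in> cl f \<longleftrightarrow> x \<in> cl g"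
      unfolding mem_class_iff[OF f] mem_class_iff[OF g]
      using fg stably_equal_sym[OF fg] stably_equal_trans[of A B x] by blast
  qed
qed

lemma class_Hom: "f \<in> Hom E A B \<Longrightarrow> g \<in> cl f \<Longrightarrow> g \<in> Hom E A B"
  by (simp add: mem_class_iff stably_equal_def)

lemma class_eqI: "f \<in> Hom E A B \<Longrightarrow> g \<in> cl f \<Longrightarrow> cl g = cl f"
  by (simp add: mem_class_iff class_eq_iff[OF class_Hom])

lemma class_Comp_cong:
  assumes "stably_equal A B f' f" "stably_equal B D g' g"
  shows "stably_equal A D (g' \<bullet> f') (g \<bullet> f)"
proof -
  obtain z where z: "z \<in> null A B" "f' = z \<boxplus> f" and f: "f' \<in> Hom E A B" "f \<in> Hom E A B"
    using assms by (auto simp: stably_equal_def)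
  obtain w where w: "w \<in> null B D" "g' = w \<boxplus> g" and g: "g' \<in> Hom E B D" "g \<in> Hom E B D"
    using assms by (auto simp: stably_equal_def)
  have "stably_equal A D (g' \<bullet> f') (g' \<bullet> f)"
    unfolding z(2) Comp_Add_right[OF null_Hom[OF z(1)] f(2) g(1)]
    using null_Comp(1)[OF z(1) g(1)] Comp_Hom[OF f(2) g(1)]
      Add_Hom[OF null_Hom[OF null_Comp(1)[OF z(1) g(1)]] Comp_Hom[OF f(2) g(1)]]
    by (auto simp: stably_equal_def)
  moreover have "stably_equal A D (g' \<bullet> f) (g \<bullet> f)"
    unfolding w(2) Comp_Add_left[OF f(2) null_Hom[OF w(1)] g(2)]
    using null_Comp(2)[OF w(1) f(2)] Comp_Hom[OF f(2) g(2)]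
      Add_Hom[OF null_Hom[OF null_Comp(2)[OF w(1) f(2)]] Comp_Hom[OF f(2) g(2)]]
    by (auto simp: stably_equal_def)
  ultimately show ?thesis by (rule stably_equal_trans)
qed

lemma class_Add_cong:
  assumes "stably_equal A B f' f" "stably_equal A B g' g"
  shows "stably_equal A B (f' \<boxplus> g') (f \<boxplus> g)"
proof -
  have left: "stably_equal A B (a' \<boxplus> b) (a \<boxplus> b)" if a: "stably_equal A B a' a" and b: "b \<in> Hom E A B" for a a' b
  proof -
    obtain z where z: "z \<in> null A B" "a' = z \<boxplus> a" and ah: "a' \<in> Hom E A B" "a \<in> Hom E A B"
      using a by (auto simp: stably_equal_def)
    then show ?thesis
      using Add_assoc[OF null_Hom[OF z(1)] ah(2) b] Add_Hom b unfolding stably_equal_def by metis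
  qed
  have h: "f' \<in> Hom E A B" "f \<in> Hom E A B" "g' \<in> Hom E A B" "g \<in> Hom E A B"
    using assms by (auto simp: stably_equal_def)
  have "stably_equal A B (f' \<boxplus> g') (f \<boxplus> g')" using left[OF assms(1)] h by blast
  moreover have "stably_equal A B (f \<boxplus> g') (f \<boxplus> g)"
    using left[OF assms(2) h(2)] h Add_commute by metis
  ultimately show ?thesis by (rule stably_equal_trans)
qed

lemma St_simps [simp]:
  "Obj St = Obj E" "Ident St A = cl (Ident E A)" "ZeroMor St A B = cl (ZeroMor E A B)"
  by (simp_all add: stable_category_def)

lemma St_Dom_Cod:
  assumes "f \<in> Hom E A B"
  shows "Dom St (cl f) = A" "Cod St (cl f) = B"
proof -
  have "Dom E ` cl f = {A}" "Cod E ` cl f = {B}"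
    using class_Hom[OF assms] class_self[OF assms] by (auto simp: Hom_def image_iff)
  then show "Dom St (cl f) = A" "Cod St (cl f) = B" by (simp_all add: stable_category_def)
qed

lemma St_Hom: "Hom St A B = cl ` Hom E A B"
proof
  show "Hom St A B \<subseteq> cl ` Hom E A B"
  proof
    fix F assume "F \<in> Hom St A B"
    then obtain f where f: "f \<in> Arr E" "F = cl f" "Dom St F = A" "Cod St F = B"
      by (auto simp: Hom_def) (auto simp: stable_category_def)
    have "f \<in> Hom E (Dom E f) (Cod E f)" using f by (simp add: Hom_def)
    then show "F \<in> cl ` Hom E A B"
      using f St_Dom_Cod[of f "Dom E f" "Cod E f"] by simp
  qed
  show "cl ` Hom E A B \<subseteq> Hom St A B"
  proof clarify
    fix f assume f: "f \<in> Hom E A B"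
    then have "cl f \<in> Arr St" by (simp add: stable_category_def Hom_def)
    then show "cl f \<in> Hom St A B" using St_Dom_Cod[OF f] by (simp add: Hom_def)
  qed
qed

lemma class_in_Hom: "f \<in> Hom E A B \<Longrightarrow> cl f \<in> Hom St A B"
  by (simp add: St_Hom)

lemma St_Comp:
  assumes f: "f \<in> Hom E A B" and g: "g \<in> Hom E B D"
  shows "cl g \<bullet>\<^bsub>St\<^esub> cl f = cl (g \<bullet> f)"
proof -
  have c: "cl (g' \<bullet> f') = cl (g \<bullet> f)" if "g' \<in> cl g" "f' \<in> cl f" for g' f'
  proof -
    have "stably_equal A D (g' \<bullet> f') (g \<bullet> f)"
      using that by (intro class_Comp_cong[of A B f' f D g' g] mem_class_iff[OF f, THEN iffD1] mem_class_iff[OF g, THEN iffD1])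
    then show ?thesis using class_eq_iff[of "g' \<bullet> f'" A D "g \<bullet> f"] by (simp add: stably_equal_def)
  qed
  have "(\<Union>g'\<in>cl g. \<Union>f'\<in>cl f. cl (g' \<bullet> f')) = (\<Union>g'\<in>cl g. \<Union>f'\<in>cl f. cl (g \<bullet> f))"
    by (rule SUP_cong[OF refl], rule SUP_cong[OF refl], rule c)
  then show ?thesis using class_self[OF f] class_self[OF g] by (auto simp: stable_category_def)
qed

lemma St_Add:
  assumes f: "f \<in> Hom E A B" and g: "g \<in> Hom E A B"
  shows "cl f \<boxplus>\<^bsub>St\<^esub> cl g = cl (f \<boxplus> g)"
proof -
  have c: "cl (f' \<boxplus> g') = cl (f \<boxplus> g)" if "g' \<in> cl g" "f' \<in> cl f" for g' f'
  proof -
    have "stably_equal A B (f' \<boxplus> g') (f \<boxplus> g)"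
      using that by (intro class_Add_cong mem_class_iff[OF f, THEN iffD1] mem_class_iff[OF g, THEN iffD1])
    then show ?thesis using class_eq_iff[of "f' \<boxplus> g'" A B "f \<boxplus> g"] by (simp add: stably_equal_def)
  qed
  have "(\<Union>f'\<in>cl f. \<Union>g'\<in>cl g. cl (f' \<boxplus> g')) = (\<Union>f'\<in>cl f. \<Union>g'\<in>cl g. cl (f \<boxplus> g))"
    by (rule SUP_cong[OF refl], rule SUP_cong[OF refl], rule c)
  then show ?thesis using class_self[OF f] class_self[OF g] by (auto simp: stable_category_def)
qed

lemma class_hom: "cl \<in> hom (hom_group E A B) (hom_group St A B)"
  using St_Add by (auto simp: hom_def St_Hom)

text \<open>All axioms are inherited along the projection \<open>cl\<close>, which is surjective on morphisms and
compatible with composition and addition.\<close>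

lemma St_preadditive: "preadditive St"
proof -
  have Obj: "Dom St F \<in> Obj E \<and> Cod St F \<in> Obj E" if "F \<in> Arr St" for F
  proof -
    obtain f where "f \<in> Arr E" "F = cl f" using \<open>F \<in> Arr St\<close> by (auto simp: stable_category_def)
    then have "f \<in> Hom E (Dom E f) (Cod E f)" "F = cl f" by (simp_all add: Hom_def)
    then show ?thesis using St_Dom_Cod Hom_Obj by metis
  qed
  have cg: "comm_group (hom_group St A B)" if O: "A \<in> Obj E" "B \<in> Obj E" for A B
  proof -
    interpret G: comm_group "hom_group E A B" using Hom_group O by blast
    have "comm_group (hom_group St A B \<lparr>carrier := cl ` carrier (hom_group E A B),
        one := cl (one (hom_group E A B))\<rparr>)"
      by (rule G.hom_imp_img_comm_group[OF class_hom])
    then show ?thesis by (simp add: hom_group_def St_Hom)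
  qed
  have cat: "category St"
  proof unfold_locales
    fix F assume "F \<in> Arr St"
    then show "Dom St F \<in> Obj St" "Cod St F \<in> Obj St" using Obj by simp_all
  next
    fix A assume "A \<in> Obj St"
    then show "Ident St A \<in> Hom St A A" by (simp add: class_in_Hom Ident_Hom)
  next
    fix F A B assume "F \<in> Hom St A B"
    then obtain f where f: "f \<in> Hom E A B" "F = cl f" by (auto simp: St_Hom)
    then show "F \<bullet>\<^bsub>St\<^esub> Ident St A = F" "Ident St B \<bullet>\<^bsub>St\<^esub> F = F"
      using St_Comp[OF Ident_Hom f(1)] St_Comp[OF f(1) Ident_Hom] Hom_Obj[OF f(1)]
        Ident_left[OF f(1)] Ident_right[OF f(1)] by simp_all
    fix G D assume "G \<in> Hom St B D"
    then obtain g where g: "g \<in> Hom E B D" "G = cl g" by (auto simp: St_Hom)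
    then show "G \<bullet>\<^bsub>St\<^esub> F \<in> Hom St A D"
      using St_Comp[OF f(1) g(1)] f class_in_Hom[OF Comp_Hom[OF f(1) g(1)]] by simp
    fix H L assume "H \<in> Hom St D L"
    then obtain h where h: "h \<in> Hom E D L" "H = cl h" by (auto simp: St_Hom)
    then show "(H \<bullet>\<^bsub>St\<^esub> G) \<bullet>\<^bsub>St\<^esub> F = H \<bullet>\<^bsub>St\<^esub> (G \<bullet>\<^bsub>St\<^esub> F)"
      using f g St_Comp[OF f(1) g(1)] St_Comp[OF g(1) h(1)] St_Comp[OF f(1) Comp_Hom[OF g(1) h(1)]]
        St_Comp[OF Comp_Hom[OF f(1) g(1)] h(1)] Comp_assoc[OF f(1) g(1) h(1)] by simp
  qed
  have left: "(G \<boxplus>\<^bsub>St\<^esub> H) \<bullet>\<^bsub>St\<^esub> F = (G \<bullet>\<^bsub>St\<^esub> F) \<boxplus>\<^bsub>St\<^esub> (H \<bullet>\<^bsub>St\<^esub> F)"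
    if FGH: "F \<in> Hom St A B" "G \<in> Hom St B D" "H \<in> Hom St B D" for F A B G D H
  proof -
    obtain f g h where *: "f \<in> Hom E A B" "F = cl f" "g \<in> Hom E B D" "G = cl g" "h \<in> Hom E B D" "H = cl h"
      using FGH by (auto simp: St_Hom)
    show ?thesis
      using * St_Add[OF *(3,5)] St_Comp[OF *(1) Add_Hom[OF *(3,5)]] St_Comp[OF *(1,3)] St_Comp[OF *(1,5)]
        St_Add[OF Comp_Hom[OF *(1,3)] Comp_Hom[OF *(1,5)]] Comp_Add_left[OF *(1,3,5)] by simp
  qed
  have right: "H \<bullet>\<^bsub>St\<^esub> (F \<boxplus>\<^bsub>St\<^esub> G) = (H \<bullet>\<^bsub>St\<^esub> F) \<boxplus>\<^bsub>St\<^esub> (H \<bullet>\<^bsub>St\<^esub> G)"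
    if FGH: "F \<in> Hom St A B" "G \<in> Hom St A B" "H \<in> Hom St B D" for F A B G D H
  proof -
    obtain f g h where *: "f \<in> Hom E A B" "F = cl f" "g \<in> Hom E A B" "G = cl g" "h \<in> Hom E B D" "H = cl h"
      using FGH by (auto simp: St_Hom)
    show ?thesis
      using * St_Add[OF *(1,3)] St_Comp[OF Add_Hom[OF *(1,3)] *(5)] St_Comp[OF *(1,5)] St_Comp[OF *(3,5)]
        St_Add[OF Comp_Hom[OF *(1,5)] Comp_Hom[OF *(3,5)]] Comp_Add_right[OF *(1,3,5)] by simp
  qed
  show ?thesis
    by (intro preadditive.intro preadditive_axioms.intro cat left right cg) simp_all
qed

lemma class_int_id:
  assumes "A \<in> Obj E"
  shows "cl (int_id E d A) = int_id St d A"
proof -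
  interpret St: preadditive St by (rule St_preadditive)
  interpret G: comm_group "hom_group E A A" using Hom_group assms by blast
  interpret H: comm_group "hom_group St A A" using St.Hom_group assms by simp
  show ?thesis
    using hom_int_pow[OF class_hom, of "Ident E A" A A d] Ident_Hom[OF assms] G.is_group H.is_group
    by (simp add: int_id_def)
qed

end

section \<open>Frobenius categories\<close>

lemma obj_at_cong:
  assumes "\<And>i. 1 \<le> i \<Longrightarrow> i \<le> k \<Longrightarrow> \<alpha> i = \<beta> i" "1 \<le> k" "1 \<le> i" "i \<le> Suc k"
  shows "obj_at C \<alpha> i = obj_at C \<beta> i"
  using assms(1)[of 1] assms(1)[of "i - 1"] assms(2-) by (auto simp: obj_at_def)

lemma right_exact_cong:
  assumes eq: "\<And>i. 1 \<le> i \<Longrightarrow> i \<le> k \<Longrightarrow> \<alpha> i = \<beta> i" and k: "1 \<le> k" and ex: "right_exact C k \<alpha>"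
  shows "right_exact C k \<beta>"
proof -
  have o: "obj_at C \<beta> i = obj_at C \<alpha> i" if "1 \<le> i" "i \<le> Suc k" for i
    by (rule obj_at_cong[OF eq k that, symmetric])
  have path: "is_path C k \<beta>"
    using is_pathD[OF is_complexD(1)[OF right_exact_complex[OF ex]]] eq o by (auto simp: is_path_def)
  have "is_complex C k \<beta>"
    unfolding is_complex_def
  proof (intro conjI ballI path)
    fix i assume i: "i \<in> {1..<k}"
    then show "\<beta> (i + 1) \<bullet>\<^bsub>C\<^esub> \<beta> i = ZeroMor C (obj_at C \<beta> i) (obj_at C \<beta> (i + 2))"
      using is_complexD(2)[OF right_exact_complex[OF ex], of i] eq[of i] eq[of "Suc i"]
        o[of i] o[of "Suc (Suc i)"] by auto
  qed
  moreover have "h = ZeroMor C (obj_at C \<beta> (k + 1)) A"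
    if "A \<in> Obj C" "h \<in> Hom C (obj_at C \<beta> (k + 1)) A" "h \<bullet>\<^bsub>C\<^esub> \<beta> k = ZeroMor C (obj_at C \<beta> k) A" for A h
    using right_exactD(1)[OF ex that(1), of h] that eq[of k] o[of k] o[of "Suc k"] k by auto
  moreover have "\<exists>h'\<in>Hom C (obj_at C \<beta> (i + 1)) A. h = h' \<bullet>\<^bsub>C\<^esub> \<beta> i"
    if "A \<in> Obj C" "i \<in> {2..k}" "h \<in> Hom C (obj_at C \<beta> i) A"
      "h \<bullet>\<^bsub>C\<^esub> \<beta> (i - 1) = ZeroMor C (obj_at C \<beta> (i - 1)) A" for A i h
  proof -
    have i: "1 \<le> i" "i \<le> k" "1 \<le> i - 1" "i - 1 \<le> k" "2 \<le> i" using that(2) by auto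
    then show ?thesis
      using right_exactD(2)[OF ex that(1), of i h] that(3,4) eq[of i] eq[of "i - 1"]
        o[of i] o[of "Suc i"] o[of "i - 1"] by simp
  qed
  ultimately show ?thesis by (simp add: right_exact_def)
qed

context exact_category
begin

lemma admissible_right_exact: "\<alpha> \<in> X \<Longrightarrow> right_exact E (n - 1) \<alpha>"
  and admissible_left_exact: "\<alpha> \<in> X \<Longrightarrow> left_exact E (n - 1) \<alpha>"
  using X_exact by (auto simp: is_exact_seq_def)

lemma admissible_complex: "\<alpha> \<in> X \<Longrightarrow> is_complex E (n - 1) \<alpha>"
  using admissible_right_exact right_exact_complex by blast

lemma admissible_path: "\<alpha> \<in> X \<Longrightarrow> is_path E (n - 1) \<alpha>"
  using admissible_complex is_complexD(1) by blast

lemma one_le: "1 \<le> n - 1" "Suc (n - 1) = n"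
  using n_ge_3 by auto

lemma admissible_Hom: "\<alpha> \<in> X \<Longrightarrow> 1 \<le> i \<Longrightarrow> i < n \<Longrightarrow> \<alpha> i \<in> Hom E (obj_at E \<alpha> i) (obj_at E \<alpha> (Suc i))"
  using is_pathD[OF admissible_path] by auto

lemma admissible_Obj: "\<alpha> \<in> X \<Longrightarrow> 1 \<le> i \<Longrightarrow> i \<le> n \<Longrightarrow> obj_at E \<alpha> i \<in> Obj E"
  using admissible_Hom[of \<alpha> i] admissible_Hom[of \<alpha> "i - 1"] Hom_Obj one_le
  by (cases "i = n") auto

lemma is_path_mor_Ident:
  assumes "\<alpha> \<in> X"
  shows "is_path_mor E (n - 1) \<alpha> \<alpha> (\<lambda>i. Ident E (obj_at E \<alpha> i))"
  unfolding is_path_mor_def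
proof (intro conjI ballI)
  fix i assume "i \<in> {1..n - 1 + 1}"
  then show "Ident E (obj_at E \<alpha> i) \<in> Hom E (obj_at E \<alpha> i) (obj_at E \<alpha> i)"
    using Ident_Hom[OF admissible_Obj[OF assms]] one_le by auto
next
  fix i assume "i \<in> {1..n - 1}"
  then have "\<alpha> i \<in> Hom E (obj_at E \<alpha> i) (obj_at E \<alpha> (i + 1))"
    using admissible_Hom[OF assms, of i] by auto
  then show "Ident E (obj_at E \<alpha> (i + 1)) \<bullet> \<alpha> i = \<alpha> i \<bullet> Ident E (obj_at E \<alpha> i)"
    using Ident_left Ident_right by metis
qed

text \<open>A class closed under weak isomorphisms is insensitive to the irrelevant values of its sequences,
because sequences with the same morphisms are linked by identities.\<close>

lemma admissible_cong:
  assumes \<alpha>: "\<alpha> \<in> X" and eq: "\<And>i. 1 \<le> i \<Longrightarrow> i \<le> n - 1 \<Longrightarrow> \<alpha> i = \<beta> i"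
  shows "\<beta> \<in> X"
proof -
  have o: "obj_at E \<alpha> i = obj_at E \<beta> i" if "1 \<le> i" "i \<le> n" for i
    by (rule obj_at_cong[OF eq one_le(1)]) (use that in auto)
  have "right_exact E (n - 1) \<beta>"
    by (rule right_exact_cong[OF eq one_le(1) admissible_right_exact[OF \<alpha>]])
  moreover have "left_exact E (n - 1) \<beta>"
    unfolding left_exact_def
    by (rule right_exact_cong[OF _ one_le(1) admissible_left_exact[OF \<alpha>, unfolded left_exact_def]])
      (auto simp: rev_seq_def intro!: eq)
  ultimately have "is_exact_seq E n \<beta>" by (simp add: is_exact_seq_def)
  moreover have "is_path_mor E (n - 1) \<alpha> \<beta> (\<lambda>i. Ident E (obj_at E \<alpha> i))"
    using is_path_mor_Ident[OF \<alpha>] o eq one_le by (auto simp: is_path_mor_def)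
  moreover have "is_iso E (Ident E (obj_at E \<alpha> i))" if "1 \<le> i" "i \<le> n" for i
    unfolding is_iso_def using admissible_Obj[OF \<alpha> that] Ident_Hom
    by (auto intro!: bexI[of _ "Ident E (obj_at E \<alpha> i)"])
  ultimately have "is_weak_iso E n \<alpha> \<beta> (\<lambda>i. Ident E (obj_at E \<alpha> i))"
    unfolding is_weak_iso_def using X_exact[OF \<alpha>] n_ge_3 by (auto intro!: bexI[of _ 1])
  then show ?thesis using X_weak_iso \<alpha> by blast
qed

lemma extend_along_admissible:
  assumes "\<alpha> \<in> X" "I \<in> injectives E X" "u \<in> Hom E (obj_at E \<alpha> 1) I"
  obtains u' where "u' \<in> Hom E (obj_at E \<alpha> 2) I" "u' \<bullet> \<alpha> 1 = u"
proof -
  have "\<alpha> 1 \<in> adm_monos X" using assms by (auto simp: adm_monos_def)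
  moreover have "Dom E (\<alpha> 1) = obj_at E \<alpha> 1" "Cod E (\<alpha> 1) = obj_at E \<alpha> 2"
    by (simp_all add: obj_at_def)
  ultimately have "\<exists>u'\<in>Hom E (obj_at E \<alpha> 2) I. u' \<bullet> \<alpha> 1 = u"
    using assms(2,3) unfolding injectives_def by force
  then show thesis using that by blast
qed

lemma injectives_zero_object:
  assumes "is_zero_object E Z"
  shows "Z \<in> injectives E X"
proof -
  have "\<exists>h'\<in>Hom E (Cod E m) Z. h' \<bullet> m = h" if m: "m \<in> adm_monos X" and h: "h \<in> Hom E (Dom E m) Z" for m h
  proof -
    obtain \<alpha> where "\<alpha> \<in> X" "m = \<alpha> 1" using m by (auto simp: adm_monos_def)
    then have mA: "m \<in> Arr E" using admissible_Hom[of \<alpha> 1] one_le by (auto simp: Hom_def)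
    obtain h' where h': "h' \<in> Hom E (Cod E m) Z"
      using assms Cod_Obj[OF mA] unfolding is_zero_object_def by blast
    have "h' \<bullet> m \<in> Hom E (Dom E m) Z" using mA h' by (simp add: Hom_def)
    then show ?thesis using assms h h' Dom_Obj[OF mA] unfolding is_zero_object_def by blast
  qed
  then show ?thesis using assms by (auto simp: injectives_def is_zero_object_def)
qed

lemma injectives_biproduct:
  assumes J: "J \<in> injectives E X" and K: "K \<in> injectives E X" and b: "is_biproduct E J K S j1 j2 q1 q2"
  shows "S \<in> injectives E X"
proof -
  have h: "j1 \<in> Hom E J S" "j2 \<in> Hom E K S" "q1 \<in> Hom E S J" "q2 \<in> Hom E S K"
    and id: "(j1 \<bullet> q1) \<boxplus> (j2 \<bullet> q2) = Ident E S"
    using b by (auto simp: is_biproduct_def)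
  have "\<exists>h'\<in>Hom E (Cod E m) S. h' \<bullet> m = x" if m: "m \<in> adm_monos X" and x: "x \<in> Hom E (Dom E m) S" for m x
  proof -
    obtain \<alpha> where "\<alpha> \<in> X" "m = \<alpha> 1" using m by (auto simp: adm_monos_def)
    then have mA: "m \<in> Hom E (Dom E m) (Cod E m)" using admissible_Hom[of \<alpha> 1] one_le by (auto simp: Hom_def)
    obtain a where a: "a \<in> Hom E (Cod E m) J" "a \<bullet> m = q1 \<bullet> x"
      using J m Comp_Hom[OF x h(3)] unfolding injectives_def by blast
    obtain c where c: "c \<in> Hom E (Cod E m) K" "c \<bullet> m = q2 \<bullet> x"
      using K m Comp_Hom[OF x h(4)] unfolding injectives_def by blast
    have "((j1 \<bullet> a) \<boxplus> (j2 \<bullet> c)) \<bullet> m = ((j1 \<bullet> a) \<bullet> m) \<boxplus> ((j2 \<bullet> c) \<bullet> m)"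
      by (rule Comp_Add_left[OF mA Comp_Hom[OF a(1) h(1)] Comp_Hom[OF c(1) h(2)]])
    also have "\<dots> = ((j1 \<bullet> q1) \<bullet> x) \<boxplus> ((j2 \<bullet> q2) \<bullet> x)"
      using Comp_assoc[OF mA a(1) h(1)] Comp_assoc[OF mA c(1) h(2)] a(2) c(2)
        Comp_assoc[OF x h(3,1)] Comp_assoc[OF x h(4,2)] by simp
    also have "\<dots> = x"
      using Comp_Add_left[OF x Comp_Hom[OF h(3,1)] Comp_Hom[OF h(4,2)]] id Ident_left[OF x] by simp
    finally show ?thesis
      using Add_Hom[OF Comp_Hom[OF a(1) h(1)] Comp_Hom[OF c(1) h(2)]] by blast
  qed
  moreover have "S \<in> Obj E" using h Hom_Obj by blast
  ultimately show ?thesis by (auto simp: injectives_def)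
qed

sublocale stabilization E "injectives E X"
proof
  show "injectives E X \<subseteq> Obj E" by (auto simp: injectives_def)
  show "injectives E X \<noteq> {}" using zero_object injectives_zero_object by blast
  fix J K assume JK: "J \<in> injectives E X" "K \<in> injectives E X"
  then have "J \<in> Obj E" "K \<in> Obj E" by (auto simp: injectives_def)
  then show "\<exists>S\<in>injectives E X. \<exists>j1 j2 q1 q2. is_biproduct E J K S j1 j2 q1 q2"
    using biproducts injectives_biproduct[OF JK] by blast
qed

lemma class_null:
  assumes "z \<in> null A B"
  shows "cl z = ZeroMor St A B"
proof -
  have z: "z \<in> Hom E A B" by (rule null_Hom[OF assms])
  then have O: "A \<in> Obj E" "B \<in> Obj E" using Hom_Obj by blast+
  have "stably_equal A B z (ZeroMor E A B)"
    unfolding stably_equal_def using assms z O Zero_Hom by (auto simp: Hom_def intro!: bexI[of _ z])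
  then show ?thesis using class_eq_iff z O Zero_Hom by simp
qed

lemma null_if_class_Zero:
  assumes "z \<in> Hom E A B" "cl z = ZeroMor St A B"
  shows "z \<in> null A B"
proof -
  have O: "A \<in> Obj E" "B \<in> Obj E" using assms Hom_Obj by blast+
  then have "stably_equal A B z (ZeroMor E A B)" using assms class_eq_iff Zero_Hom by simp
  then obtain w where "w \<in> null A B" "z = w \<boxplus> ZeroMor E A B"
    by (auto simp: stably_equal_def)
  moreover from this have "z = w" using null_Hom[of w A B] by (simp add: Hom_def)
  ultimately show ?thesis by simp
qed

lemma extend_to_admissible_path_mor:
  assumes \<alpha>: "\<alpha> \<in> X" and \<beta>: "\<beta> \<in> X" and inj: "obj_at E \<beta> 2 \<in> injectives E X"
    and g: "g \<in> Hom E (obj_at E \<alpha> 1) (obj_at E \<beta> 1)"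
  obtains \<psi> where "is_path_mor E (n - 1) \<alpha> \<beta> \<psi>" "\<psi> 1 = g"
proof -
  have "\<beta> 1 \<in> Hom E (obj_at E \<beta> 1) (obj_at E \<beta> 2)"
    using admissible_Hom[OF \<beta>, of 1] n_ge_3 by (simp add: numeral_2_eq_2)
  then obtain x where "x \<in> Hom E (obj_at E \<alpha> 2) (obj_at E \<beta> 2)" "x \<bullet> \<alpha> 1 = \<beta> 1 \<bullet> g"
    using extend_along_admissible[OF \<alpha> inj] Comp_Hom[OF g] by blast
  then show thesis
    using extend_to_path_mor[OF admissible_right_exact[OF \<alpha>] admissible_complex[OF \<beta>] one_le(1) g] that
    by blast
qed

text \<open>If \<open>\<mu>\<^sub>1 - \<nu>\<^sub>1 = v u\<close> with \<open>u\<close> ending in an injective \<open>J\<close>, then \<open>u\<close> extends along the admissible monomorphism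
\<open>\<alpha>\<^sub>1\<close> to some \<open>u'\<close>, and \<open>v u'\<close> is a first component of a homotopy which itself factors through \<open>J\<close>.\<close>

lemma stable_homotopy:
  assumes \<alpha>: "\<alpha> \<in> X" and \<beta>: "\<beta> \<in> X"
    and \<mu>: "is_path_mor E (n - 1) \<alpha> \<beta> \<mu>" and \<nu>: "is_path_mor E (n - 1) \<alpha> \<beta> \<nu>"
    and eq: "stably_equal (obj_at E \<alpha> 1) (obj_at E \<beta> 1) (\<mu> 1) (\<nu> 1)"
  shows "\<exists>h. h 1 \<in> null (obj_at E \<alpha> 2) (obj_at E \<beta> 1) \<and>
    (\<forall>i\<in>{1..n - 1}. h i \<in> Hom E (obj_at E \<alpha> (Suc i)) (obj_at E \<beta> i)) \<and>
    (\<forall>i\<in>{2..n - 1}. \<mu> i = (\<nu> i \<boxplus> (\<beta> (i - 1) \<bullet> h (i - 1))) \<boxplus> (h i \<bullet> \<alpha> i)) \<and>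
    \<mu> n = \<nu> n \<boxplus> (\<beta> (n - 1) \<bullet> h (n - 1))"
proof -
  obtain u v J where J: "J \<in> injectives E X" and u: "u \<in> Hom E (obj_at E \<alpha> 1) J"
    and v: "v \<in> Hom E J (obj_at E \<beta> 1)" and m: "\<mu> 1 = (v \<bullet> u) \<boxplus> \<nu> 1"
    and \<nu>1: "\<nu> 1 \<in> Hom E (obj_at E \<alpha> 1) (obj_at E \<beta> 1)"
    using eq by (auto simp: stably_equal_def null_def)
  obtain u' where u': "u' \<in> Hom E (obj_at E \<alpha> 2) J" "u' \<bullet> \<alpha> 1 = u"
    using extend_along_admissible[OF \<alpha> J u] .
  have \<alpha>1: "\<alpha> 1 \<in> Hom E (obj_at E \<alpha> 1) (obj_at E \<alpha> 2)"
    using admissible_Hom[OF \<alpha>, of 1] n_ge_3 by (simp add: numeral_2_eq_2)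
  have t: "v \<bullet> u' \<in> null (obj_at E \<alpha> 2) (obj_at E \<beta> 1)" by (rule nullI[OF J u'(1) v])
  have "\<mu> 1 = \<nu> 1 \<boxplus> ((v \<bullet> u') \<bullet> \<alpha> 1)"
    using m Add_commute[OF Comp_Hom[OF u v] \<nu>1] Comp_assoc[OF \<alpha>1 u'(1) v] u'(2) by simp
  from homotopy_right_exact[OF admissible_right_exact[OF \<alpha>] admissible_complex[OF \<beta>] one_le(1)
      \<mu> \<nu> null_Hom[OF t] this]
  show ?thesis using t one_le(2) by metis
qed

end

context frobenius_category
begin

text \<open>Injectives are projective, and \<open>\<beta>\<^sub>n\<^sub>-\<^sub>1\<close> is an admissible epimorphism.\<close>

lemma lift_along_admissible:
  assumes \<beta>: "\<beta> \<in> X" and J: "J \<in> injectives E X" and v: "v \<in> Hom E J (obj_at E \<beta> n)"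
  obtains w where "w \<in> Hom E J (obj_at E \<beta> (n - 1))" "\<beta> (n - 1) \<bullet> w = v"
proof -
  \<comment> \<open>The admissible epimorphism is the first map of the reversed sequence, whose reversal agrees with
\<open>\<beta>\<close> only on \<open>1, \<dots>, n - 1\<close>.\<close>
  have "rev_seq (n - 1) (rev_seq (n - 1) \<beta>) \<in> X"
    by (rule admissible_cong[OF \<beta>]) (simp add: rev_seq_rev_seq)
  then have "rev_seq (n - 1) \<beta> \<in> op_class n X" by (simp add: op_class_def)
  moreover have "\<beta> (n - 1) = rev_seq (n - 1) \<beta> 1" by (simp add: rev_seq_def)
  ultimately have m: "\<beta> (n - 1) \<in> adm_monos (op_class n X)"
    unfolding adm_monos_def by blast
  have \<beta>n: "Cod E (\<beta> (n - 1)) = obj_at E \<beta> n" "Dom E (\<beta> (n - 1)) = obj_at E \<beta> (n - 1)"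
    using admissible_Hom[OF \<beta>, of "n - 1"] n_ge_3 one_le by (auto simp: Hom_def)
  have "J \<in> projectives E n X" using J projectives_eq_injectives by simp
  then have "\<forall>m\<in>adm_monos (op_class n X). \<forall>h\<in>Hom E J (Cod E m). \<exists>h'\<in>Hom E J (Dom E m). m \<bullet> h' = h"
    unfolding projectives_def injectives_def by simp
  then have "\<exists>w\<in>Hom E J (Dom E (\<beta> (n - 1))). \<beta> (n - 1) \<bullet> w = v"
    using m v \<beta>n(1) by metis
  then show thesis using that \<beta>n(2) by auto
qed

text \<open>If the last component of a morphism of admissible sequences is stably zero, it factors through a
projective and hence through \<open>\<beta>\<^sub>n\<^sub>-\<^sub>1\<close>.  This factorization is the right end of a homotopy
to the zero morphism, which left exactness of \<open>\<beta>\<close> continues to the left end.\<close>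

lemma first_component_factors:
  assumes \<alpha>: "\<alpha> \<in> X" and \<beta>: "\<beta> \<in> X" and \<psi>: "is_path_mor E (n - 1) \<alpha> \<beta> \<psi>"
    and z: "\<psi> n \<in> null (obj_at E \<alpha> n) (obj_at E \<beta> n)"
  shows "\<exists>t\<in>Hom E (obj_at E \<alpha> 2) (obj_at E \<beta> 1). \<psi> 1 = t \<bullet> \<alpha> 1"
proof -
  obtain u v J where J: "J \<in> injectives E X" and u: "u \<in> Hom E (obj_at E \<alpha> n) J"
    and v: "v \<in> Hom E J (obj_at E \<beta> n)" and m: "\<psi> n = v \<bullet> u"
    using z by (auto simp: null_def)
  obtain w where w: "w \<in> Hom E J (obj_at E \<beta> (n - 1))" "\<beta> (n - 1) \<bullet> w = v"
    using lift_along_admissible[OF \<beta> J v] .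
  have \<beta>n: "\<beta> (n - 1) \<in> Hom E (obj_at E \<beta> (n - 1)) (obj_at E \<beta> n)"
    using admissible_Hom[OF \<beta>, of "n - 1"] n_ge_3 one_le by auto
  have s: "w \<bullet> u \<in> Hom E (obj_at E \<alpha> n) (obj_at E \<beta> (n - 1))" by (rule Comp_Hom[OF u w(1)])
  have eq: "\<psi> n = \<beta> (n - 1) \<bullet> (w \<bullet> u)" using m w(2) Comp_assoc[OF u w(1) \<beta>n] by simp
  let ?z = "\<lambda>i. ZeroMor E (obj_at E \<alpha> i) (obj_at E \<beta> i)"
  have "\<exists>t\<in>Hom E (obj_at E \<alpha> 2) (obj_at E \<beta> 1). \<psi> 1 = ?z 1 \<boxplus> (t \<bullet> \<alpha> 1)"
  proof (rule homotopy_left_exact[OF admissible_complex[OF \<alpha>] admissible_complex[OF \<beta>]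
        admissible_left_exact[OF \<beta>] one_le(1) \<psi>
        is_path_mor_Zero[OF admissible_path[OF \<alpha>] admissible_path[OF \<beta>] one_le(1)]])
    show "w \<bullet> u \<in> Hom E (obj_at E \<alpha> (Suc (n - 1))) (obj_at E \<beta> (n - 1))" using s one_le by simp
    show "\<psi> (Suc (n - 1)) = ?z (Suc (n - 1)) \<boxplus> (\<beta> (n - 1) \<bullet> (w \<bullet> u))"
      using eq Comp_Hom[OF s \<beta>n] one_le by (auto simp: Hom_def)
  qed
  then obtain t where t: "t \<in> Hom E (obj_at E \<alpha> 2) (obj_at E \<beta> 1)" "\<psi> 1 = ?z 1 \<boxplus> (t \<bullet> \<alpha> 1)" ..
  moreover have "t \<bullet> \<alpha> 1 \<in> Hom E (obj_at E \<alpha> 1) (obj_at E \<beta> 1)"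
    using Comp_Hom[OF _ t(1)] admissible_Hom[OF \<alpha>, of 1] n_ge_3 by (simp add: numeral_2_eq_2)
  ultimately have "\<psi> 1 = t \<bullet> \<alpha> 1" by (auto simp: Hom_def)
  then show ?thesis using t by blast
qed

text \<open>The relation described at the beginning.  Here \<open>J\<close> is the injective row of \<open>A\<close>, the object \<open>B\<close> is
the first one of \<open>\<gamma>\<close>, and \<open>\<Psi>\<close> will be the class of the last component of an extension \<open>\<psi>\<close> of \<open>g\<close>.\<close>

lemma standard_angle_relations:
  assumes J: "is_inj_seq E n X A J" and \<gamma>: "\<gamma> \<in> X"
    and \<phi>: "is_path_mor E (n - 1) J \<gamma> \<phi>" and \<phi>n: "\<phi> n = Ident E (obj_at E \<gamma> n)"
    and Jn: "obj_at E \<gamma> n = obj_at E J n"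
    and g: "g \<in> Hom E (obj_at E \<gamma> 1) A"
    and d: "cl (\<phi> 1) \<bullet>\<^bsub>St\<^esub> cl g = int_id St d (obj_at E \<gamma> 1)"
  obtains H \<Psi> where
    "\<And>i. 1 \<le> i \<Longrightarrow> i < n \<Longrightarrow> H i \<in> Hom St (obj_at E \<gamma> (Suc i)) (obj_at E \<gamma> i)"
    "int_id St d (obj_at E \<gamma> 2) = H 2 \<bullet>\<^bsub>St\<^esub> cl (\<gamma> 2)"
    "\<And>i. 3 \<le> i \<Longrightarrow> i < n \<Longrightarrow> int_id St d (obj_at E \<gamma> i) =
      (cl (\<gamma> (i - 1)) \<bullet>\<^bsub>St\<^esub> H (i - 1)) \<boxplus>\<^bsub>St\<^esub> (H i \<bullet>\<^bsub>St\<^esub> cl (\<gamma> i))"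
    "\<Psi> \<in> Hom St (obj_at E \<gamma> n) (obj_at E \<gamma> n)"
    "int_id St d (obj_at E \<gamma> n) = \<Psi> \<boxplus>\<^bsub>St\<^esub> (cl (\<gamma> (n - 1)) \<bullet>\<^bsub>St\<^esub> H (n - 1))"
    "\<Psi> = ZeroMor St (obj_at E \<gamma> n) (obj_at E \<gamma> n) \<Longrightarrow>
      \<exists>s\<in>Hom St (obj_at E \<gamma> 2) A. cl g = s \<bullet>\<^bsub>St\<^esub> cl (\<gamma> 1)"
proof -
  interpret St: preadditive St by (rule St_preadditive)
  let ?c = "obj_at E \<gamma>" and ?j = "obj_at E J"
  have JX: "J \<in> X" and J1: "?j 1 = A" and Jinj: "\<And>i. 2 \<le> i \<Longrightarrow> i < n \<Longrightarrow> ?j i \<in> injectives E X"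
    using J by (auto simp: is_inj_seq_def)
  note \<gamma>h = admissible_Hom[OF \<gamma>]
  have O: "?c i \<in> Obj E" if "1 \<le> i" "i \<le> n" for i using admissible_Obj[OF \<gamma> that] .
  obtain \<psi> where \<psi>: "is_path_mor E (n - 1) \<gamma> J \<psi>" and \<psi>1: "\<psi> 1 = g"
    using extend_to_admissible_path_mor[OF \<gamma> JX Jinj] g J1 n_ge_3 by auto
  have \<phi>h: "\<phi> i \<in> Hom E (?j i) (?c i)" and \<psi>h: "\<psi> i \<in> Hom E (?c i) (?j i)" if "1 \<le> i" "i \<le> n" for i
    using is_path_morD(1)[OF \<phi>] is_path_morD(1)[OF \<psi>] that one_le by auto
  have \<phi>\<psi>h: "\<phi> i \<bullet> \<psi> i \<in> Hom E (?c i) (?c i)" if "1 \<le> i" "i \<le> n" for i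
    using Comp_Hom[OF \<psi>h \<phi>h] that by blast
  have "cl (int_id E d (?c 1)) = cl (\<phi> 1 \<bullet> \<psi> 1)"
    using d class_int_id[OF O[of 1]] St_Comp[OF \<psi>h[of 1] \<phi>h[of 1]] \<psi>1 n_ge_3 by simp
  then have "stably_equal (?c 1) (?c 1) (int_id E d (?c 1)) (\<phi> 1 \<bullet> \<psi> 1)"
    using class_eq_iff[OF int_id_Hom[OF O] \<phi>\<psi>h] n_ge_3 by auto
  from stable_homotopy[OF \<gamma> \<gamma> is_path_mor_int_id[OF admissible_path[OF \<gamma>] one_le(1)]
      is_path_mor_Comp[OF \<psi> \<phi> admissible_path[OF \<gamma>] admissible_path[OF JX] admissible_path[OF \<gamma>]] this]
  obtain h where h1: "h 1 \<in> null (?c 2) (?c 1)"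
    and hh: "\<And>i. 1 \<le> i \<Longrightarrow> i < n \<Longrightarrow> h i \<in> Hom E (?c (Suc i)) (?c i)"
    and hi: "\<And>i. 2 \<le> i \<Longrightarrow> i < n \<Longrightarrow> int_id E d (?c i) =
      ((\<phi> i \<bullet> \<psi> i) \<boxplus> (\<gamma> (i - 1) \<bullet> h (i - 1))) \<boxplus> (h i \<bullet> \<gamma> i)"
    and hn: "int_id E d (?c n) = (\<phi> n \<bullet> \<psi> n) \<boxplus> (\<gamma> (n - 1) \<bullet> h (n - 1))"
    by auto
  define H where "H i = cl (h i)" for i
  have HH: "H i \<in> Hom St (?c (Suc i)) (?c i)" if "1 \<le> i" "i < n" for i
    using class_in_Hom[OF hh[OF that]] by (simp add: H_def)
  have rel: "int_id St d (?c i) =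
      (cl (\<gamma> (i - 1)) \<bullet>\<^bsub>St\<^esub> H (i - 1)) \<boxplus>\<^bsub>St\<^esub> (H i \<bullet>\<^bsub>St\<^esub> cl (\<gamma> i))" if i: "2 \<le> i" "i < n" for i
  proof -
    have "Suc (i - 1) = i" using i by simp
    then have hs: "h (i - 1) \<in> Hom E (?c i) (?c (i - 1))" "\<gamma> (i - 1) \<in> Hom E (?c (i - 1)) (?c i)"
      "h i \<in> Hom E (?c (Suc i)) (?c i)" "\<gamma> i \<in> Hom E (?c i) (?c (Suc i))"
      using hh[of "i - 1"] \<gamma>h[of "i - 1"] hh[of i] \<gamma>h[of i] i by auto
    have p: "\<phi> i \<bullet> \<psi> i \<in> null (?c i) (?c i)" using nullI[OF Jinj \<psi>h \<phi>h] i by auto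
    have "int_id St d (?c i) = cl (int_id E d (?c i))" using class_int_id O i by simp
    also have "\<dots> = (cl (\<phi> i \<bullet> \<psi> i) \<boxplus>\<^bsub>St\<^esub> cl (\<gamma> (i - 1) \<bullet> h (i - 1))) \<boxplus>\<^bsub>St\<^esub> cl (h i \<bullet> \<gamma> i)"
      unfolding hi[OF i]
      using St_Add[OF null_Hom[OF p] Comp_Hom[OF hs(1,2)]]
        St_Add[OF Add_Hom[OF null_Hom[OF p] Comp_Hom[OF hs(1,2)]] Comp_Hom[OF hs(4,3)]] by simp
    also have "cl (\<phi> i \<bullet> \<psi> i) \<boxplus>\<^bsub>St\<^esub> cl (\<gamma> (i - 1) \<bullet> h (i - 1)) = cl (\<gamma> (i - 1) \<bullet> h (i - 1))"
      unfolding class_null[OF p]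
      using class_in_Hom[OF Comp_Hom[OF hs(1,2)]] St.Add_Zero(2) by (simp add: Hom_def)
    finally show ?thesis using St_Comp[OF hs(1,2)] St_Comp[OF hs(4,3)] by (simp add: H_def)
  qed
  have two: "int_id St d (?c 2) = H 2 \<bullet>\<^bsub>St\<^esub> cl (\<gamma> 2)"
  proof -
    have "cl (\<gamma> 1) \<bullet>\<^bsub>St\<^esub> H 1 = ZeroMor St (?c 2) (?c 2)"
      using class_null[OF null_Comp(1)[OF h1, of "\<gamma> 1" "?c 2"]] St_Comp[OF null_Hom[OF h1], of "\<gamma> 1" "?c 2"]
        \<gamma>h[of 1] n_ge_3 by (simp add: H_def numeral_2_eq_2)
    moreover have "H 2 \<bullet>\<^bsub>St\<^esub> cl (\<gamma> 2) \<in> Hom St (?c 2) (?c 2)"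
      using St.Comp_Hom[OF class_in_Hom[OF \<gamma>h] HH] n_ge_3 by simp
    ultimately show ?thesis using rel[of 2] n_ge_3 St.Add_Zero(2) by (simp add: Hom_def)
  qed
  have \<psi>nh: "\<psi> n \<in> Hom E (?c n) (?c n)" using \<psi>h[of n] Jn n_ge_3 by simp
  have last: "int_id St d (?c n) = cl (\<psi> n) \<boxplus>\<^bsub>St\<^esub> (cl (\<gamma> (n - 1)) \<bullet>\<^bsub>St\<^esub> H (n - 1))"
  proof -
    have hs: "h (n - 1) \<in> Hom E (?c n) (?c (n - 1))" "\<gamma> (n - 1) \<in> Hom E (?c (n - 1)) (?c n)"
      using hh[of "n - 1"] \<gamma>h[of "n - 1"] n_ge_3 by auto
    have "int_id E d (?c n) = \<psi> n \<boxplus> (\<gamma> (n - 1) \<bullet> h (n - 1))"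
      using hn \<phi>n Ident_left[OF \<psi>nh] by simp
    moreover have "int_id St d (?c n) = cl (int_id E d (?c n))" using class_int_id O n_ge_3 by simp
    ultimately have "int_id St d (?c n) = cl (\<psi> n) \<boxplus>\<^bsub>St\<^esub> cl (\<gamma> (n - 1) \<bullet> h (n - 1))"
      using St_Add[OF \<psi>nh Comp_Hom[OF hs]] by simp
    then show ?thesis using St_Comp[OF hs] by (simp add: H_def)
  qed
  have factor: "\<exists>s\<in>Hom St (?c 2) A. cl g = s \<bullet>\<^bsub>St\<^esub> cl (\<gamma> 1)" if zero: "cl (\<psi> n) = ZeroMor St (?c n) (?c n)"
  proof -
    obtain t where t: "t \<in> Hom E (?c 2) A" "\<psi> 1 = t \<bullet> \<gamma> 1"
      using first_component_factors[OF \<gamma> JX \<psi>] null_if_class_Zero[OF \<psi>nh zero] Jn J1 by auto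
    have "cl g = cl t \<bullet>\<^bsub>St\<^esub> cl (\<gamma> 1)"
      using St_Comp[OF _ t(1), of "\<gamma> 1" "?c 1"] \<gamma>h[of 1] t(2) \<psi>1 n_ge_3 by (simp add: numeral_2_eq_2)
    then show ?thesis using class_in_Hom[OF t(1)] by blast
  qed
  show thesis
    by (rule that[of H "cl (\<psi> n)"]) (use HH two rel class_in_Hom[OF \<psi>nh] last factor in auto)
qed

text \<open>Extend representatives of \<open>\<theta>\<close> and \<open>\<theta>'\<close> to morphisms \<open>\<phi>\<close>, \<open>\<phi>'\<close> of the chosen injective rows.  Since \<open>\<phi>\<phi>'\<close>
is stably the identity at the left end, it is homotopic to the identity of the row, and at the right
end the homotopy passes through the last injective.\<close>

lemma suspension_split_epi:
  assumes J: "\<And>A. A \<in> Obj E \<Longrightarrow> is_inj_seq E n X A (J A)"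
    and \<theta>: "\<theta> \<in> Hom St A B" and \<theta>': "\<theta>' \<in> Hom St B A" and id: "\<theta> \<bullet>\<^bsub>St\<^esub> \<theta>' = Ident St B"
    and S: "S = stable_suspension E n (injectives E X) J"
    and S\<theta>: "far S \<theta> \<in> Hom St (fob S A) (fob S B)"
  shows "\<exists>\<kappa>\<in>Hom St (fob S B) (fob S A). far S \<theta> \<bullet>\<^bsub>St\<^esub> \<kappa> = Ident St (fob S B)"
proof -
  obtain t where t: "t \<in> Hom E A B" "\<theta> = cl t" using \<theta> by (auto simp: St_Hom)
  obtain t' where t': "t' \<in> Hom E B A" "\<theta>' = cl t'" using \<theta>' by (auto simp: St_Hom)
  have O: "A \<in> Obj E" "B \<in> Obj E" using t(1) Hom_Obj by blast+
  have JA: "J A \<in> X" "obj_at E (J A) 1 = A" "obj_at E (J A) 2 \<in> injectives E X"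
    and JB: "J B \<in> X" "obj_at E (J B) 1 = B" "obj_at E (J B) 2 \<in> injectives E X"
      "obj_at E (J B) (n - 1) \<in> injectives E X"
    using J[OF O(1)] J[OF O(2)] n_ge_3 by (auto simp: is_inj_seq_def)
  obtain \<phi> where \<phi>: "is_path_mor E (n - 1) (J A) (J B) \<phi>" "\<phi> 1 = t"
    using extend_to_admissible_path_mor[OF JA(1) JB(1,3)] t JA JB by metis
  obtain \<phi>' where \<phi>': "is_path_mor E (n - 1) (J B) (J A) \<phi>'" "\<phi>' 1 = t'"
    using extend_to_admissible_path_mor[OF JB(1) JA(1,3)] t' JA JB by metis
  have fob: "fob S A = obj_at E (J A) n" "fob S B = obj_at E (J B) n"
    by (simp_all add: S stable_suspension_def)
  have \<phi>n: "\<phi> n \<in> Hom E (fob S A) (fob S B)" "\<phi>' n \<in> Hom E (fob S B) (fob S A)"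
    using is_path_morD(1)[OF \<phi>(1), of n] is_path_morD(1)[OF \<phi>'(1), of n] fob n_ge_3 by auto
  have "cl (\<phi> n) \<subseteq> far S \<theta>"
    using \<phi> class_self[OF t(1)] t unfolding S stable_suspension_def
    by (auto simp: Hom_def intro!: exI[of _ \<phi>])
  moreover obtain c where c: "c \<in> Hom E (fob S A) (fob S B)" "far S \<theta> = cl c"
    using S\<theta> by (auto simp: St_Hom)
  \<comment> \<open>The value of \<open>\<Sigma>\<close> is a union over all extensions.  Being a single class by hypothesis, it is the
class of the last component of this extension.\<close>
  ultimately have far: "far S \<theta> = cl (\<phi> n)"
    using class_self[OF \<phi>n(1)] class_eqI[OF c(1), of "\<phi> n"] by auto
  have "cl (Ident E B) = cl (\<phi> 1 \<bullet> \<phi>' 1)"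
    using id St_Comp[OF t'(1) t(1)] t t' \<phi> \<phi>' by simp
  then have "stably_equal (obj_at E (J B) 1) (obj_at E (J B) 1) (Ident E (obj_at E (J B) 1)) (\<phi> 1 \<bullet> \<phi>' 1)"
    using class_eq_iff[OF Ident_Hom[OF O(2)] Comp_Hom[OF t'(1) t(1)]] \<phi> \<phi>' JB by simp
  from stable_homotopy[OF JB(1) JB(1) is_path_mor_Ident[OF JB(1)]
      is_path_mor_Comp[OF \<phi>'(1) \<phi>(1) admissible_path[OF JB(1)] admissible_path[OF JA(1)] admissible_path[OF JB(1)]]
      this]
  obtain h where hh: "\<forall>i\<in>{1..n - 1}. h i \<in> Hom E (obj_at E (J B) (Suc i)) (obj_at E (J B) i)"
    and eq: "Ident E (fob S B) = (\<phi> n \<bullet> \<phi>' n) \<boxplus> (J B (n - 1) \<bullet> h (n - 1))"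
    unfolding fob by blast
  have h: "h (n - 1) \<in> Hom E (obj_at E (J B) n) (obj_at E (J B) (n - 1))"
    using bspec[OF hh, of "n - 1"] one_le by auto
  have jn: "J B (n - 1) \<in> Hom E (obj_at E (J B) (n - 1)) (obj_at E (J B) n)"
    using admissible_Hom[OF JB(1), of "n - 1"] n_ge_3 one_le by auto
  have z: "J B (n - 1) \<bullet> h (n - 1) \<in> null (fob S B) (fob S B)"
    unfolding fob by (rule nullI[OF JB(4) h jn])
  have p: "\<phi> n \<bullet> \<phi>' n \<in> Hom E (fob S B) (fob S B)" using Comp_Hom \<phi>n by blast
  have "stably_equal (fob S B) (fob S B) (Ident E (fob S B)) (\<phi> n \<bullet> \<phi>' n)"
    unfolding stably_equal_def
    using z p Ident_Hom[of "fob S B"] Hom_Obj[OF p] Add_commute[OF p null_Hom[OF z]] eq by auto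
  then have "cl (\<phi> n) \<bullet>\<^bsub>St\<^esub> cl (\<phi>' n) = Ident St (fob S B)"
    using class_eq_iff[OF Ident_Hom p] Hom_Obj[OF p] St_Comp[OF \<phi>n(2,1)] by simp
  then show ?thesis using far class_in_Hom[OF \<phi>n(2)] by auto
qed

end

section \<open>Equivalences\<close>

lemma is_functorD:
  assumes "is_functor C D F"
  shows "A \<in> Obj C \<Longrightarrow> fob F A \<in> Obj D"
    "A \<in> Obj C \<Longrightarrow> far F (Ident C A) = Ident D (fob F A)"
    "f \<in> Hom C A B \<Longrightarrow> far F f \<in> Hom D (fob F A) (fob F B)"
    "f \<in> Hom C A B \<Longrightarrow> g \<in> Hom C B B' \<Longrightarrow> far F (g \<bullet>\<^bsub>C\<^esub> f) = far F g \<bullet>\<^bsub>D\<^esub> far F f"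
  using assms by (auto simp: is_functor_def Hom_def)

lemma is_isoE:
  assumes "is_iso C f" "f \<in> Hom C A B"
  obtains g where "g \<in> Hom C B A" "g \<bullet>\<^bsub>C\<^esub> f = Ident C A" "f \<bullet>\<^bsub>C\<^esub> g = Ident C B"
  using assms by (auto simp: is_iso_def Hom_def)

lemma is_nat_isoD:
  assumes "is_nat_iso C D F G \<eta>"
  shows "A \<in> Obj C \<Longrightarrow> \<eta> A \<in> Hom D (fob F A) (fob G A)" "A \<in> Obj C \<Longrightarrow> is_iso D (\<eta> A)"
    "f \<in> Hom C A B \<Longrightarrow> far G f \<bullet>\<^bsub>D\<^esub> \<eta> A = \<eta> B \<bullet>\<^bsub>D\<^esub> far F f"
  using assms by (auto simp: is_nat_iso_def Hom_def)

context category
begin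

lemma iso_cancel_left:
  assumes "is_iso C k" "k \<in> Hom C B D" "f \<in> Hom C A B" "g \<in> Hom C A B" "k \<bullet> f = k \<bullet> g"
  shows "f = g"
proof -
  obtain k' where k': "k' \<in> Hom C D B" "k' \<bullet> k = Ident C B" using is_isoE[OF assms(1,2)] .
  have "f = k' \<bullet> (k \<bullet> f)"
    using Comp_assoc[OF assms(3,2) k'(1)] k'(2) Ident_left[OF assms(3)] by simp
  also have "\<dots> = g"
    using Comp_assoc[OF assms(4,2) k'(1)] k'(2) Ident_left[OF assms(4)] assms(5) by simp
  finally show ?thesis .
qed

lemma iso_cancel_right:
  assumes "is_iso C k" "k \<in> Hom C D A" "f \<in> Hom C A B" "g \<in> Hom C A B" "f \<bullet> k = g \<bullet> k"
  shows "f = g"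
proof -
  obtain k' where k': "k' \<in> Hom C A D" "k \<bullet> k' = Ident C A" using is_isoE[OF assms(1,2)] .
  have "f = (f \<bullet> k) \<bullet> k'"
    using Comp_assoc[OF k'(1) assms(2,3)] k'(2) Ident_right[OF assms(3)] by simp
  also have "\<dots> = g"
    using Comp_assoc[OF k'(1) assms(2,4)] k'(2) Ident_right[OF assms(4)] assms(5) by simp
  finally show ?thesis .
qed

end

text \<open>Faithfulness is needed twice, for an equivalence and for its quasi-inverse, where the natural
isomorphism points in the other direction; hence the two versions.\<close>

lemma faithful_if_left_inverse:
  assumes C: "category C" and \<eta>: "is_nat_iso C C id_functor (comp_functor H G) \<eta>"
    and f: "f \<in> Hom C A B" and g: "g \<in> Hom C A B" and eq: "far G f = far G g"
  shows "f = g"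
proof -
  interpret category C by (rule C)
  have B: "\<eta> B \<in> Hom C B (fob H (fob G B))" "is_iso C (\<eta> B)"
    using \<eta> Hom_Obj[OF f] by (auto simp: is_nat_iso_def id_functor_def comp_functor_def)
  have "\<eta> B \<bullet>\<^bsub>C\<^esub> f = \<eta> B \<bullet>\<^bsub>C\<^esub> g"
    using is_nat_isoD(3)[OF \<eta> f] is_nat_isoD(3)[OF \<eta> g] eq
    by (simp add: id_functor_def comp_functor_def)
  then show ?thesis using iso_cancel_left[OF B(2,1) f g] by blast
qed

lemma faithful_if_right_inverse:
  assumes C: "category C" and \<epsilon>: "is_nat_iso C C (comp_functor H G) id_functor \<epsilon>"
    and f: "f \<in> Hom C A B" and g: "g \<in> Hom C A B" and eq: "far G f = far G g"
  shows "f = g"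
proof -
  interpret category C by (rule C)
  have A: "\<epsilon> A \<in> Hom C (fob H (fob G A)) A" "is_iso C (\<epsilon> A)"
    using \<epsilon> Hom_Obj[OF f] by (auto simp: is_nat_iso_def id_functor_def comp_functor_def)
  have "f \<bullet>\<^bsub>C\<^esub> \<epsilon> A = g \<bullet>\<^bsub>C\<^esub> \<epsilon> A"
    using is_nat_isoD(3)[OF \<epsilon> f] is_nat_isoD(3)[OF \<epsilon> g] eq
    by (simp add: id_functor_def comp_functor_def)
  then show ?thesis using iso_cancel_right[OF A(2,1) f g] by blast
qed

text \<open>A preimage of \<open>h\<close> is the conjugate of \<open>H h\<close> by the natural isomorphism; that \<open>G\<close> sends it to \<open>h\<close>
follows because \<open>H\<close> is faithful.\<close>

lemma equivalence_bij_betw_Hom: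
  assumes C: "category C" and D: "category D" and G: "is_equivalence C D G"
    and O: "A \<in> Obj C" "B \<in> Obj C"
  shows "bij_betw (far G) (Hom C A B) (Hom D (fob G A) (fob G B))"
proof -
  interpret C: category C by (rule C)
  interpret D: category D by (rule D)
  obtain H \<eta> \<epsilon> where F: "is_functor C D G" "is_functor D C H"
    and \<eta>: "is_nat_iso C C id_functor (comp_functor H G) \<eta>"
    and \<epsilon>: "is_nat_iso D D (comp_functor G H) id_functor \<epsilon>"
    using G by (auto simp: is_equivalence_def)
  have \<eta>h: "\<eta> A \<in> Hom C A (fob H (fob G A))" "is_iso C (\<eta> A)"
      "\<eta> B \<in> Hom C B (fob H (fob G B))" "is_iso C (\<eta> B)"
    using \<eta> O by (auto simp: is_nat_iso_def id_functor_def comp_functor_def)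
  obtain k where k: "k \<in> Hom C (fob H (fob G B)) B" "\<eta> B \<bullet>\<^bsub>C\<^esub> k = Ident C (fob H (fob G B))"
    using is_isoE[OF \<eta>h(4,3)] .
  have "h \<in> far G ` Hom C A B" if h: "h \<in> Hom D (fob G A) (fob G B)" for h
  proof -
    have Hh: "far H h \<in> Hom C (fob H (fob G A)) (fob H (fob G B))" by (rule is_functorD(3)[OF F(2) h])
    have Hh\<eta>: "far H h \<bullet>\<^bsub>C\<^esub> \<eta> A \<in> Hom C A (fob H (fob G B))" by (rule C.Comp_Hom[OF \<eta>h(1) Hh])
    define f where "f = k \<bullet>\<^bsub>C\<^esub> (far H h \<bullet>\<^bsub>C\<^esub> \<eta> A)"
    have f: "f \<in> Hom C A B" unfolding f_def by (rule C.Comp_Hom[OF Hh\<eta> k(1)])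
    have "far H (far G f) \<bullet>\<^bsub>C\<^esub> \<eta> A = \<eta> B \<bullet>\<^bsub>C\<^esub> f"
      using is_nat_isoD(3)[OF \<eta> f] by (simp add: id_functor_def comp_functor_def)
    also have "\<dots> = far H h \<bullet>\<^bsub>C\<^esub> \<eta> A"
      unfolding f_def using C.Comp_assoc[OF Hh\<eta> k(1) \<eta>h(3)] k(2) C.Ident_left[OF Hh\<eta>] by simp
    finally have "far H (far G f) = far H h"
      using C.iso_cancel_right[OF \<eta>h(2,1) is_functorD(3)[OF F(2) is_functorD(3)[OF F(1) f]] Hh] by blast
    then have "far G f = h"
      using faithful_if_right_inverse[OF D \<epsilon> is_functorD(3)[OF F(1) f] h] by blast
    then show ?thesis using f by blast
  qed
  moreover have "inj_on (far G) (Hom C A B)"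
    using faithful_if_left_inverse[OF C \<eta>] by (auto intro!: inj_onI)
  ultimately show ?thesis using is_functorD(3)[OF F(1)] by (auto simp: bij_betw_def)
qed

section \<open>The obstruction\<close>

text \<open>A sequence \<open>\<Delta>\<close> of maps \<open>Y\<^sub>1 \<rightarrow> Y\<^sub>2 \<rightarrow> \<dots> \<rightarrow> Y\<^sub>n\<^sub>+\<^sub>1\<close> which the maps \<open>\<theta>\<^sub>i : Z \<rightarrow> Y\<^sub>i\<close> identify with the sequence
of multiplications by \<open>p\<close> on an object \<open>Z\<close> with endomorphism ring \<open>R\<close>, via \<open>e\<close>.  The maps \<open>\<theta>\<^sub>1, \<dots>, \<theta>\<^sub>n\<close>
are isomorphisms with inverses \<open>\<theta>'\<^sub>i\<close>, while \<open>\<theta>\<^sub>n\<^sub>+\<^sub>1\<close> is only a split epimorphism, because it involves a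
suspended morphism.\<close>

locale ring_angle = D: preadditive D + R: cring R
  for D :: "('o, 'm) cat" and R :: "('a, 'x) ring_scheme" +
  fixes n :: nat and p u :: 'a and d :: int and Z :: 'o and e :: "'a \<Rightarrow> 'm"
    and Y :: "nat \<Rightarrow> 'o" and \<theta> \<theta>' \<Delta> :: "nat \<Rightarrow> 'm"
  assumes n: "3 \<le> n" "odd n"
    and pu: "p \<in> carrier R" "u \<in> carrier R" "p \<otimes>\<^bsub>R\<^esub> p = \<zero>\<^bsub>R\<^esub>"
    and d_eq: "[d] \<cdot>\<^bsub>R\<^esub> \<one>\<^bsub>R\<^esub> = p \<otimes>\<^bsub>R\<^esub> u" and d_nonzero: "[d] \<cdot>\<^bsub>R\<^esub> \<one>\<^bsub>R\<^esub> \<noteq> \<zero>\<^bsub>R\<^esub>"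
    and Z: "Z \<in> Obj D"
    and e_bij: "bij_betw e (carrier R) (Hom D Z Z)"
    and e_add: "r \<in> carrier R \<Longrightarrow> s \<in> carrier R \<Longrightarrow> e (r \<oplus>\<^bsub>R\<^esub> s) = e r \<boxplus>\<^bsub>D\<^esub> e s"
    and e_mult: "r \<in> carrier R \<Longrightarrow> s \<in> carrier R \<Longrightarrow> e (r \<otimes>\<^bsub>R\<^esub> s) = e r \<bullet>\<^bsub>D\<^esub> e s"
    and e_one: "e \<one>\<^bsub>R\<^esub> = Ident D Z"
    and \<theta>: "1 \<le> i \<Longrightarrow> i \<le> Suc n \<Longrightarrow> \<theta> i \<in> Hom D Z (Y i)"
    and \<theta>': "1 \<le> i \<Longrightarrow> i \<le> Suc n \<Longrightarrow> \<theta>' i \<in> Hom D (Y i) Z"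
    and \<theta>\<theta>': "1 \<le> i \<Longrightarrow> i \<le> Suc n \<Longrightarrow> \<theta> i \<bullet>\<^bsub>D\<^esub> \<theta>' i = Ident D (Y i)"
    and \<theta>'\<theta>: "1 \<le> i \<Longrightarrow> i \<le> n \<Longrightarrow> \<theta>' i \<bullet>\<^bsub>D\<^esub> \<theta> i = Ident D Z"
    and \<Delta>: "1 \<le> i \<Longrightarrow> i \<le> n \<Longrightarrow> \<Delta> i \<in> Hom D (Y i) (Y (Suc i))"
    and \<Delta>\<theta>: "1 \<le> i \<Longrightarrow> i \<le> n \<Longrightarrow> \<Delta> i \<bullet>\<^bsub>D\<^esub> \<theta> i = \<theta> (Suc i) \<bullet>\<^bsub>D\<^esub> e p"
begin

lemma e_Hom: "r \<in> carrier R \<Longrightarrow> e r \<in> Hom D Z Z"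
  using e_bij by (auto simp: bij_betw_def)

lemma coordinate:
  assumes "1 \<le> i" "i \<le> n" "F \<in> Hom D Z (Y i)"
  obtains x where "x \<in> carrier R" "F = \<theta> i \<bullet>\<^bsub>D\<^esub> e x"
proof -
  have i: "i \<le> Suc n" using assms by simp
  have "\<theta>' i \<bullet>\<^bsub>D\<^esub> F \<in> Hom D Z Z" by (rule D.Comp_Hom[OF assms(3) \<theta>'[OF assms(1) i]])
  then obtain x where x: "x \<in> carrier R" "\<theta>' i \<bullet>\<^bsub>D\<^esub> F = e x"
    using e_bij by (auto simp: bij_betw_def image_iff)
  have "F = \<theta> i \<bullet>\<^bsub>D\<^esub> (\<theta>' i \<bullet>\<^bsub>D\<^esub> F)"
    using D.Comp_assoc[OF assms(3) \<theta>'[OF assms(1) i] \<theta>[OF assms(1) i]] \<theta>\<theta>'[OF assms(1) i]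
      D.Ident_left[OF assms(3)] by simp
  then show thesis using that x by simp
qed

lemma coordinate_unique:
  assumes i: "1 \<le> i" "i \<le> n" and xy: "x \<in> carrier R" "y \<in> carrier R"
    and eq: "\<theta> i \<bullet>\<^bsub>D\<^esub> e x = \<theta> i \<bullet>\<^bsub>D\<^esub> e y"
  shows "x = y"
proof -
  have i': "i \<le> Suc n" using i by simp
  have "e z = \<theta>' i \<bullet>\<^bsub>D\<^esub> (\<theta> i \<bullet>\<^bsub>D\<^esub> e z)" if "z \<in> carrier R" for z
    using D.Comp_assoc[OF e_Hom[OF that] \<theta>[OF i(1) i'] \<theta>'[OF i(1) i']] \<theta>'\<theta>[OF i]
      D.Ident_left[OF e_Hom[OF that]] by simp
  then have "e x = e y" using eq xy by metis
  then show ?thesis using e_bij xy by (auto simp: bij_betw_def inj_on_def)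
qed

lemma dR: "[d] \<cdot>\<^bsub>R\<^esub> \<one>\<^bsub>R\<^esub> \<in> carrier R"
  using d_eq pu by simp

lemma int_id_Z: "int_id D d Z = e ([d] \<cdot>\<^bsub>R\<^esub> \<one>\<^bsub>R\<^esub>)"
proof -
  interpret G: comm_group "hom_group D Z Z" using D.Hom_group Z by blast
  have "e \<in> hom (add_monoid R) (hom_group D Z Z)"
    using e_Hom e_add by (auto simp: hom_def)
  then have "e (\<one>\<^bsub>R\<^esub> [^]\<^bsub>add_monoid R\<^esub> d) = e \<one>\<^bsub>R\<^esub> [^]\<^bsub>hom_group D Z Z\<^esub> d"
    by (rule hom_int_pow) (use R.add.is_group G.is_group in auto)
  then show ?thesis by (simp add: int_id_def e_one add_pow_def)
qed

lemma int_id_\<theta>: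
  assumes "1 \<le> i" "i \<le> Suc n"
  shows "int_id D d (Y i) \<bullet>\<^bsub>D\<^esub> \<theta> i = \<theta> i \<bullet>\<^bsub>D\<^esub> e ([d] \<cdot>\<^bsub>R\<^esub> \<one>\<^bsub>R\<^esub>)"
  using D.int_id_comp[OF \<theta>[OF assms], of d] int_id_Z by simp

text \<open>The map that corresponds to \<open>u\<close>.  As \<open>\<Delta>\<^sub>1\<close> corresponds to \<open>p\<close> and \<open>p u = d\<close>, the composite \<open>\<Delta>\<^sub>1 g\<close> is
multiplication by \<open>d\<close>.\<close>

definition g where "g = (\<theta> 1 \<bullet>\<^bsub>D\<^esub> e u) \<bullet>\<^bsub>D\<^esub> \<theta>' 2"

lemma \<theta>e_Hom: "1 \<le> i \<Longrightarrow> i \<le> Suc n \<Longrightarrow> r \<in> carrier R \<Longrightarrow> \<theta> i \<bullet>\<^bsub>D\<^esub> e r \<in> Hom D Z (Y i)"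
  using D.Comp_Hom e_Hom \<theta> by blast

lemma g_Hom: "g \<in> Hom D (Y 2) (Y 1)"
  unfolding g_def using D.Comp_Hom[OF \<theta>'[of 2] \<theta>e_Hom[of 1 u]] n pu by simp

lemma \<Delta>\<theta>e:
  assumes i: "1 \<le> i" "i \<le> n" and r: "r \<in> carrier R"
  shows "\<Delta> i \<bullet>\<^bsub>D\<^esub> (\<theta> i \<bullet>\<^bsub>D\<^esub> e r) = \<theta> (Suc i) \<bullet>\<^bsub>D\<^esub> e (p \<otimes>\<^bsub>R\<^esub> r)"
proof -
  have "\<Delta> i \<bullet>\<^bsub>D\<^esub> (\<theta> i \<bullet>\<^bsub>D\<^esub> e r) = (\<theta> (Suc i) \<bullet>\<^bsub>D\<^esub> e p) \<bullet>\<^bsub>D\<^esub> e r"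
    using D.Comp_assoc[OF e_Hom[OF r] \<theta> \<Delta>[OF i]] \<Delta>\<theta>[OF i] i by simp
  also have "\<dots> = \<theta> (Suc i) \<bullet>\<^bsub>D\<^esub> (e p \<bullet>\<^bsub>D\<^esub> e r)"
    using D.Comp_assoc[OF e_Hom[OF r] e_Hom[OF pu(1)] \<theta>[of "Suc i"]] i by simp
  finally show ?thesis using e_mult[OF pu(1) r] by simp
qed

lemma \<Delta>g: "\<Delta> 1 \<bullet>\<^bsub>D\<^esub> g = int_id D d (Y 2)"
proof -
  have h: "\<theta>' 2 \<in> Hom D (Y 2) Z" "\<theta> 2 \<in> Hom D Z (Y 2)" "\<theta> 1 \<bullet>\<^bsub>D\<^esub> e u \<in> Hom D Z (Y 1)"
    "\<Delta> 1 \<in> Hom D (Y 1) (Y 2)"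
    using \<theta>[of 2] \<theta>'[of 2] \<theta>e_Hom[of 1 u] \<Delta>[of 1] n pu by (auto simp: numeral_2_eq_2)
  have i: "int_id D d (Y 2) \<in> Hom D (Y 2) (Y 2)" using D.int_id_Hom D.Hom_Obj[OF h(2)] by blast
  have "\<Delta> 1 \<bullet>\<^bsub>D\<^esub> g = (\<Delta> 1 \<bullet>\<^bsub>D\<^esub> (\<theta> 1 \<bullet>\<^bsub>D\<^esub> e u)) \<bullet>\<^bsub>D\<^esub> \<theta>' 2"
    unfolding g_def by (rule D.Comp_assoc[OF h(1,3,4), symmetric])
  also have "\<Delta> 1 \<bullet>\<^bsub>D\<^esub> (\<theta> 1 \<bullet>\<^bsub>D\<^esub> e u) = int_id D d (Y 2) \<bullet>\<^bsub>D\<^esub> \<theta> 2"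
    using \<Delta>\<theta>e[of 1 u] n pu(2) int_id_\<theta>[of 2] d_eq by (simp add: numeral_2_eq_2)
  also have "(int_id D d (Y 2) \<bullet>\<^bsub>D\<^esub> \<theta> 2) \<bullet>\<^bsub>D\<^esub> \<theta>' 2 = int_id D d (Y 2)"
    using D.Comp_assoc[OF h(1,2) i] \<theta>\<theta>'[of 2] n D.Ident_right[OF i] by simp
  finally show ?thesis .
qed

text \<open>The indices are shifted by one against \<open>standard_angle_relations\<close>: the row \<open>\<gamma>\<close> consists of
\<open>\<Delta>\<^sub>2, \<dots>, \<Delta>\<^sub>n\<close>, so \<open>\<gamma>\<^sub>i\<close> starts at \<open>Y\<^sub>i\<^sub>+\<^sub>1\<close>.  In coordinates \<open>x\<^sub>i\<close> of \<open>H\<^sub>i\<close> the relations make \<open>p x\<^sub>i\<close>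
alternate between \<open>d\<close> and \<open>0\<close>.  The parity of \<open>n\<close> decides that \<open>p x\<^sub>n\<^sub>-\<^sub>1\<close> is \<open>d\<close>, which forces \<open>\<Psi> = 0\<close>,
and then \<open>u\<close> is divisible by \<open>p\<close>.\<close>

lemma relations_contradiction:
  assumes H: "\<And>i. 2 \<le> i \<Longrightarrow> i < n \<Longrightarrow> H i \<in> Hom D (Y (i + 2)) (Y (i + 1))"
    and H2: "int_id D d (Y 3) = H 2 \<bullet>\<^bsub>D\<^esub> \<Delta> 3"
    and Hi: "\<And>i. 3 \<le> i \<Longrightarrow> i < n \<Longrightarrow> int_id D d (Y (i + 1)) =
      (\<Delta> i \<bullet>\<^bsub>D\<^esub> H (i - 1)) \<boxplus>\<^bsub>D\<^esub> (H i \<bullet>\<^bsub>D\<^esub> \<Delta> (i + 1))"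
    and \<Psi>: "\<Psi> \<in> Hom D (Y (n + 1)) (Y (n + 1))"
    and Hn: "int_id D d (Y (n + 1)) = \<Psi> \<boxplus>\<^bsub>D\<^esub> (\<Delta> n \<bullet>\<^bsub>D\<^esub> H (n - 1))"
    and s: "\<Psi> = ZeroMor D (Y (n + 1)) (Y (n + 1)) \<Longrightarrow> \<exists>s\<in>Hom D (Y 3) (Y 1). g = s \<bullet>\<^bsub>D\<^esub> \<Delta> 2"
  shows False
proof -
  let ?d = "[d] \<cdot>\<^bsub>R\<^esub> \<one>\<^bsub>R\<^esub>"
  have "\<exists>x. x \<in> carrier R \<and> H i \<bullet>\<^bsub>D\<^esub> \<theta> (i + 2) = \<theta> (i + 1) \<bullet>\<^bsub>D\<^esub> e x" if i: "2 \<le> i" "i < n" for i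
    using coordinate[OF _ _ D.Comp_Hom[OF \<theta>[of "i + 2"] H[OF i]]] i by auto
  then obtain x where xR: "\<And>i. 2 \<le> i \<Longrightarrow> i < n \<Longrightarrow> x i \<in> carrier R"
    and x: "\<And>i. 2 \<le> i \<Longrightarrow> i < n \<Longrightarrow> H i \<bullet>\<^bsub>D\<^esub> \<theta> (i + 2) = \<theta> (i + 1) \<bullet>\<^bsub>D\<^esub> e (x i)"
    by metis
  have H\<Delta>: "(H i \<bullet>\<^bsub>D\<^esub> \<Delta> (i + 1)) \<bullet>\<^bsub>D\<^esub> \<theta> (i + 1) = \<theta> (i + 1) \<bullet>\<^bsub>D\<^esub> e (p \<otimes>\<^bsub>R\<^esub> x i)" if i: "2 \<le> i" "i < n" for i
  proof -
    have h: "\<theta> (i + 1) \<in> Hom D Z (Y (i + 1))" "\<Delta> (i + 1) \<in> Hom D (Y (i + 1)) (Y (i + 2))"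
      "\<theta> (i + 2) \<in> Hom D Z (Y (i + 2))"
      using \<theta>[of "i + 1"] \<Delta>[of "i + 1"] \<theta>[of "i + 2"] i by auto
    have "(H i \<bullet>\<^bsub>D\<^esub> \<Delta> (i + 1)) \<bullet>\<^bsub>D\<^esub> \<theta> (i + 1) = H i \<bullet>\<^bsub>D\<^esub> (\<theta> (i + 2) \<bullet>\<^bsub>D\<^esub> e p)"
      using D.Comp_assoc[OF h(1,2) H[OF i]] \<Delta>\<theta>[of "i + 1"] i by simp
    also have "\<dots> = \<theta> (i + 1) \<bullet>\<^bsub>D\<^esub> (e (x i) \<bullet>\<^bsub>D\<^esub> e p)"
      using D.Comp_assoc[OF e_Hom[OF pu(1)] h(3) H[OF i]] x[OF i]
        D.Comp_assoc[OF e_Hom[OF pu(1)] e_Hom[OF xR[OF i]] h(1)] by simp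
    also have "e (x i) \<bullet>\<^bsub>D\<^esub> e p = e (p \<otimes>\<^bsub>R\<^esub> x i)"
      using e_mult[OF xR[OF i] pu(1)] R.m_comm[OF xR[OF i] pu(1)] by simp
    finally show ?thesis .
  qed
  have \<Delta>H: "(\<Delta> (i + 1) \<bullet>\<^bsub>D\<^esub> H i) \<bullet>\<^bsub>D\<^esub> \<theta> (i + 2) = \<theta> (i + 2) \<bullet>\<^bsub>D\<^esub> e (p \<otimes>\<^bsub>R\<^esub> x i)" if i: "2 \<le> i" "i < n" for i
    using D.Comp_assoc[OF \<theta>[of "i + 2"] H[OF i] \<Delta>[of "i + 1"]] x[OF i] \<Delta>\<theta>e[of "i + 1" "x i"] xR[OF i] i
    by simp
  have Hpred: "H (i - 1) \<in> Hom D (Y (Suc i)) (Y i)" if "3 \<le> i" "i \<le> n" for i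
  proof -
    have "i - 1 + 2 = Suc i" "i - 1 + 1 = i" "2 \<le> i - 1" "i - 1 < n" using that by auto
    then show ?thesis using H[of "i - 1"] by simp
  qed
  have first: "p \<otimes>\<^bsub>R\<^esub> x 2 = ?d"
  proof (rule coordinate_unique[of 3, symmetric])
    show "\<theta> 3 \<bullet>\<^bsub>D\<^esub> e ?d = \<theta> 3 \<bullet>\<^bsub>D\<^esub> e (p \<otimes>\<^bsub>R\<^esub> x 2)"
      using H\<Delta>[of 2] int_id_\<theta>[of 3] H2 n by (simp add: numeral_3_eq_3 numeral_2_eq_2)
  qed (use n dR pu xR in auto)
  have sum: "?d = (p \<otimes>\<^bsub>R\<^esub> x (i - 1)) \<oplus>\<^bsub>R\<^esub> (p \<otimes>\<^bsub>R\<^esub> x i)" if i: "3 \<le> i" "i < n" for i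
  proof (rule coordinate_unique[of "i + 1"])
    have [simp]: "Suc (i - Suc 0) = i" using i by simp
    have xx: "x (i - 1) \<in> carrier R" "x i \<in> carrier R" using xR i by auto
    have h: "\<theta> (i + 1) \<in> Hom D Z (Y (i + 1))" using \<theta> i by simp
    have hs: "\<Delta> i \<bullet>\<^bsub>D\<^esub> H (i - 1) \<in> Hom D (Y (i + 1)) (Y (i + 1))"
      "H i \<bullet>\<^bsub>D\<^esub> \<Delta> (i + 1) \<in> Hom D (Y (i + 1)) (Y (i + 1))"
      using D.Comp_Hom[OF Hpred[of i] \<Delta>[of i]] D.Comp_Hom[OF _ H[of i], of "\<Delta> (i + 1)" "Y (i + 1)"]
        \<Delta>[of "i + 1"] i by auto
    have "\<theta> (i + 1) \<bullet>\<^bsub>D\<^esub> e ?d = int_id D d (Y (i + 1)) \<bullet>\<^bsub>D\<^esub> \<theta> (i + 1)"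
      using int_id_\<theta>[of "i + 1"] i by simp
    also have "\<dots> = ((\<Delta> i \<bullet>\<^bsub>D\<^esub> H (i - 1)) \<bullet>\<^bsub>D\<^esub> \<theta> (i + 1)) \<boxplus>\<^bsub>D\<^esub> ((H i \<bullet>\<^bsub>D\<^esub> \<Delta> (i + 1)) \<bullet>\<^bsub>D\<^esub> \<theta> (i + 1))"
      unfolding Hi[OF i] by (rule D.Comp_Add_left[OF h hs])
    also have "\<dots> = (\<theta> (i + 1) \<bullet>\<^bsub>D\<^esub> e (p \<otimes>\<^bsub>R\<^esub> x (i - 1))) \<boxplus>\<^bsub>D\<^esub> (\<theta> (i + 1) \<bullet>\<^bsub>D\<^esub> e (p \<otimes>\<^bsub>R\<^esub> x i))"
      using \<Delta>H[of "i - 1"] H\<Delta>[of i] i by simp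
    also have "\<dots> = \<theta> (i + 1) \<bullet>\<^bsub>D\<^esub> e ((p \<otimes>\<^bsub>R\<^esub> x (i - 1)) \<oplus>\<^bsub>R\<^esub> (p \<otimes>\<^bsub>R\<^esub> x i))"
      using D.Comp_Add_right[OF e_Hom e_Hom h] e_add pu(1) xx by simp
    finally show "\<theta> (i + 1) \<bullet>\<^bsub>D\<^esub> e ?d = \<theta> (i + 1) \<bullet>\<^bsub>D\<^esub> e ((p \<otimes>\<^bsub>R\<^esub> x (i - 1)) \<oplus>\<^bsub>R\<^esub> (p \<otimes>\<^bsub>R\<^esub> x i))" .
  qed (use i dR pu xR in auto)
  have alt: "p \<otimes>\<^bsub>R\<^esub> x i = (if even i then ?d else \<zero>\<^bsub>R\<^esub>)" if "2 \<le> i" "i < n" for i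
    using that
  proof (induction i rule: dec_induct)
    case base
    then show ?case using first by simp
  next
    case (step i)
    have "?d = (p \<otimes>\<^bsub>R\<^esub> x i) \<oplus>\<^bsub>R\<^esub> (p \<otimes>\<^bsub>R\<^esub> x (Suc i))" using sum[of "Suc i"] step by simp
    moreover have "p \<otimes>\<^bsub>R\<^esub> x (Suc i) \<in> carrier R" using pu xR[of "Suc i"] step by simp
    ultimately show ?case using step R.l_zero dR
      by (cases "even i") (auto simp: R.add.r_cancel_one)
  qed
  \<comment> \<open>This is where \<open>n\<close> is odd.\<close>
  have "p \<otimes>\<^bsub>R\<^esub> x (n - 1) = ?d" using alt[of "n - 1"] n by simp
  then have \<Delta>n: "(\<Delta> n \<bullet>\<^bsub>D\<^esub> H (n - 1)) \<bullet>\<^bsub>D\<^esub> \<theta> (n + 1) = \<theta> (n + 1) \<bullet>\<^bsub>D\<^esub> e ?d"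
    using \<Delta>H[of "n - 1"] n by simp
  have h: "\<theta> (n + 1) \<in> Hom D Z (Y (n + 1))" "\<theta>' (n + 1) \<in> Hom D (Y (n + 1)) Z" using \<theta> \<theta>' by simp_all
  have hd: "\<theta> (n + 1) \<bullet>\<^bsub>D\<^esub> e ?d \<in> Hom D Z (Y (n + 1))" using \<theta>e_Hom[of "n + 1"] dR by simp
  have \<Delta>Hn: "\<Delta> n \<bullet>\<^bsub>D\<^esub> H (n - 1) \<in> Hom D (Y (n + 1)) (Y (n + 1))"
    using D.Comp_Hom[OF Hpred[of n] \<Delta>[of n]] n by simp
  have \<Psi>\<theta>: "\<Psi> \<bullet>\<^bsub>D\<^esub> \<theta> (n + 1) \<in> Hom D Z (Y (n + 1))" by (rule D.Comp_Hom[OF h(1) \<Psi>])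
  have "(\<Psi> \<bullet>\<^bsub>D\<^esub> \<theta> (n + 1)) \<boxplus>\<^bsub>D\<^esub> (\<theta> (n + 1) \<bullet>\<^bsub>D\<^esub> e ?d) = \<theta> (n + 1) \<bullet>\<^bsub>D\<^esub> e ?d"
    using int_id_\<theta>[of "n + 1"] D.Comp_Add_left[OF h(1) \<Psi> \<Delta>Hn] \<Delta>n Hn by simp
  then have "\<Psi> \<bullet>\<^bsub>D\<^esub> \<theta> (n + 1) = ZeroMor D Z (Y (n + 1))"
    using D.Add_eq_right_imp_Zero[OF \<Psi>\<theta> hd] by blast
  then have "\<Psi> \<bullet>\<^bsub>D\<^esub> (\<theta> (n + 1) \<bullet>\<^bsub>D\<^esub> \<theta>' (n + 1)) = ZeroMor D (Y (n + 1)) (Y (n + 1))"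
    using D.Comp_assoc[OF h(2,1) \<Psi>] D.Comp_Zero(1)[OF h(2)] D.Hom_Obj[OF \<Psi>] by simp
  then have "\<Psi> = ZeroMor D (Y (n + 1)) (Y (n + 1))"
    using \<theta>\<theta>'[of "n + 1"] D.Ident_right[OF \<Psi>] by simp
  then obtain s where s: "s \<in> Hom D (Y 3) (Y 1)" "g = s \<bullet>\<^bsub>D\<^esub> \<Delta> 2" using s by blast
  have hs: "\<theta> 2 \<in> Hom D Z (Y 2)" "\<theta> 3 \<in> Hom D Z (Y 3)" "\<Delta> 2 \<in> Hom D (Y 2) (Y 3)" "\<theta>' 2 \<in> Hom D (Y 2) Z"
    "\<theta> 1 \<bullet>\<^bsub>D\<^esub> e u \<in> Hom D Z (Y 1)" "\<theta> 1 \<in> Hom D Z (Y 1)"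
    using \<theta>[of 2] \<theta>[of 3] \<theta>[of 1] \<Delta>[of 2] \<theta>'[of 2] \<theta>e_Hom[of 1 u] n pu by (auto simp: numeral_3_eq_3 numeral_2_eq_2)
  obtain y where y: "y \<in> carrier R" "s \<bullet>\<^bsub>D\<^esub> \<theta> 3 = \<theta> 1 \<bullet>\<^bsub>D\<^esub> e y"
    using coordinate[of 1, OF _ _ D.Comp_Hom[OF hs(2) s(1)]] n by auto
  have "\<theta> 1 \<bullet>\<^bsub>D\<^esub> e u = g \<bullet>\<^bsub>D\<^esub> \<theta> 2"
    unfolding g_def using D.Comp_assoc[OF hs(1,4,5)] \<theta>'\<theta>[of 2] n D.Ident_right[OF hs(5)] by simp
  also have "\<dots> = s \<bullet>\<^bsub>D\<^esub> (\<theta> 3 \<bullet>\<^bsub>D\<^esub> e p)"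
    using D.Comp_assoc[OF hs(1,3) s(1)] s(2) \<Delta>\<theta>[of 2] n by (simp add: numeral_3_eq_3 numeral_2_eq_2)
  also have "\<dots> = \<theta> 1 \<bullet>\<^bsub>D\<^esub> (e y \<bullet>\<^bsub>D\<^esub> e p)"
    using D.Comp_assoc[OF e_Hom[OF pu(1)] hs(2) s(1)] y(2)
      D.Comp_assoc[OF e_Hom[OF pu(1)] e_Hom[OF y(1)] hs(6)] by simp
  finally have "u = y \<otimes>\<^bsub>R\<^esub> p"
    using coordinate_unique[of 1 u "y \<otimes>\<^bsub>R\<^esub> p"] e_mult[OF y(1) pu(1)] y(1) pu n by simp
  then have "?d = y \<otimes>\<^bsub>R\<^esub> (p \<otimes>\<^bsub>R\<^esub> p)"
    using d_eq y(1) pu(1) by (simp add: R.m_lcomm)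
  then show False using d_nonzero pu(3) y(1) by simp
qed

end

text \<open>The theorem for any category with an object \<open>M\<close> whose endomorphism ring is \<open>R\<close> and for which the
multiplications by \<open>p\<close> on \<open>M\<close> form an \<open>n\<close>-angle: fullness and faithfulness of the equivalence
identify \<open>R\<close> with the endomorphism ring of the image of \<open>M\<close>, so that the relations of
\<open>standard_angle_relations\<close> are refuted by \<open>relations_contradiction\<close>.\<close>

lemma not_algebraic_if_scalar_angle:
  fixes C :: "('c, 'd) cat" and R :: "('a, 'x) ring_scheme" and d :: int
  assumes C: "category C" and R: "cring R" and n: "3 \<le> n" "odd n"
    and pu: "p \<in> carrier R" "u \<in> carrier R" "p \<otimes>\<^bsub>R\<^esub> p = \<zero>\<^bsub>R\<^esub>"
    and d: "[d] \<cdot>\<^bsub>R\<^esub> \<one>\<^bsub>R\<^esub> = p \<otimes>\<^bsub>R\<^esub> u" "[d] \<cdot>\<^bsub>R\<^esub> \<one>\<^bsub>R\<^esub> \<noteq> \<zero>\<^bsub>R\<^esub>"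
    and M: "M \<in> Obj C" and bij: "bij_betw sc (carrier R) (Hom C M M)"
    and sc_add: "\<And>r s. r \<in> carrier R \<Longrightarrow> s \<in> carrier R \<Longrightarrow> sc (r \<oplus>\<^bsub>R\<^esub> s) = sc r \<boxplus>\<^bsub>C\<^esub> sc s"
    and sc_mult: "\<And>r s. r \<in> carrier R \<Longrightarrow> s \<in> carrier R \<Longrightarrow> sc (r \<otimes>\<^bsub>R\<^esub> s) = sc r \<bullet>\<^bsub>C\<^esub> sc s"
    and sc_one: "sc \<one>\<^bsub>R\<^esub> = Ident C M"
    and N: "(\<lambda>i. sc p) \<in> N"
  shows "\<not> algebraic TYPE('o) TYPE('m) n C id_functor N"
proof
  assume "algebraic TYPE('o) TYPE('m) n C id_functor N"
  then obtain E :: "('o, 'm) cat" and X J where "frobenius_category E n X"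
    and J: "\<And>A. A \<in> Obj E \<Longrightarrow> is_inj_seq E n X A (J A)"
    and equiv: "angulated_equivalent n C id_functor N (stable_category E (injectives E X))
      (stable_suspension E n (injectives E X) J) (natural_angulation E n X J)"
    by (auto simp: algebraic_def)
  then interpret F: frobenius_category E n X by simp
  define D where "D = stable_category E (injectives E X)"
  define T where "T = stable_suspension E n (injectives E X) J"
  interpret D: preadditive D unfolding D_def by (rule F.St_preadditive)
  have scp: "sc p \<in> Hom C M M" using bij pu by (auto simp: bij_betw_def)
  obtain G \<eta> where G: "is_additive_functor C D G" "is_equivalence C D G"
    and \<eta>: "is_nat_iso C D (comp_functor G id_functor) (comp_functor T G) \<eta>"
    and angle: "image_seq D n G (\<eta> (obj_at C (\<lambda>i. sc p) 1)) (\<lambda>i. sc p) \<in> natural_angulation E n X J"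
    using equiv N unfolding angulated_equivalent_def D_def T_def by blast
  have GF: "is_functor C D G" using G by (simp add: is_additive_functor_def)
  define Z where "Z = fob G M"
  define e where "e = far G \<circ> sc"
  define \<delta> where "\<delta> = image_seq D n G (\<eta> M) (\<lambda>i. sc p)"
  have ZD: "Z \<in> Obj D" unfolding Z_def by (rule is_functorD(1)[OF GF M])
  have e_bij: "bij_betw e (carrier R) (Hom D Z Z)"
    unfolding e_def Z_def
    by (rule bij_betw_trans[OF bij equivalence_bij_betw_Hom[OF C D.category_axioms G(2) M M]])
  have e_add: "e (r \<oplus>\<^bsub>R\<^esub> s) = e r \<boxplus>\<^bsub>D\<^esub> e s" and e_mult: "e (r \<otimes>\<^bsub>R\<^esub> s) = e r \<bullet>\<^bsub>D\<^esub> e s"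
    if "r \<in> carrier R" "s \<in> carrier R" for r s
  proof -
    have "sc r \<in> Hom C M M" "sc s \<in> Hom C M M" using bij that by (auto simp: bij_betw_def)
    then show "e (r \<oplus>\<^bsub>R\<^esub> s) = e r \<boxplus>\<^bsub>D\<^esub> e s" "e (r \<otimes>\<^bsub>R\<^esub> s) = e r \<bullet>\<^bsub>D\<^esub> e s"
      using G(1) M that sc_add sc_mult is_functorD(4)[OF GF]
      by (auto simp: e_def is_additive_functor_def)
  qed
  have e_one: "e \<one>\<^bsub>R\<^esub> = Ident D Z" using is_functorD(2)[OF GF M] sc_one by (simp add: e_def Z_def)
  have ep: "e p \<in> Hom D Z Z" using e_bij pu by (auto simp: bij_betw_def)
  have \<eta>M: "\<eta> M \<in> Hom D Z (fob T Z)" "is_iso D (\<eta> M)"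
    using is_nat_isoD(1,2)[OF \<eta> M] by (simp_all add: comp_functor_def id_functor_def Z_def)
  have \<delta>_lt: "\<delta> i = e p" if "i \<noteq> n" for i using that by (simp add: \<delta>_def image_seq_def e_def)
  have \<delta>_n: "\<delta> n = \<eta> M \<bullet>\<^bsub>D\<^esub> e p" by (simp add: \<delta>_def image_seq_def e_def)
  have obj\<delta>: "obj_at D \<delta> i = Z" if "1 \<le> i" "i \<le> n" for i
    using that n \<delta>_lt[of 1] \<delta>_lt[of "i - 1"] ep by (auto simp: obj_at_def Hom_def)
  have "obj_at C (\<lambda>i. sc p) 1 = M" using scp by (simp add: obj_at_def Hom_def)
  then have "\<delta> \<in> natural_angulation E n X J" using angle by (simp add: \<delta>_def)
  then obtain \<delta>' where \<delta>': "\<delta>' \<in> standard_angles E n X J" and iso: "sigma_isomorphic D T n \<delta> \<delta>'"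
    by (auto simp: natural_angulation_def D_def T_def)
  then obtain f \<gamma> \<phi> where f: "f \<in> Arr E" and \<gamma>: "\<gamma> \<in> X"
    and \<gamma>1: "obj_at E \<gamma> 1 = Cod E f" and \<gamma>n: "obj_at E \<gamma> n = obj_at E (J (Dom E f)) n"
    and \<phi>: "is_path_mor E (n - 1) (J (Dom E f)) \<gamma> \<phi>" "\<phi> 1 = f" "\<phi> n = Ident E (obj_at E \<gamma> n)"
    and \<delta>'_eq: "\<delta>' = (\<lambda>i. F.cl (if i = 1 then f else \<gamma> (i - 1)))"
    by (auto simp: standard_angles_def)
  obtain \<psi> where \<psi>: "is_sigma_mor D T n \<delta> \<delta>' \<psi>" and \<psi>_iso: "\<And>i. 1 \<le> i \<Longrightarrow> i \<le> n \<Longrightarrow> is_iso D (\<psi> i)"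
    and seq: "is_sigma_seq D T n \<delta>" "is_sigma_seq D T n \<delta>'"
    using iso by (auto simp: sigma_isomorphic_def)
  define Y where "Y = obj_at D \<delta>'"
  have \<psi>_mor: "is_path_mor D n \<delta> \<delta>' \<psi>" and \<psi>_last: "\<psi> (Suc n) = far T (\<psi> 1)"
    using \<psi> by (auto simp: is_sigma_mor_def)
  have \<psi>h: "\<psi> i \<in> Hom D Z (Y i)" if "1 \<le> i" "i \<le> n" for i
    using is_path_morD(1)[OF \<psi>_mor, of i] that obj\<delta>[OF that] by (simp add: Y_def)
  have Y_last: "Y (Suc n) = fob T (Y 1)" using seq(2) by (simp add: is_sigma_seq_def Y_def)
  have T\<psi>: "far T (\<psi> 1) \<in> Hom D (fob T Z) (fob T (Y 1))"
    using is_path_morD(1)[OF \<psi>_mor, of "Suc n"] \<psi>_last seq(1) obj\<delta>[of 1] n Y_last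
    by (simp add: is_sigma_seq_def Y_def)
  have \<delta>'h: "\<delta>' i \<in> Hom D (Y i) (Y (Suc i))" if "1 \<le> i" "i \<le> n" for i
    using is_pathD[of D n \<delta>' i] seq(2) that by (simp add: is_sigma_seq_def Y_def)
  obtain \<psi>' where \<psi>'h: "\<And>i. 1 \<le> i \<Longrightarrow> i \<le> n \<Longrightarrow> \<psi>' i \<in> Hom D (Y i) Z"
    and \<psi>'\<psi>: "\<And>i. 1 \<le> i \<Longrightarrow> i \<le> n \<Longrightarrow> \<psi>' i \<bullet>\<^bsub>D\<^esub> \<psi> i = Ident D Z"
    and \<psi>\<psi>': "\<And>i. 1 \<le> i \<Longrightarrow> i \<le> n \<Longrightarrow> \<psi> i \<bullet>\<^bsub>D\<^esub> \<psi>' i = Ident D (Y i)"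
  proof -
    have "\<forall>i. \<exists>k. 1 \<le> i \<and> i \<le> n \<longrightarrow> k \<in> Hom D (Y i) Z \<and> k \<bullet>\<^bsub>D\<^esub> \<psi> i = Ident D Z \<and> \<psi> i \<bullet>\<^bsub>D\<^esub> k = Ident D (Y i)"
      using is_isoE[OF \<psi>_iso \<psi>h] by metis
    then show thesis using that by metis
  qed
  have n1: "1 \<le> (1::nat)" "1 \<le> n" using n by auto
  obtain \<kappa> where \<kappa>: "\<kappa> \<in> Hom D (fob T (Y 1)) (fob T Z)" "far T (\<psi> 1) \<bullet>\<^bsub>D\<^esub> \<kappa> = Ident D (fob T (Y 1))"
    using F.suspension_split_epi[OF J \<psi>h[OF n1, unfolded D_def] \<psi>'h[OF n1, unfolded D_def]
        \<psi>\<psi>'[OF n1, unfolded D_def] T_def T\<psi>[unfolded D_def]]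
    unfolding D_def by blast
  obtain \<eta>' where \<eta>': "\<eta>' \<in> Hom D (fob T Z) Z" "\<eta> M \<bullet>\<^bsub>D\<^esub> \<eta>' = Ident D (fob T Z)"
    using is_isoE[OF \<eta>M(2,1)] .
  \<comment> \<open>The last object of the image of the angle is \<open>\<Sigma>Z\<close>; the natural isomorphism \<open>\<eta>\<close> leads to it from \<open>Z\<close>.\<close>
  define \<theta> where "\<theta> i = (if i = Suc n then far T (\<psi> 1) \<bullet>\<^bsub>D\<^esub> \<eta> M else \<psi> i)" for i
  define \<theta>' where "\<theta>' i = (if i = Suc n then \<eta>' \<bullet>\<^bsub>D\<^esub> \<kappa> else \<psi>' i)" for i
  interpret cring R by (rule R)
  interpret A: ring_angle D R n p u d Z e Y \<theta> \<theta>' \<delta>'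
  proof (intro ring_angle.intro ring_angle_axioms.intro)
    fix i assume i: "1 \<le> i" "i \<le> Suc n"
    show "\<theta> i \<in> Hom D Z (Y i)"
      using \<psi>h[of i] D.Comp_Hom[OF \<eta>M(1) T\<psi>] Y_last i by (auto simp: \<theta>_def)
    show "\<theta>' i \<in> Hom D (Y i) Z"
      using \<psi>'h[of i] D.Comp_Hom[OF \<kappa>(1) \<eta>'(1)] Y_last i by (auto simp: \<theta>'_def)
    have "(far T (\<psi> 1) \<bullet>\<^bsub>D\<^esub> \<eta> M) \<bullet>\<^bsub>D\<^esub> (\<eta>' \<bullet>\<^bsub>D\<^esub> \<kappa>) = far T (\<psi> 1) \<bullet>\<^bsub>D\<^esub> ((\<eta> M \<bullet>\<^bsub>D\<^esub> \<eta>') \<bullet>\<^bsub>D\<^esub> \<kappa>)"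
      using D.Comp_assoc[OF D.Comp_Hom[OF \<kappa>(1) \<eta>'(1)] \<eta>M(1) T\<psi>] D.Comp_assoc[OF \<kappa>(1) \<eta>'(1) \<eta>M(1)] by simp
    then show "\<theta> i \<bullet>\<^bsub>D\<^esub> \<theta>' i = Ident D (Y i)"
      using \<psi>\<psi>'[of i] \<eta>'(2) \<kappa> D.Ident_left[OF \<kappa>(1)] Y_last i by (auto simp: \<theta>_def \<theta>'_def)
  next
    fix i assume i: "1 \<le> i" "i \<le> n"
    show "\<theta>' i \<bullet>\<^bsub>D\<^esub> \<theta> i = Ident D Z" using \<psi>'\<psi> i by (simp add: \<theta>_def \<theta>'_def)
    show "\<delta>' i \<in> Hom D (Y i) (Y (Suc i))" by (rule \<delta>'h[OF i])
    have "\<delta>' i \<bullet>\<^bsub>D\<^esub> \<psi> i = \<psi> (Suc i) \<bullet>\<^bsub>D\<^esub> \<delta> i" using is_path_morD(2)[OF \<psi>_mor i] by simp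
    then show "\<delta>' i \<bullet>\<^bsub>D\<^esub> \<theta> i = \<theta> (Suc i) \<bullet>\<^bsub>D\<^esub> e p"
      using i \<delta>_lt[of i] \<delta>_n \<psi>_last D.Comp_assoc[OF ep \<eta>M(1) T\<psi>]
      by (cases "i = n") (auto simp: \<theta>_def)
  qed (use D.preadditive_axioms R n pu d ZD e_bij e_add e_mult e_one in auto)
  have fh: "f \<in> Hom E (Dom E f) (Cod E f)" using f by (simp add: Hom_def)
  have Y1: "Y 1 = Dom E f" using F.St_Dom_Cod[OF fh] by (simp add: Y_def obj_at_def \<delta>'_eq D_def)
  have Y_Suc: "Y (Suc i) = obj_at E \<gamma> i" if i: "1 \<le> i" "i \<le> n" for i
  proof (cases "i = 1")
    case True
    then show ?thesis using F.St_Dom_Cod(2)[OF fh] \<gamma>1 by (simp add: Y_def obj_at_def \<delta>'_eq D_def)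
  next
    case False
    then have "\<gamma> (i - 1) \<in> Hom E (obj_at E \<gamma> (i - 1)) (obj_at E \<gamma> i)"
      using F.admissible_Hom[OF \<gamma>, of "i - 1"] i by auto
    moreover have "Y (Suc i) = Cod D (F.cl (\<gamma> (i - 1)))"
      using False i unfolding Y_def obj_at_def \<delta>'_eq by simp
    ultimately show ?thesis using F.St_Dom_Cod(2) unfolding D_def by metis
  qed
  have \<delta>'_Suc: "\<delta>' (Suc i) = F.cl (\<gamma> i)" if "1 \<le> i" for i using that by (simp add: \<delta>'_eq)
  have \<delta>'_1: "\<delta>' 1 = F.cl f" by (simp add: \<delta>'_eq)
  have Y2: "Y 2 = obj_at E \<gamma> 1" using Y_Suc[of 1] n by (simp add: numeral_2_eq_2)
  obtain g where g: "g \<in> Hom E (obj_at E \<gamma> 1) (Dom E f)" "A.g = F.cl g"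
    using A.g_Hom Y1 Y2 by (auto simp: D_def F.St_Hom)
  have "F.cl (\<phi> 1) \<bullet>\<^bsub>D\<^esub> F.cl g = int_id D d (obj_at E \<gamma> 1)"
    using A.\<Delta>g \<delta>'_1 \<phi>(2) g(2) Y2 by simp
  then obtain H \<Psi> where H: "\<And>i. 1 \<le> i \<Longrightarrow> i < n \<Longrightarrow> H i \<in> Hom D (obj_at E \<gamma> (Suc i)) (obj_at E \<gamma> i)"
    and H2: "int_id D d (obj_at E \<gamma> 2) = H 2 \<bullet>\<^bsub>D\<^esub> F.cl (\<gamma> 2)"
    and Hi: "\<And>i. 3 \<le> i \<Longrightarrow> i < n \<Longrightarrow> int_id D d (obj_at E \<gamma> i) =
      (F.cl (\<gamma> (i - 1)) \<bullet>\<^bsub>D\<^esub> H (i - 1)) \<boxplus>\<^bsub>D\<^esub> (H i \<bullet>\<^bsub>D\<^esub> F.cl (\<gamma> i))"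
    and \<Psi>: "\<Psi> \<in> Hom D (obj_at E \<gamma> n) (obj_at E \<gamma> n)"
    and Hn: "int_id D d (obj_at E \<gamma> n) = \<Psi> \<boxplus>\<^bsub>D\<^esub> (F.cl (\<gamma> (n - 1)) \<bullet>\<^bsub>D\<^esub> H (n - 1))"
    and s: "\<Psi> = ZeroMor D (obj_at E \<gamma> n) (obj_at E \<gamma> n) \<Longrightarrow>
      \<exists>s\<in>Hom D (obj_at E \<gamma> 2) (Dom E f). F.cl g = s \<bullet>\<^bsub>D\<^esub> F.cl (\<gamma> 1)"
    using F.standard_angle_relations[OF J[OF F.Dom_Obj[OF f]] \<gamma> \<phi>(1,3) \<gamma>n g(1)]
    unfolding D_def by metis
  show False
  proof (rule A.relations_contradiction[of H \<Psi>])
    fix i assume i: "2 \<le> i" "i < n"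
    then show "H i \<in> Hom D (Y (i + 2)) (Y (i + 1))"
      using H[of i] Y_Suc[of i] Y_Suc[of "Suc i"] by simp
  next
    show "int_id D d (Y 3) = H 2 \<bullet>\<^bsub>D\<^esub> \<delta>' 3"
      using H2 Y_Suc[of 2] \<delta>'_Suc[of 2] n by (simp add: numeral_3_eq_3 numeral_2_eq_2)
  next
    fix i assume i: "3 \<le> i" "i < n"
    have "\<delta>' i = F.cl (\<gamma> (i - 1))" "\<delta>' (i + 1) = F.cl (\<gamma> i)" "Y (i + 1) = obj_at E \<gamma> i"
      using \<delta>'_Suc[of "i - 1"] \<delta>'_Suc[of i] Y_Suc[of i] i by auto
    then show "int_id D d (Y (i + 1)) = (\<delta>' i \<bullet>\<^bsub>D\<^esub> H (i - 1)) \<boxplus>\<^bsub>D\<^esub> (H i \<bullet>\<^bsub>D\<^esub> \<delta>' (i + 1))"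
      using Hi[OF i] by simp
  next
    have Yn: "Y (n + 1) = obj_at E \<gamma> n" "\<delta>' n = F.cl (\<gamma> (n - 1))"
      using Y_Suc[of n] \<delta>'_Suc[of "n - 1"] n by auto
    show "\<Psi> \<in> Hom D (Y (n + 1)) (Y (n + 1))" using \<Psi> Yn by simp
    show "int_id D d (Y (n + 1)) = \<Psi> \<boxplus>\<^bsub>D\<^esub> (\<delta>' n \<bullet>\<^bsub>D\<^esub> H (n - 1))" using Hn Yn by simp
    assume "\<Psi> = ZeroMor D (Y (n + 1)) (Y (n + 1))"
    then have "\<exists>s\<in>Hom D (obj_at E \<gamma> 2) (Dom E f). F.cl g = s \<bullet>\<^bsub>D\<^esub> F.cl (\<gamma> 1)" using s Yn by simp
    then show "\<exists>s\<in>Hom D (Y 3) (Y 1). A.g = s \<bullet>\<^bsub>D\<^esub> \<delta>' 2"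
      using Y_Suc[of 2] \<delta>'_Suc[of 1] Y1 g(2) n by (simp add: numeral_3_eq_3 numeral_2_eq_2)
  qed
qed

section \<open>Free modules\<close>

lemma free_modules_simps [simp]:
  "M \<in> Obj (free_modules R) \<longleftrightarrow> fg_free R M"
  "(M, N, f) \<in> Arr (free_modules R) \<longleftrightarrow> fg_free R M \<and> fg_free R N \<and> f \<in> linear_maps R M N"
  "Dom (free_modules R) (M, N, f) = M" "Cod (free_modules R) (M, N, f) = N"
  "Ident (free_modules R) M = (M, M, \<lambda>x\<in>carrier M. x)"
  "Comp (free_modules R) (L', N', g) (M, L, f) = (M, N', compose (carrier M) g f)"
  "Add (free_modules R) (M, N, f) (M', N'', g') = (M, N, \<lambda>x\<in>carrier M. f x \<oplus>\<^bsub>N\<^esub> g' x)"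
  "ZeroMor (free_modules R) M N = (M, N, \<lambda>x\<in>carrier M. \<zero>\<^bsub>N\<^esub>)"
  by (simp_all add: free_modules_def)

lemma Hom_free_modules:
  "F \<in> Hom (free_modules R) M N \<longleftrightarrow>
    (\<exists>f. F = (M, N, f) \<and> fg_free R M \<and> fg_free R N \<and> f \<in> linear_maps R M N)"
  by (cases F) (auto simp: Hom_def)

lemma linear_mapsD:
  assumes "f \<in> linear_maps R M N"
  shows "f \<in> carrier M \<rightarrow>\<^sub>E carrier N" "x \<in> carrier M \<Longrightarrow> f x \<in> carrier N"
    "x \<in> carrier M \<Longrightarrow> y \<in> carrier M \<Longrightarrow> f (x \<oplus>\<^bsub>M\<^esub> y) = f x \<oplus>\<^bsub>N\<^esub> f y"
    "a \<in> carrier R \<Longrightarrow> x \<in> carrier M \<Longrightarrow> f (a \<odot>\<^bsub>M\<^esub> x) = a \<odot>\<^bsub>N\<^esub> f x"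
  using assms by (auto simp: linear_maps_def)

lemma fg_free_module: "fg_free R M \<Longrightarrow> module R M"
  by (simp add: fg_free_def)

lemma module_closed:
  assumes "module R M"
  shows "x \<in> carrier M \<Longrightarrow> y \<in> carrier M \<Longrightarrow> x \<oplus>\<^bsub>M\<^esub> y \<in> carrier M"
    "a \<in> carrier R \<Longrightarrow> x \<in> carrier M \<Longrightarrow> a \<odot>\<^bsub>M\<^esub> x \<in> carrier M" "\<zero>\<^bsub>M\<^esub> \<in> carrier M"
proof -
  interpret module R M by (rule assms)
  show "x \<in> carrier M \<Longrightarrow> y \<in> carrier M \<Longrightarrow> x \<oplus>\<^bsub>M\<^esub> y \<in> carrier M"
    "a \<in> carrier R \<Longrightarrow> x \<in> carrier M \<Longrightarrow> a \<odot>\<^bsub>M\<^esub> x \<in> carrier M" "\<zero>\<^bsub>M\<^esub> \<in> carrier M" by auto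
qed

lemma linear_maps_compose:
  assumes "f \<in> linear_maps R M N" "g \<in> linear_maps R N L" "module R M"
  shows "compose (carrier M) g f \<in> linear_maps R M L"
  using linear_mapsD[OF assms(1)] linear_mapsD[OF assms(2)] module_closed[OF assms(3)]
  unfolding linear_maps_def by (auto simp: compose_def)

lemma linear_maps_id: "module R M \<Longrightarrow> (\<lambda>x\<in>carrier M. x) \<in> linear_maps R M M"
  using module_closed by (fastforce simp: linear_maps_def)

lemma linear_maps_zero:
  assumes "module R M" "module R N"
  shows "(\<lambda>x\<in>carrier M. \<zero>\<^bsub>N\<^esub>) \<in> linear_maps R M N"
proof -
  interpret N: module R N by (rule assms)
  show ?thesis using module_closed[OF assms(1)] by (auto simp: linear_maps_def)
qed

lemma linear_maps_scalar:
  assumes "module R M" "r \<in> carrier R"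
  shows "(\<lambda>x\<in>carrier M. r \<odot>\<^bsub>M\<^esub> x) \<in> linear_maps R M M"
proof -
  interpret M: module R M by (rule assms)
  have "r \<odot>\<^bsub>M\<^esub> (a \<odot>\<^bsub>M\<^esub> x) = a \<odot>\<^bsub>M\<^esub> (r \<odot>\<^bsub>M\<^esub> x)" if "a \<in> carrier R" "x \<in> carrier M" for a x
    using that assms(2) M.m_comm by (simp flip: M.smult_assoc1)
  then show ?thesis
    using assms(2) by (auto simp: linear_maps_def M.smult_r_distr)
qed

lemma free_modules_category: "category (free_modules R)"
proof
  fix F assume F: "F \<in> Arr (free_modules R)"
  then show "Dom (free_modules R) F \<in> Obj (free_modules R)" "Cod (free_modules R) F \<in> Obj (free_modules R)"
    by (cases F; simp)+
next
  fix M assume "M \<in> Obj (free_modules R)"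
  then show "Ident (free_modules R) M \<in> Hom (free_modules R) M M"
    using linear_maps_id fg_free_module by (auto simp: Hom_free_modules)
next
  fix F M N assume "F \<in> Hom (free_modules R) M N"
  then obtain f where F: "F = (M, N, f)" "fg_free R M" "fg_free R N" "f \<in> linear_maps R M N"
    by (auto simp: Hom_free_modules)
  note f = linear_mapsD(1,2)[OF F(4)]
  show "F \<bullet>\<^bsub>free_modules R\<^esub> Ident (free_modules R) M = F"
    "Ident (free_modules R) N \<bullet>\<^bsub>free_modules R\<^esub> F = F"
    using f F(1) by (auto simp: compose_def PiE_def extensional_def)
  fix G L assume "G \<in> Hom (free_modules R) N L"
  then obtain g where G: "G = (N, L, g)" "fg_free R L" "g \<in> linear_maps R N L"
    by (auto simp: Hom_free_modules)
  show "G \<bullet>\<^bsub>free_modules R\<^esub> F \<in> Hom (free_modules R) M L"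
    using F G linear_maps_compose[OF F(4) G(3) fg_free_module[OF F(2)]] by (simp add: Hom_free_modules)
  fix H K assume "H \<in> Hom (free_modules R) L K"
  then obtain h where H: "H = (L, K, h)" by (auto simp: Hom_free_modules)
  show "(H \<bullet>\<^bsub>free_modules R\<^esub> G) \<bullet>\<^bsub>free_modules R\<^esub> F = H \<bullet>\<^bsub>free_modules R\<^esub> (G \<bullet>\<^bsub>free_modules R\<^esub> F)"
    using F(1) G(1) H f by (auto simp: compose_def)
qed

definition trivial_module :: "'b \<Rightarrow> ('a, 'b) module" where
  "trivial_module z = \<lparr>carrier = {z}, mult = (\<lambda>x y. z), one = z, zero = z, add = (\<lambda>x y. z),
    smult = (\<lambda>a x. z)\<rparr>"

lemma trivial_module_simps [simp]:
  "carrier (trivial_module z) = {z}" "\<zero>\<^bsub>trivial_module z\<^esub> = z" "x \<oplus>\<^bsub>trivial_module z\<^esub> y = z"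
  "a \<odot>\<^bsub>trivial_module z\<^esub> x = z"
  by (simp_all add: trivial_module_def)

lemma trivial_module_free:
  assumes "cring R"
  shows "fg_free R (trivial_module z)"
proof -
  have m: "module R (trivial_module z)"
    by (intro moduleI abelian_groupI assms) simp_all
  then interpret module R "trivial_module z" .
  show ?thesis
    unfolding fg_free_def using m by (intro conjI exI[of _ "{}"]) auto
qed

text \<open>The regular module, transported along \<open>j\<close> to the type over which the modules range.  The
multiplication and unit are required by the record type of modules.\<close>

definition regular_module :: "('a, 'x) ring_scheme \<Rightarrow> ('a \<Rightarrow> 'b) \<Rightarrow> ('a, 'b) module" where
  "regular_module R j = (let k = inv_into (carrier R) j in
    \<lparr>carrier = j ` carrier R, mult = (\<lambda>x y. j (k x \<otimes>\<^bsub>R\<^esub> k y)), one = j \<one>\<^bsub>R\<^esub>, zero = j \<zero>\<^bsub>R\<^esub>,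
     add = (\<lambda>x y. j (k x \<oplus>\<^bsub>R\<^esub> k y)), smult = (\<lambda>a x. j (a \<otimes>\<^bsub>R\<^esub> k x))\<rparr>)"

locale regular_module_copy = R: cring R
  for R :: "('a, 'x) ring_scheme" +
  fixes j :: "'a \<Rightarrow> 'b"
  assumes j: "inj_on j (carrier R)"
begin

abbreviation "M \<equiv> regular_module R j"

lemma M_simps [simp]:
  "carrier M = j ` carrier R" "\<zero>\<^bsub>M\<^esub> = j \<zero>\<^bsub>R\<^esub>"
  "x \<in> carrier R \<Longrightarrow> y \<in> carrier R \<Longrightarrow> j x \<oplus>\<^bsub>M\<^esub> j y = j (x \<oplus>\<^bsub>R\<^esub> y)"
  "x \<in> carrier R \<Longrightarrow> a \<odot>\<^bsub>M\<^esub> j x = j (a \<otimes>\<^bsub>R\<^esub> x)"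
  using j by (simp_all add: regular_module_def Let_def)

lemma j_eq [simp]: "x \<in> carrier R \<Longrightarrow> y \<in> carrier R \<Longrightarrow> j x = j y \<longleftrightarrow> x = y"
  using j by (auto simp: inj_on_def)

lemma M_module: "module R M"
proof (intro moduleI abelian_groupI)
  fix x assume "x \<in> carrier M"
  then obtain a where a: "a \<in> carrier R" "x = j a" by auto
  then have "\<ominus>\<^bsub>R\<^esub> a \<in> carrier R" "j (\<ominus>\<^bsub>R\<^esub> a) \<oplus>\<^bsub>M\<^esub> x = \<zero>\<^bsub>M\<^esub>"
    using R.l_neg[of a] by simp_all
  then show "\<exists>y\<in>carrier M. y \<oplus>\<^bsub>M\<^esub> x = \<zero>\<^bsub>M\<^esub>" by (intro bexI[of _ "j (\<ominus>\<^bsub>R\<^esub> a)"]) simp_all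
qed (auto simp: R.a_assoc R.a_comm R.a_lcomm R.l_distr R.r_distr R.m_assoc R.is_cring)

lemma M_free: "fg_free R M"
proof -
  interpret module R M by (rule M_module)
  have sum: "(\<Oplus>\<^bsub>M\<^esub>b\<in>{j \<one>\<^bsub>R\<^esub>}. c b \<odot>\<^bsub>M\<^esub> b) = j (c (j \<one>\<^bsub>R\<^esub>))" if "c \<in> {j \<one>\<^bsub>R\<^esub>} \<rightarrow>\<^sub>E carrier R" for c
  proof -
    have c: "c (j \<one>\<^bsub>R\<^esub>) \<in> carrier R" using that by auto
    then show ?thesis using M.finsum_insert[of "{}" "j \<one>\<^bsub>R\<^esub>" "\<lambda>b. c b \<odot>\<^bsub>M\<^esub> b"] by (simp add: Pi_def)
  qed
  have "\<exists>!c. c \<in> {j \<one>\<^bsub>R\<^esub>} \<rightarrow>\<^sub>E carrier R \<and> x = (\<Oplus>\<^bsub>M\<^esub>b\<in>{j \<one>\<^bsub>R\<^esub>}. c b \<odot>\<^bsub>M\<^esub> b)" if x: "x \<in> carrier M" for x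
  proof -
    obtain a where a: "a \<in> carrier R" "x = j a" using x by auto
    let ?c = "\<lambda>b\<in>{j \<one>\<^bsub>R\<^esub>}. a"
    show ?thesis
    proof (rule ex1I[of _ ?c])
      have c: "?c \<in> {j \<one>\<^bsub>R\<^esub>} \<rightarrow>\<^sub>E carrier R" using a by auto
      then show "?c \<in> {j \<one>\<^bsub>R\<^esub>} \<rightarrow>\<^sub>E carrier R \<and> x = (\<Oplus>\<^bsub>M\<^esub>b\<in>{j \<one>\<^bsub>R\<^esub>}. ?c b \<odot>\<^bsub>M\<^esub> b)"
        using sum[OF c] a by simp
    next
      fix c assume c: "c \<in> {j \<one>\<^bsub>R\<^esub>} \<rightarrow>\<^sub>E carrier R \<and> x = (\<Oplus>\<^bsub>M\<^esub>b\<in>{j \<one>\<^bsub>R\<^esub>}. c b \<odot>\<^bsub>M\<^esub> b)"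
      then have "j a = j (c (j \<one>\<^bsub>R\<^esub>))" using sum[of c] a by simp
      moreover have "c (j \<one>\<^bsub>R\<^esub>) \<in> carrier R" using c by auto
      ultimately have "c (j \<one>\<^bsub>R\<^esub>) = a" using a by simp
      then show "c = ?c" using c by (auto simp: PiE_def extensional_def)
    qed
  qed
  then show ?thesis
    unfolding fg_free_def using M_module by (intro conjI exI[of _ "{j \<one>\<^bsub>R\<^esub>}"]) auto
qed

definition scalar :: "'a \<Rightarrow> ('a, 'b) module \<times> ('a, 'b) module \<times> ('b \<Rightarrow> 'b)" where
  "scalar r = (M, M, \<lambda>x\<in>carrier M. r \<odot>\<^bsub>M\<^esub> x)"

text \<open>A linear endomorphism is determined by the image of the generator \<open>j 1\<close>, hence is multiplication by
a scalar; here commutativity of \<open>R\<close> makes the scalars linear.\<close>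

lemma scalar_bij: "bij_betw scalar (carrier R) (Hom (free_modules R) M M)"
  unfolding bij_betw_def
proof
  show "inj_on scalar (carrier R)"
  proof (rule inj_onI)
    fix r s assume rs: "r \<in> carrier R" "s \<in> carrier R" "scalar r = scalar s"
    then have "(\<lambda>x\<in>carrier M. r \<odot>\<^bsub>M\<^esub> x) (j \<one>\<^bsub>R\<^esub>) = (\<lambda>x\<in>carrier M. s \<odot>\<^bsub>M\<^esub> x) (j \<one>\<^bsub>R\<^esub>)"
      by (simp add: scalar_def)
    then show "r = s" using rs by simp
  qed
  show "scalar ` carrier R = Hom (free_modules R) M M"
  proof
    show "scalar ` carrier R \<subseteq> Hom (free_modules R) M M"
      using linear_maps_scalar[OF M_module] M_free by (auto simp: scalar_def Hom_free_modules)
    show "Hom (free_modules R) M M \<subseteq> scalar ` carrier R"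
    proof
      fix F assume "F \<in> Hom (free_modules R) M M"
      then obtain f where F: "F = (M, M, f)" and f: "f \<in> linear_maps R M M"
        by (auto simp: Hom_free_modules)
      obtain s where s: "s \<in> carrier R" "f (j \<one>\<^bsub>R\<^esub>) = j s"
        using linear_mapsD(2)[OF f, of "j \<one>\<^bsub>R\<^esub>"] by auto
      have "f (j a) = s \<odot>\<^bsub>M\<^esub> j a" if a: "a \<in> carrier R" for a
        using linear_mapsD(4)[OF f a, of "j \<one>\<^bsub>R\<^esub>"] s a R.m_comm[of a s] by simp
      then have "f = (\<lambda>x\<in>carrier M. s \<odot>\<^bsub>M\<^esub> x)"
        using linear_mapsD(1)[OF f] by (auto simp: PiE_def extensional_def fun_eq_iff)
      then show "F \<in> scalar ` carrier R" using F s by (auto simp: scalar_def)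
    qed
  qed
qed

lemma scalar_ring_hom:
  assumes "r \<in> carrier R" "s \<in> carrier R"
  shows "scalar (r \<oplus>\<^bsub>R\<^esub> s) = scalar r \<boxplus>\<^bsub>free_modules R\<^esub> scalar s"
    "scalar (r \<otimes>\<^bsub>R\<^esub> s) = scalar r \<bullet>\<^bsub>free_modules R\<^esub> scalar s"
  using assms by (auto simp: scalar_def compose_def restrict_def R.l_distr R.m_assoc fun_eq_iff)

lemma scalar_one: "scalar \<one>\<^bsub>R\<^esub> = Ident (free_modules R) M"
  by (auto simp: scalar_def restrict_def fun_eq_iff)

text \<open>Take the contractible summand to be the zero sequence: then the sequence of multiplications by \<open>p\<close> is
a direct sum of it and itself, with zero and identity maps as structure morphisms.\<close>

lemma mult_seq_free_angle:
  assumes p: "p \<in> carrier R"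
  shows "mult_seq p M \<in> free_angles R p n"
proof -
  let ?C = "free_modules R :: (('a, 'b) module, _) cat" and ?Z = "trivial_module (j \<zero>\<^bsub>R\<^esub>) :: ('a, 'b) module"
  interpret C: category ?C by (rule free_modules_category)
  define \<gamma> where "\<gamma> = (\<lambda>i::nat. Ident ?C ?Z)"
  define \<mu> where "\<mu> = mult_seq p M"
  have \<mu>: "\<mu> i = scalar p" for i by (simp add: \<mu>_def mult_seq_def scalar_def)
  have ph: "scalar p \<in> Hom ?C M M" using scalar_bij p by (auto simp: bij_betw_def)
  have O: "?Z \<in> Obj ?C" "M \<in> Obj ?C" using trivial_module_free R.is_cring M_free by auto
  have \<gamma>: "\<gamma> i = Ident ?C ?Z" for i by (simp only: \<gamma>_def)
  have o\<gamma>: "obj_at ?C \<gamma> i = ?Z" for i by (simp add: obj_at_def \<gamma>_def)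
  have o\<mu>: "obj_at ?C \<mu> i = M" for i using ph by (simp add: obj_at_def \<mu> Hom_def)
  have s\<gamma>: "is_sigma_seq ?C id_functor n \<gamma>"
    using O by (auto simp: is_sigma_seq_def is_path_def o\<gamma> id_functor_def \<gamma> C.Ident_Hom simp del: free_modules_simps)
  have s\<mu>: "is_sigma_seq ?C id_functor n \<mu>"
    using ph by (auto simp: is_sigma_seq_def is_path_def o\<mu> id_functor_def \<mu>)
  have Z0: "ZeroMor ?C ?Z ?Z = Ident ?C ?Z" "Ident ?C ?Z \<bullet>\<^bsub>?C\<^esub> Ident ?C ?Z = Ident ?C ?Z"
    "Ident ?C ?Z \<boxplus>\<^bsub>?C\<^esub> Ident ?C ?Z = Ident ?C ?Z"
    by (auto simp: compose_def restrict_def fun_eq_iff)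
  have contr: "is_contractible ?C id_functor n \<gamma>"
    using s\<gamma> Z0 O unfolding is_contractible_def is_candidate_angle_def is_complex_def is_sigma_seq_def
    by (auto simp: o\<gamma> id_functor_def \<gamma> C.Ident_Hom simp del: free_modules_simps
        intro!: exI[of _ "\<lambda>i. Ident ?C ?Z"])
  define j1 where "j1 = ZeroMor ?C ?Z M"
  define q1 where "q1 = ZeroMor ?C M ?Z"
  have h: "j1 \<in> Hom ?C ?Z M" "q1 \<in> Hom ?C M ?Z"
    using linear_maps_zero[of R ?Z M] linear_maps_zero[of R M ?Z] fg_free_module O
    by (auto simp: j1_def q1_def Hom_free_modules)
  have id: "is_sigma_mor ?C id_functor n \<mu> \<mu> (\<lambda>i. Ident ?C M)"
    using ph O C.Ident_Hom C.Ident_left[OF ph] C.Ident_right[OF ph]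
    by (auto simp: is_sigma_mor_def is_path_mor_def o\<mu> \<mu> id_functor_def simp del: free_modules_simps)
  have eq: "j1 \<bullet>\<^bsub>?C\<^esub> Ident ?C ?Z = scalar p \<bullet>\<^bsub>?C\<^esub> j1" "q1 \<bullet>\<^bsub>?C\<^esub> scalar p = Ident ?C ?Z \<bullet>\<^bsub>?C\<^esub> q1"
    using p by (auto simp: j1_def q1_def scalar_def compose_def restrict_def fun_eq_iff)
  have j1: "is_sigma_mor ?C id_functor n \<gamma> \<mu> (\<lambda>i. j1)" and q1: "is_sigma_mor ?C id_functor n \<mu> \<gamma> (\<lambda>i. q1)"
    using h eq by (auto simp: is_sigma_mor_def is_path_mor_def o\<mu> o\<gamma> \<mu> \<gamma> id_functor_def simp del: free_modules_simps)
  have b: "is_biproduct ?C ?Z M M j1 (Ident ?C M) q1 (Ident ?C M)"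
    unfolding is_biproduct_def
  proof (intro conjI h C.Ident_Hom O)
    show "q1 \<bullet>\<^bsub>?C\<^esub> j1 = Ident ?C ?Z" "Ident ?C M \<bullet>\<^bsub>?C\<^esub> Ident ?C M = Ident ?C M"
      "q1 \<bullet>\<^bsub>?C\<^esub> Ident ?C M = ZeroMor ?C M ?Z" "Ident ?C M \<bullet>\<^bsub>?C\<^esub> j1 = ZeroMor ?C ?Z M"
      "(j1 \<bullet>\<^bsub>?C\<^esub> q1) \<boxplus>\<^bsub>?C\<^esub> (Ident ?C M \<bullet>\<^bsub>?C\<^esub> Ident ?C M) = Ident ?C M"
      by (auto simp: j1_def q1_def compose_def restrict_def fun_eq_iff)
  qed
  have "is_direct_sum ?C id_functor n \<gamma> \<mu> \<mu>"
    unfolding is_direct_sum_def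
    using s\<gamma> s\<mu> j1 q1 id b o\<gamma> o\<mu>
    by (intro conjI exI[of _ "\<lambda>i. j1"] exI[of _ "\<lambda>i. Ident ?C M"] exI[of _ "\<lambda>i. q1"]) auto
  moreover have "is_iso ?C (Ident ?C M)"
    unfolding is_iso_def using O C.Ident_Hom C.Ident_left[OF C.Ident_Hom]
    by (auto simp: Hom_def simp del: free_modules_simps intro!: bexI[of _ "Ident ?C M"])
  then have "sigma_isomorphic ?C id_functor n \<mu> \<mu>"
    unfolding sigma_isomorphic_def using s\<mu> id by blast
  ultimately show ?thesis
    unfolding free_angles_def using contr M_free unfolding \<mu>_def by blast
qed

end

theorem theorem5p2:
  fixes R :: "('a, 'x) ring_scheme" and \<mm> :: "'a set" and p :: 'a and n :: nat and d :: int
    and emb :: "'a list \<Rightarrow> 'b"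
  assumes "local_ring R"
    and "maximalideal \<mm> R"
    and "p \<in> carrier R"
    and "\<mm> = PIdl\<^bsub>R\<^esub> p"
    and "\<mm> \<noteq> {\<zero>\<^bsub>R\<^esub>}"
    and "\<mm> \<cdot>\<^bsub>R\<^esub> \<mm> = {\<zero>\<^bsub>R\<^esub>}"
    and "p \<oplus>\<^bsub>R\<^esub> p = \<zero>\<^bsub>R\<^esub>"
    and universe: "inj_on emb (lists (carrier R))"
    and "n \<ge> 3"
    and "odd n"
    and "[d] \<cdot>\<^bsub>R\<^esub> \<one>\<^bsub>R\<^esub> \<in> \<mm> - {\<zero>\<^bsub>R\<^esub>}"
  shows "\<not> algebraic TYPE('o) TYPE('m) n
    (free_modules R :: (('a, 'b) module, _) cat) id_functor (free_angles R p n)"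
proof -
  interpret R: cring R using assms(1) by (simp add: local_ring_def)
  define j where "j r = emb [r]" for r
  interpret regular_module_copy R j
  proof
    show "inj_on j (carrier R)"
      unfolding j_def by (rule inj_onI) (use inj_onD[OF universe] in force)
  qed
  have "p \<in> \<mm>" using R.cgenideal_self[OF assms(3)] assms(4) by simp
  then have pp: "p \<otimes>\<^bsub>R\<^esub> p = \<zero>\<^bsub>R\<^esub>"
    using ideal_prod.prod[of p \<mm> p \<mm> R] assms(6) by simp
  obtain u where u: "u \<in> carrier R" "[d] \<cdot>\<^bsub>R\<^esub> \<one>\<^bsub>R\<^esub> = p \<otimes>\<^bsub>R\<^esub> u"
    using assms(3,4,11) R.m_comm by (auto simp: cgenideal_def)
  have "(\<lambda>i. scalar p) = mult_seq p M" by (simp add: mult_seq_def scalar_def)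
  then have "(\<lambda>i. scalar p) \<in> free_angles R p n" using mult_seq_free_angle[OF assms(3)] by simp
  then show ?thesis
    using not_algebraic_if_scalar_angle[OF free_modules_category R.is_cring assms(9,10,3) u(1) pp u(2) _
        _ scalar_bij scalar_ring_hom scalar_one] M_free assms(11)
    by auto
qed

end
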